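(* Let $S$ be a parabolic Inoue surface with second Betti number $m>0$. Then: 1) $\mathrm{Aut}_0 S$ (which is isomorphic to $\mathbb{C}^*$) coincides with the center of $\mathrm{Aut}\,S$. 2) $\mathrm{Aut}_1 S$ is commutative and is isomorphic to $\mathbb{C}^*\times\mu_m$. 3) $\mathrm{Aut}\,S$ is isomorphic to the semidirect product $\mu_m\ltimes \mathrm{Aut}_1 S$, where the action of a generator of $\mu_m$ maps $(t,s)\in \mathrm{Aut}_1 S\cong\mathbb{C}^*\times\mu_m$ to $(st,s)$, where $s\in\mu_m$ is considered as an $m$-th root of unity.
   Context: Construction of parabolic Inoue surfaces. Let $W$ be the complex surface covered by open charts $U_k=\mathbb{C}^2$ with coordinates $(x_k,y_k)$, $k\in\mathbb{Z}$, and $V=\mathbb{C}^*\times\mathbb{C}$ with coordinates $(w,x)$, glued by $x_{k+1}=y_k^{-1}$, $y_{k+1}=x_ky_k^2$ on $U_k\cap U_{k+1}$, and $w=x_ky_k$, $x=x_k^{k+1}y_k^k$ (equivalently $x_k=w^{-k}x$, $y_k=w^{k+1}x^{-1}$) on $U_k\cap V$. For an integer $m\ge 1$ and $\alpha\in\mathbb{C}$ with $0<|\alpha|<1$ let $\gamma_{m,\alpha}$ be the automorphism of $W$ given by $(w,x)\mapsto(\alpha w,w^mx)$ on $V$ and mapping $U_{k-m}$ to $U_k$ by $(x_k,y_k)=(\alpha^{-k}x_{k-m},\alpha^{k+1}y_{k-m})$. It generates an infinite cyclic group acting freely, properly discontinuously and cocompactly on $W$. A parabolic Inoue surface with second Betti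 number $m$ is a surface of the form $S=S(m,\alpha):=W/\langle\gamma_{m,\alpha}\rangle$. Curves. For $k\in\mathbb{Z}$ let $\tilde C_{k+1}\subset W$ be the compact smooth rational curve defined by $x_k=0$ on $U_k$ and $y_{k+1}=0$ on $U_{k+1}$. The image of $\tilde C_i$ in $S$ is denoted $C_i$ ($1\le i\le m$); $C=C_1+\cdots+C_m$ is a cycle of rational curves on $S$ (a rational curve with one node if $m=1$). The image $E$ of $\{x=0\}\subset V$ is a smooth elliptic curve with $E^2=-m$. The $C_i$ and $E$ are the only irreducible curves on $S$. Notation. $\mathrm{Aut}\,S$ is the group of holomorphic automorphisms of $S$, $\mathrm{Aut}_0S$ its identity component, and $\mathrm{Aut}_1S$ the normal subgroup of elements leaving each $C_i$ invariant. $\mu_m$ is the cyclic group of order $m$. *)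

theory Defs
  imports
    "HOL-Analysis.Analysis"
    "HOL-Algebra.Bij"
    "HOL-Algebra.Group_Action"
    "HOL-Algebra.Generated_Groups"
    "HOL-Algebra.Elementary_Groups"
begin

section \<open>Complex surfaces given by charts, and their automorphism groups\<close>

type_synonym C2 = "complex \<times> complex"

text \<open>Holomorphy in two variables: Frechet differentiability with complex-linear derivative.\<close>

definition holomorphic2_on :: "(C2 \<Rightarrow> C2) \<Rightarrow> C2 set \<Rightarrow> bool" where
  "holomorphic2_on f D \<longleftrightarrow> open D \<and>
     (\<forall>z\<in>D. \<exists>f'. (f has_derivative f') (at z) \<and>
        (\<forall>c a b. f' (c * a, c * b) = (c * fst (f' (a, b)), c * snd (f' (a, b)))))"

text \<open>A chart is a pair of an open set and a coordinate map on it.\<close>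

type_synonym 'a chart = "'a set \<times> ('a \<Rightarrow> C2)"

definition holomorphic_map ::
  "'a topology \<Rightarrow> 'a chart set \<Rightarrow> 'b topology \<Rightarrow> 'b chart set \<Rightarrow> ('a \<Rightarrow> 'b) \<Rightarrow> bool" where
  "holomorphic_map X A Y B f \<longleftrightarrow> continuous_map X Y f \<and>
     (\<forall>(U, \<phi>)\<in>A. \<forall>(V, \<psi>)\<in>B.
        holomorphic2_on (\<lambda>z. \<psi> (f (inv_into U \<phi> z))) (\<phi> ` {x\<in>U. f x \<in> V}))"

text \<open>Elements are extensional functions, as in \<^const>\<open>BijGroup\<close>.\<close>

definition holomorphic_aut_group :: "'a topology \<Rightarrow> 'a chart set \<Rightarrow> ('a \<Rightarrow> 'a) monoid" where
  "holomorphic_aut_group X A = (BijGroup (topspace X))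
     \<lparr>carrier := {f \<in> Bij (topspace X). holomorphic_map X A X A f \<and>
                    holomorphic_map X A X A (inv_into (topspace X) f)}\<rparr>"

definition compact_open_topology :: "'a topology \<Rightarrow> 'b topology \<Rightarrow> ('a \<Rightarrow> 'b) set \<Rightarrow> ('a \<Rightarrow> 'b) topology" where
  "compact_open_topology X Y F =
     topology_generated_by {{f\<in>F. f ` K \<subseteq> V} | K V. compactin X K \<and> openin Y V}"

lemma topspace_compact_open_topology [simp]: "topspace (compact_open_topology X Y F) = F"
  by (auto simp: compact_open_topology_def)

definition quotient_topology :: "'a topology \<Rightarrow> ('a \<Rightarrow> 'b) \<Rightarrow> 'b topology" where
  "quotient_topology X p =
     topology (\<lambda>B. B \<subseteq> p ` topspace X \<and> openin X {x \<in> topspace X. p x \<in> B})"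

lemma openin_quotient_topology:
  "openin (quotient_topology X p) B \<longleftrightarrow>
     B \<subseteq> p ` topspace X \<and> openin X {x \<in> topspace X. p x \<in> B}"
proof -
  have 1: "{x \<in> topspace X. p x \<in> S \<inter> T} = {x \<in> topspace X. p x \<in> S} \<inter> {x \<in> topspace X. p x \<in> T}"
    for S T by auto
  have 2: "{x \<in> topspace X. p x \<in> \<Union>\<K>} = (\<Union>K\<in>\<K>. {x \<in> topspace X. p x \<in> K})" for \<K>
    by auto
  have "istopology (\<lambda>B. B \<subseteq> p ` topspace X \<and> openin X {x \<in> topspace X. p x \<in> B})"
    unfolding istopology_def 1 2 by (intro conjI allI impI openin_Int openin_Union; fastforce)
  then show ?thesis
    by (simp add: quotient_topology_def)
qed

lemma topspace_quotient_topology [simp]: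
  "topspace (quotient_topology X p) = p ` topspace X"
proof -
  have "{x \<in> topspace X. p x \<in> p ` topspace X} = topspace X"
    by auto
  then have "openin (quotient_topology X p) (p ` topspace X)"
    by (simp add: openin_quotient_topology)
  then show ?thesis
    using openin_subset[of "quotient_topology X p"] openin_topspace[of "quotient_topology X p"]
    unfolding openin_quotient_topology[of X p "topspace (quotient_topology X p)"]
    by (intro subset_antisym) blast+
qed

text \<open>Charts of a quotient by a free and properly discontinuous action: the charts upstairs,
  restricted to open sets on which the projection is injective.\<close>

definition quotient_atlas :: "'a topology \<Rightarrow> 'a chart set \<Rightarrow> ('a \<Rightarrow> 'b) \<Rightarrow> 'b chart set" where
  "quotient_atlas X A p =
     {(p ` B, \<lambda>q. \<phi> (inv_into B p q)) | B \<phi>.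
        openin X B \<and> inj_on p B \<and> (\<exists>U. (U, \<phi>) \<in> A \<and> B \<subseteq> U)}"


section \<open>The surface \<open>W\<close>\<close>

datatype chart_index = ChU int | ChV

fun chart_dom :: "chart_index \<Rightarrow> C2 set" where
  "chart_dom (ChU k) = UNIV"
| "chart_dom ChV = {(w, x). w \<noteq> 0}"

type_synonym prepoint = "chart_index \<times> C2"

inductive glue :: "prepoint \<Rightarrow> prepoint \<Rightarrow> bool" where
  glue_UU: "y \<noteq> 0 \<Longrightarrow> glue (ChU k, (x, y)) (ChU (k + 1), (inverse y, x * y\<^sup>2))"
| glue_UV: "x \<noteq> 0 \<Longrightarrow> y \<noteq> 0 \<Longrightarrow>
             glue (ChU k, (x, y)) (ChV, (x * y, x powi (k + 1) * y powi k))"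

type_synonym W_pt = "prepoint set"

definition W_point :: "chart_index \<Rightarrow> C2 \<Rightarrow> W_pt" where
  "W_point i p = Collect (equivclp glue (i, p))"

definition W_top :: "W_pt topology" where
  "W_top = quotient_topology
     (sum_topology (\<lambda>i. top_of_set (chart_dom i)) UNIV) (\<lambda>(i, p). W_point i p)"

definition W_atlas :: "W_pt chart set" where
  "W_atlas = {(W_point i ` chart_dom i, inv_into (chart_dom i) (W_point i)) | i. True}"

lemma topspace_W_top: "topspace W_top = (\<Union>i. W_point i ` chart_dom i)"
  by (force simp: W_top_def image_iff)

text \<open>The gluing does not identify two points of the same chart.\<close>

lemma W_point_eq_iff: "W_point i p = W_point j q \<longleftrightarrow> equivclp glue (i, p) (j, q)"
  unfolding W_point_def
  by (metis (mono_tags, lifting) Collect_cong equivclp_refl equivclp_sym equivclp_trans mem_Collect_eq)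

fun glue_normal :: "prepoint \<Rightarrow> prepoint" where
  "glue_normal (ChV, p) = (ChV, p)"
| "glue_normal (ChU k, (x, y)) =
     (if y = 0 then (ChU k, (x, 0))
      else if x = 0 then (ChU (k + 1), (inverse y, 0))
      else (ChV, (x * y, x powi (k + 1) * y powi k)))"

lemma glue_normal_cong: "equivclp glue a b \<Longrightarrow> glue_normal a = glue_normal b"
proof (induction rule: equivclp_induct)
  case (step b c)
  have "glue_normal u = glue_normal v" if "glue u v" for u v
    using that
  proof cases
    case (glue_UU y k x)
    have "(x * y\<^sup>2) powi (k + 1) * inverse y powi (k + 2) = x powi (k + 1) * y powi k" if "x \<noteq> 0"
    proof -
      have 1: "y\<^sup>2 powi (k + 1) = y powi k * y * (y powi k * y)"
        using glue_UU(3) by (simp add: power2_eq_square power_int_mult_distrib power_int_add)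
      have 2: "inverse y powi (k + 2) = inverse (y powi k * (y * y))"
        using glue_UU(3) by (simp add: power_int_inverse power_int_add power2_eq_square)
      have "y\<^sup>2 powi (k + 1) * inverse y powi (k + 2) = y powi k"
        unfolding 1 2 using glue_UU(3) by (simp add: field_simps)
      then show ?thesis
        by (simp add: power_int_mult_distrib mult.assoc)
    qed
    with glue_UU show ?thesis
      by (auto simp: power2_eq_square add.commute mult.commute mult.left_commute field_simps)
  qed auto
  with step show ?case by metis
qed auto

lemma inj_on_W_point: "inj_on (W_point i) (chart_dom i)"
proof (rule inj_onI)
  fix p q assume "W_point i p = W_point i q"
  then have eq: "glue_normal (i, p) = glue_normal (i, q)"
    by (simp add: W_point_eq_iff glue_normal_cong)
  obtain x y u v where pq: "p = (x, y)" "q = (u, v)" by (metis surj_pair)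
  show "p = q"
  proof (cases i)
    case (ChU k)
    have *: "a = (a powi (k + 1) * b powi k) / (a * b) powi k" if "a \<noteq> 0" "b \<noteq> 0" for a b :: complex
      using that by (simp add: power_int_mult_distrib power_int_add_1')
    show ?thesis
      using eq *[of x y] *[of u v] by (auto simp: pq ChU split: if_splits)
  next
    case ChV
    then show ?thesis using eq by simp
  qed
qed


section \<open>The surfaces \<open>S(m,\<alpha>)\<close>\<close>

fun pre_gamma :: "nat \<Rightarrow> complex \<Rightarrow> prepoint \<Rightarrow> prepoint" where
  "pre_gamma m \<alpha> (ChU j, (x, y)) =
     (ChU (j + int m), (\<alpha> powi (- (j + int m)) * x, \<alpha> powi (j + int m + 1) * y))"
| "pre_gamma m \<alpha> (ChV, (w, x)) = (ChV, (\<alpha> * w, w ^ m * x))"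

definition gamma :: "nat \<Rightarrow> complex \<Rightarrow> W_pt \<Rightarrow> W_pt" where
  "gamma m \<alpha> = (\<lambda>P\<in>topspace W_top. pre_gamma m \<alpha> ` P)"

text \<open>The action on classes is well defined, and \<open>gamma m \<alpha>\<close> is a bijection of \<open>W\<close>.\<close>

lemma powi_1: "z \<noteq> 0 \<Longrightarrow> z powi (k + 1) = z powi k * (z :: complex)"
  by (simp add: power_int_add)

lemma glue_pre_gamma:
  assumes "glue a b" "\<alpha> \<noteq> 0"
  shows "glue (pre_gamma m \<alpha> a) (pre_gamma m \<alpha> b)"
  using assms(1)
proof cases
  case (glue_UU y k x)
  define A where "A = \<alpha> powi (k + int m)"
  have A: "A \<noteq> 0" using assms(2) by (simp add: A_def)
  have e: "\<alpha> powi (k + int m + 1) = A * \<alpha>" "\<alpha> powi (- (k + int m)) = inverse A"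
    "\<alpha> powi (k + 1 + int m + 1) = A * \<alpha> * \<alpha>" "\<alpha> powi (- (k + 1 + int m)) = inverse (A * \<alpha>)"
    using assms(2) powi_1[of \<alpha> "k + int m"] powi_1[of \<alpha> "k + int m + 1"]
    unfolding A_def power_int_minus by (simp_all add: ac_simps)
  have "glue (ChU (k + int m), (inverse A * x, A * \<alpha> * y))
    (ChU (k + int m + 1), (inverse (A * \<alpha> * y), inverse A * x * (A * \<alpha> * y)\<^sup>2))"
    by (rule glue.glue_UU) (use glue_UU A assms(2) in auto)
  also have "inverse A * x * (A * \<alpha> * y)\<^sup>2 = A * \<alpha> * \<alpha> * (x * y\<^sup>2)"
    using A by (simp add: power2_eq_square)
  finally show ?thesis
    unfolding glue_UU pre_gamma.simps e by (simp add: ac_simps)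
next
  case (glue_UV x y k)
  define A where "A = \<alpha> powi (k + int m)"
  have A: "A \<noteq> 0" using assms(2) by (simp add: A_def)
  have e: "\<alpha> powi (k + int m + 1) = A * \<alpha>" "\<alpha> powi (- (k + int m)) = inverse A"
    using assms(2) powi_1[of \<alpha> "k + int m"] unfolding A_def power_int_minus by simp_all
  have z: "z powi (k + int m + 1) = z powi k * z ^ m * z" if "z \<noteq> 0" for z :: complex
    using that by (simp add: power_int_add)
  have zz: "z powi (k + int m) = z powi k * z ^ m" if "z \<noteq> 0" for z :: complex
    using that by (simp add: power_int_add)
  have c: "(inverse A * x) powi (k + int m + 1) * (A * \<alpha> * y) powi (k + int m)
     = (x * y) ^ m * (x powi (k + 1) * y powi k)"
  proof -
    have "(inverse A) powi (k + int m + 1) * A powi (k + int m) * A = 1"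
      using A powi_1[of A "k + int m"] by (simp add: power_int_inverse field_simps)
    then have i: "(inverse A) powi (k + int m + 1) * A powi (k + int m) * \<alpha> powi (k + int m) = 1"
      by (simp add: A_def)
    have "(inverse A * x) powi (k + int m + 1) * (A * \<alpha> * y) powi (k + int m) =
      ((inverse A) powi (k + int m + 1) * A powi (k + int m) * \<alpha> powi (k + int m)) *
      (x powi (k + int m + 1) * y powi (k + int m))"
      by (simp add: power_int_mult_distrib ac_simps)
    also have "\<dots> = x powi (k + int m + 1) * y powi (k + int m)"
      by (simp only: i mult_1)
    also have "\<dots> = (x * y) ^ m * (x powi (k + 1) * y powi k)"
      using glue_UV by (simp add: z zz powi_1 power_mult_distrib)
    finally show ?thesis .
  qed
  have "glue (ChU (k + int m), (inverse A * x, A * \<alpha> * y))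
    (ChV, (inverse A * x * (A * \<alpha> * y),
       (inverse A * x) powi (k + int m + 1) * (A * \<alpha> * y) powi (k + int m)))"
    by (rule glue.glue_UV) (use glue_UV A assms(2) in auto)
  also have "inverse A * x * (A * \<alpha> * y) = \<alpha> * (x * y)"
    using A by simp
  finally show ?thesis
    unfolding glue_UV pre_gamma.simps e c by simp
qed

lemma pre_gamma_inj:
  assumes "\<alpha> \<noteq> 0" "pre_gamma m \<alpha> (i, p) = pre_gamma m \<alpha> (j, q)"
    "p \<in> chart_dom i" "q \<in> chart_dom j"
  shows "(i, p) = (j, q)"
  using assms by (cases i; cases j; cases p; cases q) auto

lemma pre_gamma_surj:
  assumes "\<alpha> \<noteq> 0" "p \<in> chart_dom i"
  obtains j q where "q \<in> chart_dom j" "(i, p) = pre_gamma m \<alpha> (j, q)"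
proof (cases i)
  case (ChU k)
  have "(i, p) = pre_gamma m \<alpha> (ChU (k - int m), (\<alpha> powi k * fst p, inverse (\<alpha> powi (k + 1)) * snd p))"
    using assms(1) by (cases p) (simp add: ChU power_int_minus)
  then show ?thesis by (rule that[rotated]) simp
next
  case ChV
  have "(i, p) = pre_gamma m \<alpha> (ChV, (fst p / \<alpha>, snd p / (fst p / \<alpha>) ^ m))"
    using assms by (auto simp: ChV)
  then show ?thesis by (rule that[rotated]) (use assms ChV in auto)
qed

lemma glue_dom: "glue (i, p) (j, q) \<Longrightarrow> p \<in> chart_dom i \<and> q \<in> chart_dom j"
  by (auto elim: glue.cases)

lemma glue_pre_gamma_fwd:
  assumes "\<alpha> \<noteq> 0" "glue (pre_gamma m \<alpha> (i, p)) b"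
  obtains c where "b = pre_gamma m \<alpha> c" "glue (i, p) c"
proof -
  obtain x y where p: "p = (x, y)" by (metis surj_pair)
  have det: "b = c" if "glue a b" "glue a c" "fst b = fst c" for a b c
    using that by (auto elim!: glue.cases)
  show ?thesis
  proof (cases i)
    case (ChU k)
    from assms(2) show ?thesis
    proof cases
      case (glue_UU y' k' x')
      let ?c = "(ChU (k + 1), (inverse y, x * y\<^sup>2))"
      have "glue (i, p) ?c"
        using glue_UU by (auto simp: ChU p intro!: glue.intros)
      moreover have "b = pre_gamma m \<alpha> ?c"
        by (rule det[OF assms(2) glue_pre_gamma[OF calculation assms(1)]])
          (use glue_UU in \<open>auto simp: ChU p\<close>)
      ultimately show ?thesis using that by blast
    next
      case (glue_UV x' y' k')
      let ?c = "(ChV, (x * y, x powi (k + 1) * y powi k))"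
      have "glue (i, p) ?c"
        using glue_UV by (auto simp: ChU p intro!: glue.intros)
      moreover have "b = pre_gamma m \<alpha> ?c"
        by (rule det[OF assms(2) glue_pre_gamma[OF calculation assms(1)]])
          (use glue_UV in \<open>auto simp: ChU p\<close>)
      ultimately show ?thesis using that by blast
    qed
  next
    case ChV
    with assms(2) show ?thesis by (auto simp: p elim: glue.cases)
  qed
qed

lemma glue_pre_gamma_bwd:
  assumes "\<alpha> \<noteq> 0" "glue b (pre_gamma m \<alpha> (i, p))" "p \<in> chart_dom i"
  obtains c where "b = pre_gamma m \<alpha> c" "glue c (i, p)"
proof -
  obtain j q where b: "b = (j, q)" by (metis surj_pair)
  obtain j' q' where "pre_gamma m \<alpha> (i, p) = (j', q')" by (metis surj_pair)
  then have "q \<in> chart_dom j" using assms(2) glue_dom b by metis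
  then obtain k r where c: "r \<in> chart_dom k" "b = pre_gamma m \<alpha> (k, r)"
    unfolding b by (rule pre_gamma_surj[OF assms(1)])
  then obtain d where d: "pre_gamma m \<alpha> (i, p) = pre_gamma m \<alpha> d" "glue (k, r) d"
    using glue_pre_gamma_fwd[OF assms(1) assms(2)[unfolded c(2)]] by blast
  obtain l t where "d = (l, t)" by (metis surj_pair)
  then have "(i, p) = d"
    using pre_gamma_inj[OF assms(1), of m i p l t] d assms(3) glue_dom[of k r l t] by simp
  then show ?thesis using that c d by blast
qed

lemma equivclp_glue_dom:
  assumes "equivclp glue a b" "snd a \<in> chart_dom (fst a)"
  shows "snd b \<in> chart_dom (fst b)"
  using assms
proof (induction rule: equivclp_induct)
  case (step b c)
  then show ?case by (metis glue_dom prod.collapse)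
qed

lemma pre_gamma_image_W_point:
  assumes "\<alpha> \<noteq> 0" "p \<in> chart_dom i" "pre_gamma m \<alpha> (i, p) = (j, q)"
  shows "pre_gamma m \<alpha> ` W_point i p = W_point j q"
proof (intro subset_antisym subsetI)
  fix b assume "b \<in> pre_gamma m \<alpha> ` W_point i p"
  then obtain a where a: "equivclp glue (i, p) a" "b = pre_gamma m \<alpha> a"
    by (auto simp: W_point_def)
  from a(1) have "equivclp glue (pre_gamma m \<alpha> (i, p)) (pre_gamma m \<alpha> a)"
  proof (induction rule: equivclp_induct)
    case (step b c)
    then show ?case by (meson glue_pre_gamma[OF _ assms(1)] equivclp_into_equivclp)
  qed auto
  then show "b \<in> W_point j q" by (simp add: W_point_def a assms)
next
  fix b assume "b \<in> W_point j q"
  then have "equivclp glue (pre_gamma m \<alpha> (i, p)) b" by (simp add: W_point_def assms)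
  then have "\<exists>a. equivclp glue (i, p) a \<and> b = pre_gamma m \<alpha> a"
  proof (induction rule: equivclp_induct)
    case base show ?case by (blast intro: equivclp_refl)
  next
    case (step b c)
    then obtain k r where a: "equivclp glue (i, p) (k, r)" "b = pre_gamma m \<alpha> (k, r)"
      by (metis surj_pair)
    then have "r \<in> chart_dom k" using equivclp_glue_dom assms(2) by fastforce
    obtain d where "c = pre_gamma m \<alpha> d" "glue (k, r) d \<or> glue d (k, r)"
      using step(2) unfolding a(2)
    proof
      assume "glue (pre_gamma m \<alpha> (k, r)) c"
      then show ?thesis by (rule glue_pre_gamma_fwd[OF assms(1)]) (use that in blast)
    next
      assume "glue c (pre_gamma m \<alpha> (k, r))"
      then show ?thesis
        by (rule glue_pre_gamma_bwd[OF assms(1) _ \<open>r \<in> chart_dom k\<close>]) (use that in blast)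
    qed
    then show ?case using equivclp_into_equivclp[OF a(1), of d] by blast
  qed
  then show "b \<in> pre_gamma m \<alpha> ` W_point i p" by (auto simp: W_point_def)
qed

lemma W_point_in_W: "p \<in> chart_dom i \<Longrightarrow> W_point i p \<in> topspace W_top"
  by (auto simp: topspace_W_top)

lemma gamma_W_point_ChU:
  "\<alpha> \<noteq> 0 \<Longrightarrow> gamma m \<alpha> (W_point (ChU (k - int m)) (x, y)) =
     W_point (ChU k) (\<alpha> powi (- k) * x, \<alpha> powi (k + 1) * y)"
  by (simp add: gamma_def W_point_in_W pre_gamma_image_W_point)

lemma gamma_W_point_ChV:
  "\<alpha> \<noteq> 0 \<Longrightarrow> w \<noteq> 0 \<Longrightarrow> gamma m \<alpha> (W_point ChV (w, x)) = W_point ChV (\<alpha> * w, w ^ m * x)"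
  by (simp add: gamma_def W_point_in_W pre_gamma_image_W_point)

lemma gamma_in_Bij:
  assumes "\<alpha> \<noteq> 0"
  shows "gamma m \<alpha> \<in> Bij (topspace W_top)"
proof -
  have "inj_on (gamma m \<alpha>) (topspace W_top)"
  proof (rule inj_onI)
    fix P Q assume P: "P \<in> topspace W_top" and Q: "Q \<in> topspace W_top"
      and eq: "gamma m \<alpha> P = gamma m \<alpha> Q"
    have dom: "snd a \<in> chart_dom (fst a)" if "a \<in> R" "R \<in> topspace W_top" for a R
    proof -
      obtain i p where "p \<in> chart_dom i" "equivclp glue (i, p) a"
        using \<open>a \<in> R\<close> \<open>R \<in> topspace W_top\<close> by (auto simp: topspace_W_top W_point_def)
      then show ?thesis using equivclp_glue_dom[of "(i, p)" a] by simp
    qed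
    have "inj_on (pre_gamma m \<alpha>) (P \<union> Q)"
      using dom P Q pre_gamma_inj[OF assms] by (intro inj_onI) (metis UnE prod.collapse)
    moreover have "pre_gamma m \<alpha> ` P = pre_gamma m \<alpha> ` Q"
      using eq P Q by (simp add: gamma_def)
    ultimately show "P = Q" by (metis inj_on_image_eq_iff sup_ge1 sup_ge2)
  qed
  moreover have "gamma m \<alpha> ` topspace W_top = topspace W_top"
  proof (intro subset_antisym subsetI)
    fix Q assume "Q \<in> gamma m \<alpha> ` topspace W_top"
    then obtain i p where p: "p \<in> chart_dom i" "Q = gamma m \<alpha> (W_point i p)"
      by (auto simp: topspace_W_top)
    obtain j q where q: "pre_gamma m \<alpha> (i, p) = (j, q)" by (metis surj_pair)
    have "q \<in> chart_dom j"
      using q p(1) assms by (cases i; cases p) auto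
    with p q show "Q \<in> topspace W_top"
      by (simp add: gamma_def W_point_in_W pre_gamma_image_W_point[OF assms])
  next
    fix Q assume "Q \<in> topspace W_top"
    then obtain i p where p: "p \<in> chart_dom i" "Q = W_point i p"
      by (auto simp: topspace_W_top)
    then obtain j q where q: "q \<in> chart_dom j" "(i, p) = pre_gamma m \<alpha> (j, q)"
      by (rule_tac pre_gamma_surj[OF assms])
    then have "Q = gamma m \<alpha> (W_point j q)"
      using pre_gamma_image_W_point[OF assms q(1) q(2)[symmetric]] p
      by (simp add: gamma_def W_point_in_W)
    then show "Q \<in> gamma m \<alpha> ` topspace W_top"
      using q(1) W_point_in_W by blast
  qed
  ultimately show ?thesis
    by (simp add: Bij_def bij_betw_def gamma_def)
qed

type_synonym S_pt = "W_pt set"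

definition S_proj :: "nat \<Rightarrow> complex \<Rightarrow> W_pt \<Rightarrow> S_pt" where
  "S_proj m \<alpha> = orbit (subgroup_generated (BijGroup (topspace W_top)) {gamma m \<alpha>}) (\<lambda>g. g)"

definition S_top :: "nat \<Rightarrow> complex \<Rightarrow> S_pt topology" where
  "S_top m \<alpha> = quotient_topology W_top (S_proj m \<alpha>)"

definition S_atlas :: "nat \<Rightarrow> complex \<Rightarrow> S_pt chart set" where
  "S_atlas m \<alpha> = quotient_atlas W_top W_atlas (S_proj m \<alpha>)"

definition W_curve :: "int \<Rightarrow> W_pt set" where
  "W_curve i = {W_point (ChU (i - 1)) (0, y) | y. True} \<union> {W_point (ChU i) (x, 0) | x. True}"

definition S_curve :: "nat \<Rightarrow> complex \<Rightarrow> int \<Rightarrow> S_pt set" where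
  "S_curve m \<alpha> i = S_proj m \<alpha> ` W_curve i"


section \<open>The groups in the theorem\<close>

definition Aut_S :: "nat \<Rightarrow> complex \<Rightarrow> (S_pt \<Rightarrow> S_pt) monoid" where
  "Aut_S m \<alpha> = holomorphic_aut_group (S_top m \<alpha>) (S_atlas m \<alpha>)"

definition Aut_S_top :: "nat \<Rightarrow> complex \<Rightarrow> (S_pt \<Rightarrow> S_pt) topology" where
  "Aut_S_top m \<alpha> = compact_open_topology (S_top m \<alpha>) (S_top m \<alpha>) (carrier (Aut_S m \<alpha>))"

definition Aut0 :: "nat \<Rightarrow> complex \<Rightarrow> (S_pt \<Rightarrow> S_pt) set" where
  "Aut0 m \<alpha> = connected_component_of_set (Aut_S_top m \<alpha>) \<one>\<^bsub>Aut_S m \<alpha>\<^esub>"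

definition Aut1 :: "nat \<Rightarrow> complex \<Rightarrow> (S_pt \<Rightarrow> S_pt) set" where
  "Aut1 m \<alpha> = {f \<in> carrier (Aut_S m \<alpha>). \<forall>i\<in>{1..int m}. f ` S_curve m \<alpha> i = S_curve m \<alpha> i}"

definition group_center :: "('a, 'b) monoid_scheme \<Rightarrow> 'a set" where
  "group_center G = {z \<in> carrier G. \<forall>g\<in>carrier G. z \<otimes>\<^bsub>G\<^esub> g = g \<otimes>\<^bsub>G\<^esub> z}"

definition Cstar :: "complex monoid" where
  "Cstar = \<lparr>carrier = UNIV - {0}, mult = (*), one = 1\<rparr>"

definition mu :: "nat \<Rightarrow> complex monoid" where
  "mu m = \<lparr>carrier = {z. z ^ m = 1}, mult = (*), one = 1\<rparr>"

definition semidirect_product ::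
  "('h, 'c) monoid_scheme \<Rightarrow> ('n, 'd) monoid_scheme \<Rightarrow> ('h \<Rightarrow> 'n \<Rightarrow> 'n) \<Rightarrow> ('h \<times> 'n) monoid" where
  "semidirect_product H N \<theta> =
     \<lparr>carrier = carrier H \<times> carrier N,
      mult = (\<lambda>(h, n) (h', n'). (h \<otimes>\<^bsub>H\<^esub> h', n \<otimes>\<^bsub>N\<^esub> \<theta> h n')),
      one = (\<one>\<^bsub>H\<^esub>, \<one>\<^bsub>N\<^esub>)\<rparr>"

text \<open>Isomorphism of topological groups. For abstract groups being isomorphic to \<open>C*\<close> would say
  much less: as an abstract group \<open>C*\<close> is isomorphic to the circle.\<close>

definition topological_group_iso ::
  "('a, 'c) monoid_scheme \<Rightarrow> 'a topology \<Rightarrow> ('b, 'd) monoid_scheme \<Rightarrow> 'b topology \<Rightarrow> ('a \<Rightarrow> 'b) \<Rightarrow> bool" where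
  "topological_group_iso G X H Y h \<longleftrightarrow> h \<in> iso G H \<and> homeomorphic_map X Y h"

end

(* S is the quotient of W by the infinite cyclic group generated by gamma. A function h : W -> R with
   h o gamma = h + 1 shows that W -> S is a covering, and since continuous functions without zeros on W
   have logarithms, every automorphism of S lifts to a holomorphic F : W -> W. The only holomorphic
   functions on W are those of w: the logarithmic maximum modulus over the tori |w| = r, |x| = R
   increases in each of the directions (1, k), k in Z, hence does not depend on R, and Liouville's
   theorem applies to the fibres of w. So w o F is an entire function of w commuting with
   multiplication by alpha, that is w o F = b w, and on the fibres of w, which are complex lines, F is
   affine: F(w, x) = (b w, A(w) x + B(w)). Equivariance under gamma forces B = 0 and A(w) = a w^l with
   b^m = alpha^l. Everything else is a computation with these maps. In the compact-open topology,
   evaluation at the point (w, x) = (1, 1) recovers the parameters, as the admissible b are discrete. *)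
theory Submission
  imports Defs "HOL-Complex_Analysis.Complex_Analysis" "HOL-Real_Asymp.Real_Asymp"
begin

text \<open>The function \<open>h\<close> is an explicit substitute for covering theory.
  \<open>clamped\<close> is a continuous step function on W, equal to 0 where |w| and |x| are small
  and to 1 where one of them is large. Along an orbit of gamma it runs from 1 to 0, and
  \<open>h\<close> measures by a regularised sum over the orbit how far the point has moved. As
  gamma^n changes \<open>h\<close> by n, the function exp (2 pi i h) descends to S; a logarithm of
  its pullback then selects one point of each fibre in a continuous way. The group law becomes
  transparent after taking an m-th root of gamma, of the form (w, x) -> (rho w, c w x) with rho^m =
  \<alpha>. The automorphisms of S are products of powers of this root, scalings of x by t and
  rotations of w by m-th roots of unity s. Only the root and the rotations fail to commute, and
  their commutator is the scaling of x by s. The centre, Aut_1 and the semidirect product are read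
  off from this Heisenberg-type law.\<close>

section \<open>Entire functions and holomorphic functions on the punctured plane\<close>

text \<open>Properness makes f a polynomial, and the derivative of an injective holomorphic function
  has no zero. So the fundamental theorem of algebra excludes degree two and more.\<close>

lemma proper_injective_entire_affine:
  assumes f: "f holomorphic_on UNIV" and inj: "inj f"
    and proper: "\<And>k. compact k \<Longrightarrow> compact {z. f z \<in> k}"
  obtains a b where "a \<noteq> 0" "\<And>z. f z = a * z + b"
proof -
  obtain c n where n: "0 < n" "c n \<noteq> 0" and fe: "f = (\<lambda>z. \<Sum>i\<le>n. c i * z^i)"
    using proper_map_polyfun_eq[OF f] proper by blast
  have n1: "n = 1"
  proof (rule ccontr)
    assume "n \<noteq> 1"
    with n obtain k where k: "n = Suc (Suc k)" by (metis One_nat_def gr0_conv_Suc not0_implies_Suc)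
    define d where "d = (\<lambda>i. of_nat (Suc i) * c (Suc i))"
    have "(f has_field_derivative (\<Sum>i\<le>Suc k. d i * z ^ i)) (at z)" for z
    proof -
      have "(f has_field_derivative (\<Sum>i\<le>n. c i * (of_nat i * z ^ (i - Suc 0)))) (at z)"
        unfolding fe by (auto intro!: derivative_eq_intros sum.cong simp: algebra_simps)
      also have "(\<Sum>i\<le>n. c i * (of_nat i * z ^ (i - Suc 0))) = (\<Sum>i\<le>Suc k. d i * z ^ i)"
        unfolding k d_def by (subst sum.atMost_Suc_shift) (simp add: algebra_simps)
      finally show ?thesis .
    qed
    moreover obtain z where "(\<Sum>i\<le>Suc k. d i * z ^ i) = 0"
      by (rule fundamental_theorem_of_algebra[of d "Suc k"])
        (use n k in \<open>auto simp: d_def intro!: bexI[of _ "Suc k"] simp del: of_nat_Suc\<close>)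
    ultimately have "deriv f z = 0" by (metis DERIV_imp_deriv)
    then show False
      using holomorphic_injective_imp_regular[OF f open_UNIV inj] by simp
  qed
  show thesis
    by (rule that[of "c 1" "c 0"]) (use n n1 in \<open>auto simp: fe\<close>)
qed

text \<open>The preimage of a compact k under f lies in the image of k under g divided by c, so that
  f is proper.\<close>

lemma entire_left_inverse_imp_affine:
  assumes f: "f holomorphic_on UNIV" and g: "g holomorphic_on UNIV"
    and c: "c \<noteq> 0" and gf: "\<And>z. g (f z) = c * z"
  obtains a b where "a \<noteq> 0" "\<And>z. f z = a * z + b"
proof -
  have inj: "inj f" by (metis c gf injI mult_cancel_left)
  have cont: "continuous_on UNIV f" "continuous_on UNIV g"
    using f g by (auto intro: holomorphic_on_imp_continuous_on)
  have proper: "compact {z. f z \<in> k}" if k: "compact k" for k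
  proof -
    have "closed {z. f z \<in> k}"
      using closed_vimage[OF compact_imp_closed[OF k] cont(1)] by (simp add: vimage_def)
    moreover have "{z. f z \<in> k} \<subseteq> (\<lambda>u. inverse c * g u) ` k"
    proof
      fix z assume "z \<in> {z. f z \<in> k}"
      then show "z \<in> (\<lambda>u. inverse c * g u) ` k"
        using c gf by (intro image_eqI[of _ _ "f z"]) auto
    qed
    moreover have "compact ((\<lambda>u. inverse c * g u) ` k)"
      by (intro compact_continuous_image continuous_intros continuous_on_subset[OF cont(2)] k) auto
    ultimately show ?thesis
      by (metis compact_Int_closed inf.absorb_iff2)
  qed
  show thesis
    by (rule proper_injective_entire_affine[OF f inj proper]) (use that in auto)
qed

lemma bounded_holomorphic_punctured_constant:
  assumes f: "f holomorphic_on (- {0})" and b: "\<And>z. z \<noteq> 0 \<Longrightarrow> norm (f z) \<le> M"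
  obtains c where "\<And>z. z \<noteq> 0 \<Longrightarrow> f z = c"
proof -
  have "eventually (\<lambda>z. norm (f z) \<le> M) (at 0)"
    using b by (auto simp: eventually_at intro: exI[of _ "1::real"])
  then have "\<exists>g. g holomorphic_on UNIV \<and> (\<forall>z\<in>UNIV - {0}. g z = f z)"
    by (subst holomorphic_on_extend_bounded)
      (use f in \<open>auto simp: Compl_eq_Diff_UNIV\<close>)
  then obtain g where g: "g holomorphic_on UNIV" "\<And>z. z \<noteq> 0 \<Longrightarrow> g z = f z" by auto
  have "range g \<subseteq> insert (g 0) (cball 0 M)"
    using g(2) b by (auto simp: image_def) (metis)
  then have "bounded (range g)"
    by (rule bounded_subset[rotated]) simp
  then obtain c where "\<And>z. g z = c"
    using Liouville_theorem[OF g(1)] by (auto simp: constant_on_def)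
  with g(2) show thesis by (metis that)
qed

text \<open>The half-open intervals (r q, r] are fundamental domains for multiplication by q on the
  positive reals; n is the first exponent at which the orbit of x drops to r or below.\<close>

lemma annulus_representative:
  fixes q x r :: real
  assumes "0 < q" "q < 1" "0 < x" "0 < r"
  obtains n :: int where "r * q < q powi n * x" "q powi n * x \<le> r"
proof -
  define n where "n = \<lceil>(ln r - ln x) / ln q\<rceil>"
  have lq: "ln q < 0" using assms by simp
  have *: "real_of_int n \<ge> (ln r - ln x) / ln q" "real_of_int n < (ln r - ln x) / ln q + 1"
    unfolding n_def by linarith+
  have e: "q powi n * x = exp (n * ln q + ln x)"
    using assms by (simp add: exp_add powr_real_of_int' [symmetric] powr_def)
  have "n * ln q \<le> ln r - ln x" using *(1) lq by (simp add: field_simps)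
  then have 1: "q powi n * x \<le> r"
    unfolding e using assms by (metis diff_add_cancel exp_le_cancel_iff exp_ln add_le_cancel_right)
  have "n * ln q > ln r - ln x + ln q" using *(2) lq by (simp add: field_simps)
  then have "exp (n * ln q + ln x) > exp (ln r + ln q)" by simp
  then have 2: "r * q < q powi n * x"
    unfolding e using assms by (simp add: exp_add)
  show thesis using that 1 2 by blast
qed

text \<open>From both ends of the punctured plane the orbit under multiplication by \<alpha> can be
  followed into a compact annulus without decreasing u: backwards from small w by
  \<open>dec\<close>, forwards from large w by \<open>inc\<close>.\<close>

lemma annulus_bound:
  fixes u :: "complex \<Rightarrow> real" and \<alpha> :: complex
  assumes \<alpha>: "0 < norm \<alpha>" "norm \<alpha> < 1" and r: "0 < r" "r \<le> R"
    and dec: "\<And>w. w \<noteq> 0 \<Longrightarrow> norm w \<le> r \<Longrightarrow> u (\<alpha> * w) \<le> u w"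
    and inc: "\<And>w. norm w \<ge> R \<Longrightarrow> u w \<le> u (\<alpha> * w)"
    and M: "\<And>w. r * norm \<alpha> \<le> norm w \<Longrightarrow> norm w \<le> R / norm \<alpha> \<Longrightarrow> u w \<le> M"
    and w: "w \<noteq> 0"
  shows "u w \<le> M"
proof -
  have a0: "\<alpha> \<noteq> 0" using \<alpha> by auto
  consider "norm w < r" | "r \<le> norm w" "norm w \<le> R" | "R < norm w" by linarith
  then show ?thesis
  proof cases
    case 1
    obtain n :: int where n: "r * norm \<alpha> < norm \<alpha> powi n * norm w" "norm \<alpha> powi n * norm w \<le> r"
      using annulus_representative[OF \<alpha>, of "norm w" r] w r by auto
    have "n \<le> 0"
    proof (rule ccontr)
      assume "\<not> n \<le> 0"
      then have "norm \<alpha> powi n \<le> norm \<alpha> powi 1"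
        using \<alpha> by (intro power_int_decreasing) auto
      then have "norm \<alpha> powi n * norm w \<le> norm \<alpha> * norm w"
        by (intro mult_right_mono) auto
      also have "\<dots> < norm \<alpha> * r" using 1 \<alpha> by simp
      finally show False using n by (simp add: mult.commute)
    qed
    then obtain k where k: "n = - int k" by (metis nonpos_int_cases)
    \<comment> \<open>The orbit point with r |\<alpha>| < |v| <= r. All points between v and w have
      modulus at most r, so \<open>dec\<close> applies at each step.\<close>
    define v where "v = w / \<alpha> ^ k"
    have nv: "norm v = norm \<alpha> powi n * norm w"
      by (simp add: v_def k norm_divide norm_power power_int_minus field_simps)
    have v0: "v \<noteq> 0" using w a0 by (simp add: v_def)
    have "u (\<alpha> ^ j * v) \<le> u v" for j
    proof (induction j)
      case (Suc j)
      have "norm (\<alpha> ^ j * v) \<le> 1 * norm v"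
        unfolding norm_mult using \<alpha> by (intro mult_right_mono) (auto simp: norm_power power_le_one)
      then have "u (\<alpha> * (\<alpha> ^ j * v)) \<le> u (\<alpha> ^ j * v)"
        using n nv v0 a0 by (intro dec) auto
      with Suc show ?case by (simp add: mult.assoc)
    qed simp
    from this[of k] have "u w \<le> u v" using a0 by (simp add: v_def)
    also have "u v \<le> M"
    proof (rule M)
      have "norm v \<le> r" using n nv by simp
      also have "r \<le> R / norm \<alpha>"
        using r \<alpha> by (simp add: field_simps) (smt (verit) mult_left_le)
      finally show "norm v \<le> R / norm \<alpha>" .
    qed (use n nv in auto)
    finally show ?thesis .
  next
    case 2
    show ?thesis
    proof (rule M)
      have "r * norm \<alpha> \<le> r" using r \<alpha> by (simp add: mult_left_le)
      then show "r * norm \<alpha> \<le> norm w" using 2 by linarith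
      have "R \<le> R / norm \<alpha>" using r \<alpha> by (simp add: field_simps mult_left_le)
      then show "norm w \<le> R / norm \<alpha>" using 2 by linarith
    qed
  next
    case 3
    have R0: "R > 0" using r by simp
    \<comment> \<open>The representative is taken in (R, R / |\<alpha>|], so that every earlier
      point of the forward orbit still has modulus at least R, as \<open>inc\<close>
      requires.\<close>
    obtain n :: int where n: "R / norm \<alpha> * norm \<alpha> < norm \<alpha> powi n * norm w"
      "norm \<alpha> powi n * norm w \<le> R / norm \<alpha>"
      using annulus_representative[OF \<alpha>, of "norm w" "R / norm \<alpha>"] w R0 \<alpha> by auto
    have "n \<ge> 0"
    proof (rule ccontr)
      assume "\<not> n \<ge> 0"
      then have "norm \<alpha> powi n \<ge> norm \<alpha> powi (-1)"
        using \<alpha> by (intro power_int_decreasing) auto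
      then have "norm \<alpha> powi n * norm w \<ge> inverse (norm \<alpha>) * norm w"
        by (intro mult_right_mono) auto
      moreover have "inverse (norm \<alpha>) * norm w > inverse (norm \<alpha>) * R" 
        using 3 \<alpha> by (intro mult_strict_left_mono) auto
      ultimately show False using n by (simp add: field_simps)
    qed
    then obtain k where k: "n = int k" by (metis nonneg_int_cases)
    have nv: "norm (\<alpha> ^ k * w) = norm \<alpha> powi n * norm w"
      by (simp add: k norm_mult norm_power)
    have "u w \<le> u (\<alpha> ^ j * w)" if "j \<le> k" for j
      using that
    proof (induction j)
      case (Suc j)
      have "norm \<alpha> ^ k \<le> norm \<alpha> ^ j" using Suc \<alpha> by (intro power_decreasing) auto
      then have "norm (\<alpha> ^ k * w) \<le> norm (\<alpha> ^ j * w)"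
        by (simp add: norm_mult norm_power mult_right_mono)
      moreover have "R \<le> norm (\<alpha> ^ k * w)" using n nv a0 by simp
      ultimately have "u (\<alpha> ^ j * w) \<le> u (\<alpha> * (\<alpha> ^ j * w))"
        by (intro inc) auto
      with Suc show ?case by (simp add: mult.assoc)
    qed simp
    from this[of k] have "u w \<le> u (\<alpha> ^ k * w)" by simp
    also have "\<dots> \<le> M"
    proof (rule M)
      have "R < norm (\<alpha> ^ k * w)" using n nv a0 by simp
      moreover have "r * norm \<alpha> \<le> r" using r \<alpha> by (simp add: mult_left_le)
      ultimately show "r * norm \<alpha> \<le> norm (\<alpha> ^ k * w)" using r by linarith
    qed (use n nv in auto)
    finally show ?thesis .
  qed
qed

lemma compact_annulus:
  "compact {w :: complex. r \<le> norm w \<and> norm w \<le> R}"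
proof -
  have "{w :: complex. r \<le> norm w \<and> norm w \<le> R} = cball 0 R - ball 0 r" by auto
  then show ?thesis by (simp add: compact_diff)
qed

lemma punctured_plane_bounded:
  fixes f :: "complex \<Rightarrow> complex" and \<alpha> :: complex
  assumes \<alpha>: "0 < norm \<alpha>" "norm \<alpha> < 1" and r: "0 < r" "r \<le> R"
    and f: "f holomorphic_on (- {0})"
    and dec: "\<And>w. w \<noteq> 0 \<Longrightarrow> norm w \<le> r \<Longrightarrow> norm (f (\<alpha> * w)) \<le> norm (f w)"
    and inc: "\<And>w. norm w \<ge> R \<Longrightarrow> norm (f w) \<le> norm (f (\<alpha> * w))"
  obtains c where "\<And>z. z \<noteq> 0 \<Longrightarrow> f z = c"
proof -
  define K where "K = {w :: complex. r * norm \<alpha> \<le> norm w \<and> norm w \<le> R / norm \<alpha>}"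
  have "K \<subseteq> - {0}" using mult_pos_pos[OF r(1) \<alpha>(1)] by (auto simp: K_def simp del: zero_less_norm_iff)
  then have "continuous_on K f"
    using f holomorphic_on_imp_continuous_on continuous_on_subset by blast
  then have "compact (f ` K)"
    using compact_annulus by (auto simp: K_def intro: compact_continuous_image)
  then obtain M where M: "\<And>w. w \<in> K \<Longrightarrow> norm (f w) \<le> M"
    by (metis compact_imp_bounded bounded_iff imageI)
  have "norm (f w) \<le> M" if "w \<noteq> 0" for w
    by (rule annulus_bound[OF \<alpha> r, of "\<lambda>w. norm (f w)" M w]) (use dec inc M that in \<open>auto simp: K_def\<close>)
  then show thesis using bounded_holomorphic_punctured_constant[OF f] that by metis
qed

text \<open>The factor c w^m has modulus at most 1 near 0 and at least 1 near infinity, so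
  \<open>punctured_plane_bounded\<close> applies and B is a constant d. Comparing w = 1 with w = 2
  in d = c w^m d leaves only d = 0.\<close>

lemma multiplier_periodic_zero:
  fixes B :: "complex \<Rightarrow> complex" and m :: nat
  assumes \<alpha>: "0 < norm \<alpha>" "norm \<alpha> < 1" and m: "m > 0" and c: "c \<noteq> 0"
    and B: "B holomorphic_on (- {0})" and eq: "\<And>w. w \<noteq> 0 \<Longrightarrow> B (\<alpha> * w) = c * w ^ m * B w"
    and w: "w \<noteq> 0"
  shows "B w = 0"
proof -
  \<comment> \<open>As m is positive, |w|^m <= |w| for |w| <= 1 and |w|^m >= |w| for |w| >= 1; hence
    |c w^m| is at most 1 inside radius r and at least 1 outside radius R.\<close>
  define r where "r = min 1 (1 / norm c)"
  define R where "R = max 1 (1 / norm c)"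
  have r: "0 < r" "r \<le> R" using c by (auto simp: r_def R_def)
  have le: "norm (B (\<alpha> * w)) \<le> norm (B w)" if "w \<noteq> 0" "norm w \<le> r" for w
  proof -
    have "norm w ^ m \<le> norm w ^ 1" using that m r_def by (intro power_decreasing) auto
    then have "norm c * norm w ^ m \<le> norm c * (1 / norm c)"
      using that by (intro mult_left_mono) (auto simp: r_def)
    then have "norm c * norm w ^ m * norm (B w) \<le> 1 * norm (B w)"
      using c by (intro mult_right_mono) auto
    then show ?thesis using that by (simp add: eq norm_mult norm_power)
  qed
  have ge: "norm (B w) \<le> norm (B (\<alpha> * w))" if "norm w \<ge> R" for w
  proof -
    have w0: "w \<noteq> 0" using that by (auto simp: R_def)
    have "norm w ^ m \<ge> norm w ^ 1" using that m R_def by (intro power_increasing) auto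
    then have "norm c * norm w ^ m \<ge> norm c * (1 / norm c)"
      using that by (intro mult_left_mono) (auto simp: R_def)
    then have "norm c * norm w ^ m * norm (B w) \<ge> 1 * norm (B w)"
      using c by (intro mult_right_mono) auto
    then show ?thesis using w0 by (simp add: eq norm_mult norm_power)
  qed
  obtain d where d: "\<And>z. z \<noteq> 0 \<Longrightarrow> B z = d"
    using punctured_plane_bounded[OF \<alpha> r B le ge] by metis
  have a0: "\<alpha> \<noteq> 0" using \<alpha> by auto
  have "d = c * d" using eq[of 1] d a0 by simp
  moreover have "d = c * 2 ^ m * d" using eq[of 2] d a0 by simp
  moreover have "(2::complex) ^ m \<noteq> 1"
    using m by (metis norm_one norm_power norm_numeral one_less_numeral_iff one_less_power less_irrefl semiring_norm(76))
  ultimately have "d = 0" by (metis mult_cancel_right mult.commute mult_1 mult.assoc)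
  with d w show ?thesis by simp
qed

text \<open>The logarithmic derivative w A'(w) / A(w) is invariant under multiplication by \<alpha>,
  hence a constant L. So A(exp u) is a multiple of exp (L u), and its period 2 pi i makes L an
  integer.\<close>

lemma multiplier_periodic_monomial:
  fixes A :: "complex \<Rightarrow> complex"
  assumes \<alpha>: "0 < norm \<alpha>" "norm \<alpha> < 1"
    and A: "A holomorphic_on (- {0})" and nz: "\<And>w. w \<noteq> 0 \<Longrightarrow> A w \<noteq> 0"
    and eq: "\<And>w. w \<noteq> 0 \<Longrightarrow> A (\<alpha> * w) = c * A w"
  obtains a and l :: int where "a \<noteq> 0" "\<And>w. w \<noteq> 0 \<Longrightarrow> A w = a * w powi l"
proof -
  have a0: "\<alpha> \<noteq> 0" using \<alpha> by auto
  define A' where "A' = deriv A"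
  have dA: "(A has_field_derivative A' w) (at w)" if "w \<noteq> 0" for w
    unfolding A'_def by (rule holomorphic_derivI[OF A]) (use that in \<open>auto simp: open_Compl\<close>)
  have A'h: "A' holomorphic_on (- {0})" unfolding A'_def by (intro holomorphic_deriv A) auto
  have eq': "\<alpha> * A' (\<alpha> * w) = c * A' w" if "w \<noteq> 0" for w
  proof (rule DERIV_unique)
    have "((\<lambda>w. A (\<alpha> * w)) has_field_derivative A' (\<alpha> * w) * \<alpha>) (at w)"
      by (rule DERIV_chain2[where g = "\<lambda>w. \<alpha> * w", OF dA]) (use that a0 in \<open>auto intro!: derivative_eq_intros\<close>)
    then show "((\<lambda>w. A (\<alpha> * w)) has_field_derivative \<alpha> * A' (\<alpha> * w)) (at w)" by (simp add: mult.commute)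
    have "((\<lambda>w. c * A w) has_field_derivative c * A' w) (at w)"
      using dA[OF that] by (auto intro!: derivative_eq_intros)
    then show "((\<lambda>w. A (\<alpha> * w)) has_field_derivative c * A' w) (at w)"
      by (rule has_field_derivative_transform_within_open[of _ _ _ "- {0}"]) (use that eq in auto)
  qed
  have c0: "c \<noteq> 0" using eq[of 1] nz[of \<alpha>] a0 by auto
  define D where "D = (\<lambda>w. w * A' w / A w)"
  have D: "D holomorphic_on (- {0})"
    unfolding D_def using A A'h nz by (intro holomorphic_intros) auto
  have per: "D (\<alpha> * w) = D w" if "w \<noteq> 0" for w
  proof -
    have "D (\<alpha> * w) = w * (\<alpha> * A' (\<alpha> * w)) / A (\<alpha> * w)" by (simp add: D_def)
    then show ?thesis using eq[OF that] eq'[OF that] c0 by (simp add: D_def)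
  qed
  have perR: "norm (D w) \<le> norm (D (\<alpha> * w))" if "1 \<le> norm w" for w
    using per[of w] that by fastforce
  obtain L where L: "\<And>z. z \<noteq> 0 \<Longrightarrow> D z = L"
    using punctured_plane_bounded[OF \<alpha> zero_less_one order_refl D] per perR by (metis order_refl)
  have A'L: "A' w = L * A w / w" if "w \<noteq> 0" for w
    using L[OF that] nz[OF that] that by (simp add: D_def field_simps)
  define P where "P = (\<lambda>u. A (exp u) * exp (- (L * u)))"
  have "(P has_field_derivative 0) (at u)" for u
  proof -
    have "((\<lambda>u. A (exp u)) has_field_derivative A' (exp u) * exp u) (at u)"
      by (rule DERIV_chain2[where g = exp, OF dA]) (auto intro!: derivative_eq_intros)
    then have "(P has_field_derivative
        A' (exp u) * exp u * exp (- (L * u)) + exp (- (L * u)) * - L * A (exp u)) (at u)"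
      unfolding P_def by (auto intro!: derivative_eq_intros)
    then show ?thesis by (simp add: A'L algebra_simps)
  qed
  then have "\<exists>a. \<forall>u. P u = a"
    using has_field_derivative_zero_constant[of UNIV P] by auto
  then obtain a where a: "\<And>u. P u = a" by auto
  have Ae: "A (exp u) = a * exp (L * u)" for u
    using a[of u] by (simp add: P_def exp_minus field_simps)
  have an: "a \<noteq> 0" using Ae[of 0] nz[of 1] by auto
  have "exp (L * (2 * of_real pi * \<i>)) = 1" using Ae[of "2 * of_real pi * \<i>"] Ae[of 0] an by simp
  then obtain l :: int where "L * (2 * of_real pi * \<i>) = of_int (2 * l) * pi * \<i>"
    unfolding exp_eq_1 by (auto simp: complex_eq_iff)
  then have l: "L = of_int l" by simp
  show thesis
  proof (rule that[OF an])
    fix w :: complex assume w: "w \<noteq> 0"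
    have "A w = a * exp (of_int l * Ln w)" using Ae[of "Ln w"] w by (simp add: l)
    also have "exp (of_int l * Ln w) = w powi l"
      using w by (simp add: exp_power_int[symmetric])
    finally show "A w = a * w powi l" .
  qed
qed


text \<open>The vector \<open>(1, k)\<close> is the direction in which \<open>(log |w|, log |x|)\<close> moves when \<open>x\<^sub>k\<close> is fixed and
  \<open>|y\<^sub>k|\<close> grows, so the maximum principle on \<open>y\<^sub>k\<close>-discs says that the maximum of \<open>|\<phi>|\<close> on tori
  increases in all these directions. For \<open>k \<rightarrow> \<plusminus>\<infinity>\<close> they become vertical, which bounds \<open>\<phi>\<close> on
  the fibres of \<open>w\<close>.\<close>

lemma holomorphic_on_charts_fibre_constant:
  fixes \<phi> :: "complex \<Rightarrow> complex \<Rightarrow> complex"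
  assumes cont: "continuous_on ((- {0}) \<times> UNIV) (\<lambda>(w, x). \<phi> w x)"
    and fib: "\<And>w. w \<noteq> 0 \<Longrightarrow> \<phi> w holomorphic_on UNIV"
    and chart: "\<And>(k::int) x. x \<noteq> 0 \<Longrightarrow> \<exists>Y. Y holomorphic_on UNIV \<and>
       (\<forall>y. y \<noteq> 0 \<longrightarrow> Y y = \<phi> (x * y) (x powi (k + 1) * y powi k))"
    and w: "w \<noteq> 0"
  shows "\<phi> w x = \<phi> w 1"
proof -
  \<comment> \<open>The values on the fibre over w will be bounded by those on this compact set,
    where |x| = 1 and |w| has grown at most by the factor e.\<close>
  define K where "K = {v :: complex. norm w \<le> norm v \<and> norm v \<le> norm w * exp 1} \<times> sphere (0::complex) 1"
  have "compact K" unfolding K_def by (intro compact_Times compact_annulus) auto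
  moreover have "continuous_on K (\<lambda>(w, x). \<phi> w x)"
    by (rule continuous_on_subset[OF cont]) (use w in \<open>auto simp: K_def\<close>)
  ultimately have "compact ((\<lambda>(w, x). \<phi> w x) ` K)" by (rule compact_continuous_image[rotated])
  then obtain M where "\<forall>p\<in>K. norm (case p of (w, x) \<Rightarrow> \<phi> w x) \<le> M"
    by (auto dest!: compact_imp_bounded simp: bounded_iff)
  then have M: "norm (\<phi> v u) \<le> M" if "(v, u) \<in> K" for v u
    using that by fastforce
  have bd: "norm (\<phi> w x0) \<le> M" if x0: "x0 \<noteq> 0" for x0
  proof -
    define b where "b = ln (norm x0)"
    \<comment> \<open>Moving from log |x0| = b in direction (1, k) for time s ends at log |x| = 0. A
      steep enough k keeps s in [0, 1].\<close>
    obtain k :: int and s :: real where ks: "b + k * s = 0" "0 \<le> s" "s \<le> 1"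
    proof (cases "b \<ge> 0")
      case True
      define n where "n = \<lceil>b\<rceil> + 1"
      have n: "0 < real_of_int n" "b \<le> real_of_int n" using True unfolding n_def by linarith+
      show thesis by (rule that[of "- n" "b / n"]) (use n True in \<open>auto simp: field_simps\<close>)
    next
      case False
      define n where "n = \<lceil>- b\<rceil> + 1"
      have n: "0 < real_of_int n" "- b \<le> real_of_int n" using False unfolding n_def by linarith+
      show thesis by (rule that[of n "- b / n"]) (use n False in \<open>auto simp: field_simps\<close>)
    qed
    \<comment> \<open>The coordinates of (w, x0) in U_k. The y-disc through this point is enlarged
      by exp s, so that its boundary lies in K.\<close>
    define x where "x = w powi (- k) * x0"
    define y where "y = w / x"
    have nz: "x \<noteq> 0" "y \<noteq> 0" using w x0 by (auto simp: x_def y_def)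
    obtain Y where Y: "Y holomorphic_on UNIV"
      "\<And>y. y \<noteq> 0 \<Longrightarrow> Y y = \<phi> (x * y) (x powi (k + 1) * y powi k)"
      using chart[OF nz(1)] by blast
    have xk: "x powi (k + 1) * y powi k = x0"
    proof -
      have "x powi (k + 1) * y powi k = (x * y) powi k * x"
        using nz by (simp add: power_int_mult_distrib power_int_add)
      also have "\<dots> = x0" using w nz by (simp add: y_def x_def power_int_minus)
      finally show ?thesis .
    qed
    have xy: "x * y = w" using nz by (simp add: y_def)
    have Yy: "Y y = \<phi> w x0" using Y(2)[OF nz(2)] by (simp add: xk xy)
    have "norm (Y y) \<le> M"
    proof (rule maximum_modulus_frontier[of Y "cball 0 (norm y * exp s)"])
      show "Y holomorphic_on interior (cball 0 (norm y * exp s))" "continuous_on (closure (cball 0 (norm y * exp s))) Y"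
        using Y(1) by (auto intro: holomorphic_on_subset holomorphic_on_imp_continuous_on)
      show "y \<in> cball 0 (norm y * exp s)" using ks by (simp add: mult_le_cancel_left1)
      fix z :: complex assume "z \<in> frontier (cball 0 (norm y * exp s))"
      then have z: "norm z = norm y * exp s" using nz by (simp add: frontier_cball)
      then have z0: "z \<noteq> 0" using nz by auto
      have 1: "norm (x * z) = norm w * exp s" by (metis mult.assoc norm_mult xy z)
      have "norm (x powi (k + 1) * z powi k) = norm (x powi (k + 1) * y powi k) * exp s powi k"
        by (simp add: norm_mult norm_power_int z power_int_mult_distrib)
      also have "\<dots> = exp b * exp (k * s)" using x0 by (simp add: xk b_def exp_power_int)
      also have "\<dots> = 1" by (metis exp_add exp_zero ks(1))
      finally have 2: "norm (x powi (k + 1) * z powi k) = 1" .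
      have "(x * z, x powi (k + 1) * z powi k) \<in> K"
        using ks w by (simp add: K_def 1 2 mult_le_cancel_left1)
      then show "norm (Y z) \<le> M" using M Y(2)[OF z0] by simp
    qed auto
    then show ?thesis by (simp add: Yy)
  qed
  have "range (\<phi> w) \<subseteq> insert (\<phi> w 0) (cball 0 M)" using bd by (auto simp: image_def) metis
  then have "bounded (range (\<phi> w))" by (rule bounded_subset[rotated]) simp
  then obtain c where "\<And>z. \<phi> w z = c"
    using Liouville_theorem[OF fib[OF w]] by (auto simp: constant_on_def)
  then show ?thesis by simp
qed

section \<open>Holomorphy in two variables at a point\<close>

definition hol_at :: "(C2 \<Rightarrow> complex) \<Rightarrow> C2 \<Rightarrow> bool" where
  "hol_at f z \<longleftrightarrow> (\<exists>a b. (f has_derivative (\<lambda>(u, v). a * u + b * v)) (at z))"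

definition hol2_at :: "(C2 \<Rightarrow> C2) \<Rightarrow> C2 \<Rightarrow> bool" where
  "hol2_at f z \<longleftrightarrow> hol_at (\<lambda>z. fst (f z)) z \<and> hol_at (\<lambda>z. snd (f z)) z"

lemma hol_at_const [simp]: "hol_at (\<lambda>_. c) z"
  unfolding hol_at_def by (rule exI[of _ 0], rule exI[of _ 0]) (auto simp: case_prod_unfold)

lemma hol_at_fst [simp]: "hol_at fst z"
  unfolding hol_at_def
  by (rule exI[of _ 1], rule exI[of _ 0]) (auto simp: case_prod_unfold intro!: derivative_eq_intros)

lemma hol_at_snd [simp]: "hol_at snd z"
  unfolding hol_at_def
  by (rule exI[of _ 0], rule exI[of _ 1]) (auto simp: case_prod_unfold intro!: derivative_eq_intros)

lemma hol_at_compose_field: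
  assumes "hol_at f z" "(g has_field_derivative d) (at (f z))"
  shows "hol_at (\<lambda>z. g (f z)) z"
proof -
  obtain a b where f: "(f has_derivative (\<lambda>(u, v). a * u + b * v)) (at z)"
    using assms by (auto simp: hol_at_def)
  have "((\<lambda>z. g (f z)) has_derivative (\<lambda>h. d * (case h of (u, v) \<Rightarrow> a * u + b * v))) (at z)"
    using has_derivative_compose[OF f, of g "(*) d"] assms(2) by (simp add: has_field_derivative_def)
  then show ?thesis
    unfolding hol_at_def
    by (intro exI[of _ "d * a"] exI[of _ "d * b"]) (simp add: case_prod_unfold algebra_simps)
qed

lemma hol_at_mult [simp]:
  assumes "hol_at f z" "hol_at g z"
  shows "hol_at (\<lambda>z. f z * g z) z"
proof -
  obtain a b a' b' where "(f has_derivative (\<lambda>(u, v). a * u + b * v)) (at z)"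
    "(g has_derivative (\<lambda>(u, v). a' * u + b' * v)) (at z)"
    using assms by (auto simp: hol_at_def)
  then have "((\<lambda>z. f z * g z) has_derivative
      (\<lambda>h. f z * (case h of (u, v) \<Rightarrow> a' * u + b' * v) + (case h of (u, v) \<Rightarrow> a * u + b * v) * g z)) (at z)"
    by (rule has_derivative_mult)
  then show ?thesis
    unfolding hol_at_def
    by (intro exI[of _ "f z * a' + a * g z"] exI[of _ "f z * b' + b * g z"])
      (simp add: case_prod_unfold algebra_simps)
qed

lemma hol_at_inverse [simp]: "hol_at f z \<Longrightarrow> f z \<noteq> 0 \<Longrightarrow> hol_at (\<lambda>z. inverse (f z)) z"
  by (erule hol_at_compose_field) (auto intro!: derivative_eq_intros)

lemma hol_at_power_int [simp]: "hol_at f z \<Longrightarrow> f z \<noteq> 0 \<Longrightarrow> hol_at (\<lambda>z. f z powi n) z"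
  by (erule hol_at_compose_field) (auto intro!: derivative_eq_intros)

lemma hol_at_power [simp]: "hol_at f z \<Longrightarrow> hol_at (\<lambda>z. f z ^ n) z"
  by (erule hol_at_compose_field) (auto intro!: derivative_eq_intros)

lemma hol_at_imp_isCont: "hol_at f z \<Longrightarrow> isCont f z"
  by (auto simp: hol_at_def has_derivative_continuous)

lemma hol2_at_imp_isCont: "hol2_at f z \<Longrightarrow> isCont f z"
  unfolding hol2_at_def using isCont_Pair[of z "\<lambda>z. fst (f z)" "\<lambda>z. snd (f z)"]
  by (simp add: hol_at_imp_isCont)

lemma hol2_at_case_prodI [simp]:
  "hol_at (\<lambda>z. f (fst z) (snd z)) z \<Longrightarrow> hol_at (\<lambda>z. g (fst z) (snd z)) z \<Longrightarrow>
   hol2_at (\<lambda>(x, y). (f x y, g x y)) z"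
  by (simp add: hol2_at_def case_prod_unfold)

lemma hol_at_cong:
  assumes "hol_at f z" "open N" "z \<in> N" "\<And>u. u \<in> N \<Longrightarrow> g u = f u"
  shows "hol_at g z"
  using assms unfolding hol_at_def by (metis has_derivative_transform_within_open)

lemma hol2_at_cong:
  assumes "hol2_at f z" "open N" "z \<in> N" "\<And>u. u \<in> N \<Longrightarrow> g u = f u"
  shows "hol2_at g z"
  using assms unfolding hol2_at_def by (metis hol_at_cong)

lemma hol_at_compose:
  assumes f: "hol_at f (g z)" and g: "hol2_at g z"
  shows "hol_at (\<lambda>z. f (g z)) z"
proof -
  obtain a b where F: "(f has_derivative (\<lambda>(u, v). a * u + b * v)) (at (g z))"
    using assms by (auto simp: hol_at_def)
  obtain c d c' d' where "((\<lambda>z. fst (g z)) has_derivative (\<lambda>(u, v). c * u + d * v)) (at z)"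
    "((\<lambda>z. snd (g z)) has_derivative (\<lambda>(u, v). c' * u + d' * v)) (at z)"
    using g by (auto simp: hol2_at_def hol_at_def)
  from has_derivative_Pair[OF this]
  have "(g has_derivative (\<lambda>h. (case h of (u, v) \<Rightarrow> c * u + d * v, case h of (u, v) \<Rightarrow> c' * u + d' * v))) (at z)"
    by simp
  from has_derivative_compose[OF this F] show ?thesis
    unfolding hol_at_def
    by (intro exI[of _ "a * c + b * c'"] exI[of _ "a * d + b * d'"])
      (simp add: case_prod_unfold algebra_simps)
qed

lemma hol2_at_compose: "hol2_at f (g z) \<Longrightarrow> hol2_at g z \<Longrightarrow> hol2_at (\<lambda>z. f (g z)) z"
  unfolding hol2_at_def[of f] hol2_at_def[of "\<lambda>z. f (g z)"] using hol_at_compose by blast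

lemma hol_at_curve:
  assumes f: "hol_at f (p t, q t)" and p: "(p has_field_derivative p') (at t)"
    and q: "(q has_field_derivative q') (at t)"
  shows "(\<lambda>t. f (p t, q t)) field_differentiable (at t)"
proof -
  obtain a b where F: "(f has_derivative (\<lambda>(u, v). a * u + b * v)) (at (p t, q t))"
    using assms by (auto simp: hol_at_def)
  have "((\<lambda>t. (p t, q t)) has_derivative (\<lambda>h. (p' * h, q' * h))) (at t)"
    using p q by (intro has_derivative_Pair) (auto simp: has_field_derivative_def)
  from has_derivative_compose[OF this, of f "\<lambda>(u, v). a * u + b * v"] F
  have "((\<lambda>t. f (p t, q t)) has_derivative (\<lambda>h. (a * p' + b * q') * h)) (at t)"
    by (simp add: algebra_simps case_prod_unfold)
  then show ?thesis
    unfolding field_differentiable_def has_field_derivative_def by blast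
qed

lemma complex_linear_pair:
  fixes f' :: "C2 \<Rightarrow> complex"
  assumes "linear f'" "\<And>c a b. f' (c * a, c * b) = c * f' (a, b)"
  shows "f' = (\<lambda>(u, v). f' (1, 0) * u + f' (0, 1) * v)"
proof
  fix h :: C2
  obtain u v where h: "h = (u, v)" by (metis surj_pair)
  have "f' (u, v) = f' (u * 1, u * 0) + f' (v * 0, v * 1)"
    using linear_add[OF assms(1), of "(u * 1, u * 0)" "(v * 0, v * 1)"] by simp
  then show "f' h = (case h of (u, v) \<Rightarrow> f' (1, 0) * u + f' (0, 1) * v)"
    unfolding assms(2) h by (simp add: mult.commute)
qed

text \<open>Complex linear forms on C^2 are exactly (u, v) -> a u + b v, so holomorphy becomes a
  pointwise condition on the two components.\<close>

lemma holomorphic2_on_iff: "holomorphic2_on f D \<longleftrightarrow> open D \<and> (\<forall>z\<in>D. hol2_at f z)"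
proof -
  have "(\<exists>f'. (f has_derivative f') (at z) \<and>
        (\<forall>c a b. f' (c * a, c * b) = (c * fst (f' (a, b)), c * snd (f' (a, b))))) \<longleftrightarrow> hol2_at f z" for z
  proof
    assume "\<exists>f'. (f has_derivative f') (at z) \<and>
        (\<forall>c a b. f' (c * a, c * b) = (c * fst (f' (a, b)), c * snd (f' (a, b))))"
    then obtain f' where f': "(f has_derivative f') (at z)"
      "\<And>c a b. f' (c * a, c * b) = (c * fst (f' (a, b)), c * snd (f' (a, b)))" by blast
    have l: "linear f'" using f'(1) has_derivative_linear by blast
    have "linear (\<lambda>h. fst (f' h))" "linear (\<lambda>h. snd (f' h))"
      using linear_compose[OF l bounded_linear.linear[OF bounded_linear_fst]]
        linear_compose[OF l bounded_linear.linear[OF bounded_linear_snd]] by (auto simp: o_def)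
    then have "(\<lambda>h. fst (f' h)) = (\<lambda>(u, v). fst (f' (1, 0)) * u + fst (f' (0, 1)) * v)"
      "(\<lambda>h. snd (f' h)) = (\<lambda>(u, v). snd (f' (1, 0)) * u + snd (f' (0, 1)) * v)"
      using f'(2) by (auto intro!: complex_linear_pair)
    moreover have "((\<lambda>z. fst (f z)) has_derivative (\<lambda>h. fst (f' h))) (at z)"
      "((\<lambda>z. snd (f z)) has_derivative (\<lambda>h. snd (f' h))) (at z)"
      using f'(1) by (auto intro!: derivative_intros)
    ultimately show "hol2_at f z" unfolding hol2_at_def hol_at_def by metis
  next
    assume "hol2_at f z"
    then obtain c d c' d' where "((\<lambda>z. fst (f z)) has_derivative (\<lambda>(u, v). c * u + d * v)) (at z)"
      "((\<lambda>z. snd (f z)) has_derivative (\<lambda>(u, v). c' * u + d' * v)) (at z)"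
      by (auto simp: hol2_at_def hol_at_def)
    from has_derivative_Pair[OF this]
    have "(f has_derivative (\<lambda>h. (case h of (u, v) \<Rightarrow> c * u + d * v, case h of (u, v) \<Rightarrow> c' * u + d' * v))) (at z)"
      by simp
    then show "\<exists>f'. (f has_derivative f') (at z) \<and>
        (\<forall>c a b. f' (c * a, c * b) = (c * fst (f' (a, b)), c * snd (f' (a, b))))"
      by (intro exI conjI) (auto simp: algebra_simps)
  qed
  then show ?thesis by (simp add: holomorphic2_on_def)
qed

section \<open>Points and maps of \<open>W\<close>\<close>

lemma equivclp_glue_normal: "equivclp glue a (glue_normal a)"
proof -
  obtain i x y where a: "a = (i, x, y)" by (metis surj_pair)
  have "equivclp glue (ChU k, x, y) (glue_normal (ChU k, x, y))" for k
  proof -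
    consider "y = 0" | "y \<noteq> 0" "x = 0" | "y \<noteq> 0" "x \<noteq> 0" by blast
    then show ?thesis
    proof cases
      case 2
      then show ?thesis using glue_UU[of y k 0] by auto
    next
      case 3
      then show ?thesis using glue_UV[of x y k] by auto
    qed auto
  qed
  then show ?thesis by (cases i) (auto simp: a)
qed

text \<open>\<open>glue_normal\<close> is constant on classes and returns a member of the class, so
  equality of points of W becomes a computation.\<close>

lemma W_point_eq_iff_normal: "W_point i p = W_point j q \<longleftrightarrow> glue_normal (i, p) = glue_normal (j, q)"
  unfolding W_point_eq_iff
  by (metis equivclp_glue_normal equivclp_sym equivclp_trans glue_normal_cong)

lemma chart_dom_iff [simp]: "p \<in> chart_dom ChV \<longleftrightarrow> fst p \<noteq> 0"
  by (cases p) auto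

declare chart_dom.simps(2) [simp del]

lemma open_chart_dom: "open (chart_dom i)"
proof (cases i)
  case ChV
  have "chart_dom ChV = fst -` (- {0})" by (auto simp: chart_dom.simps)
  then show ?thesis using ChV by (auto intro!: open_vimage_fst)
qed auto

lemma W_point_UU:
  "y \<noteq> 0 \<Longrightarrow> W_point (ChU k) (x, y) = W_point (ChU (k + 1)) (inverse y, x * y\<^sup>2)"
  unfolding W_point_eq_iff by (blast intro: glue_UU)

lemma W_point_UV:
  "x \<noteq> 0 \<Longrightarrow> y \<noteq> 0 \<Longrightarrow>
   W_point (ChU k) (x, y) = W_point ChV (x * y, x powi (k + 1) * y powi k)"
  unfolding W_point_eq_iff by (blast intro: glue_UV)

lemma powi_simps:
  fixes z u :: complex
  assumes "z \<noteq> 0"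
  shows "z powi (a + b) = z powi a * z powi b" "z powi (- a) = inverse (z powi a)"
    "z powi (a - b) = z powi a / z powi b"
  using assms by (simp_all add: power_int_add power_int_minus power_int_diff)

lemma powi_Suc_mult: "u \<noteq> 0 \<Longrightarrow> u powi (n + 1) * v powi n = (u * v) powi n * (u :: complex)"
  by (simp add: powi_simps(1) power_int_mult_distrib)

lemma W_point_VU:
  assumes "w \<noteq> 0" "x \<noteq> 0"
  shows "W_point ChV (w, x) = W_point (ChU k) (w powi (- k) * x, w powi (k + 1) * inverse x)"
proof -
  have "(w powi (- k) * x) * (w powi (k + 1) * inverse x) = w"
    using assms by (simp add: powi_simps field_simps)
  moreover have "(w powi (- k) * x) powi (k + 1) * (w powi (k + 1) * inverse x) powi k
      = ((w powi (- k) * x) * (w powi (k + 1) * inverse x)) powi k * (w powi (- k) * x)"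
    using assms by (simp add: powi_simps(1) power_int_mult_distrib)
  ultimately show ?thesis
    using assms by (subst W_point_UV) (auto simp: powi_simps(2) field_simps)
qed

lemma W_point_1: "W_point i (1, 1) = W_point (ChU 0) (1, 1)"
  using W_point_VU[of 1 1] by (cases i) auto

lemma topspace_W_cases:
  assumes "P \<in> topspace W_top"
  obtains k x y where "P = W_point (ChU k) (x, y)" | w x where "w \<noteq> 0" "P = W_point ChV (w, x)"
proof -
  obtain i p where ip: "p \<in> chart_dom i" "P = W_point i p" using assms by (auto simp: topspace_W_top)
  show thesis using ip that by (cases i; cases p) auto
qed

text \<open>Points of W are classes of representatives, so q is evaluated at an arbitrary one. This
  is meaningful for q invariant under \<open>glue\<close>.\<close>

definition W_desc :: "(prepoint \<Rightarrow> 'b) \<Rightarrow> W_pt \<Rightarrow> 'b" where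
  "W_desc q P = q (SOME a. a \<in> P)"

lemma W_desc:
  assumes "\<And>a b. glue a b \<Longrightarrow> q a = q b"
  shows "W_desc q (W_point i p) = q (i, p)"
proof -
  have *: "q a = q b" if "equivclp glue a b" for a b
    using that by (induction rule: equivclp_induct) (auto dest: assms)
  have "(i, p) \<in> W_point i p" by (simp add: W_point_def)
  then have "(SOME a. a \<in> W_point i p) \<in> W_point i p" by (rule someI)
  then show ?thesis by (auto simp: W_point_def W_desc_def dest: *)
qed

fun pre_w :: "prepoint \<Rightarrow> complex" where
  "pre_w (ChU k, (x, y)) = x * y"
| "pre_w (ChV, (w, x)) = w"

text \<open>The coordinate w of V extends holomorphically to W as x_k y_k; its zero set is the chain
  of rational curves.\<close>

definition wfun :: "W_pt \<Rightarrow> complex" where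
  "wfun = W_desc pre_w"

lemma wfun_W_point: "wfun (W_point i p) = pre_w (i, p)"
  unfolding wfun_def by (rule W_desc) (auto elim!: glue.cases simp: power2_eq_square)

lemma wfun_simps [simp]: "wfun (W_point (ChU k) (x, y)) = x * y" "wfun (W_point ChV (w, x)) = w"
  by (simp_all add: wfun_W_point)

text \<open>On U_k this is (w, x) -> (\<beta> w, a w^l x) rewritten with x_k = w^(-k) x; the factor
  w^l moves the index from k to k + l.\<close>

fun pre_T :: "complex \<Rightarrow> complex \<Rightarrow> int \<Rightarrow> prepoint \<Rightarrow> W_pt" where
  "pre_T \<beta> a l (ChU k, (x, y)) =
     W_point (ChU (k + l)) (a * \<beta> powi (- (k + l)) * x, inverse a * \<beta> powi (k + l + 1) * y)"
| "pre_T \<beta> a l (ChV, (w, x)) = W_point ChV (\<beta> * w, a * w powi l * x)"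

text \<open>The automorphism \<open>(w, x) \<mapsto> (\<beta>w, aw\<^sup>lx)\<close> of \<open>W\<close>.\<close>

definition T :: "complex \<Rightarrow> complex \<Rightarrow> int \<Rightarrow> W_pt \<Rightarrow> W_pt" where
  "T \<beta> a l = W_desc (pre_T \<beta> a l)"

lemma pre_T_cong:
  assumes "\<beta> \<noteq> 0" "a \<noteq> 0" "glue c d"
  shows "pre_T \<beta> a l c = pre_T \<beta> a l d"
  using assms(3)
proof cases
  case (glue_UU y k x)
  have e: "\<beta> powi (k + l + 1) = \<beta> powi (k + l) * \<beta>" "\<beta> powi (k + 1 + l + 1) = \<beta> powi (k + l) * \<beta> * \<beta>"
    "\<beta> powi (k + 1 + l) = \<beta> powi (k + l) * \<beta>"
    using assms(1) powi_simps(1)[of \<beta> "k + l" 1] powi_simps(1)[of \<beta> "k + l" "1 + 1"]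
    by (simp_all add: ac_simps power2_eq_square)
  let ?B = "\<beta> powi (k + l)"
  have "W_point (ChU (k + l)) (a * inverse ?B * x, inverse a * (?B * \<beta>) * y) =
      W_point (ChU (k + l + 1)) (inverse (inverse a * (?B * \<beta>) * y), (a * inverse ?B * x) * (inverse a * (?B * \<beta>) * y)\<^sup>2)"
    by (rule W_point_UU) (use assms glue_UU in auto)
  also have "inverse (inverse a * (?B * \<beta>) * y) = a * inverse (?B * \<beta>) * inverse y"
    by (simp add: field_simps)
  also have "(a * inverse ?B * x) * (inverse a * (?B * \<beta>) * y)\<^sup>2 = inverse a * (?B * \<beta> * \<beta>) * (x * y\<^sup>2)"
    using assms by (simp add: field_simps power2_eq_square)
  also have "k + l + 1 = k + 1 + l" by simp
  finally show ?thesis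
    unfolding glue_UU pre_T.simps e powi_simps(2)[OF assms(1)] .
next
  case (glue_UV x y k)
  let ?B = "\<beta> powi (k + l)"
  have B: "?B \<noteq> 0" using assms by simp
  have e: "\<beta> powi (k + l + 1) = ?B * \<beta>" "\<beta> powi (- (k + l)) = inverse ?B"
    using assms(1) powi_simps(1)[of \<beta> "k + l" 1] powi_simps(2)[of \<beta> "k + l"] by (simp_all del: minus_add_distrib)
  let ?X = "a * inverse ?B * x" let ?Y = "inverse a * (?B * \<beta>) * y"
  have nz: "?X \<noteq> 0" "?Y \<noteq> 0" using B assms glue_UV by auto
  have xy: "?X * ?Y = \<beta> * (x * y)" using B assms by (simp add: field_simps)
  have "?X powi (k + l + 1) * ?Y powi (k + l) = (?X * ?Y) powi (k + l) * ?X"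
    by (rule powi_Suc_mult[OF nz(1)])
  also have "\<dots> = (\<beta> * (x * y)) powi (k + l) * (a * inverse ?B * x)"
    unfolding xy ..
  also have "\<dots> = a * (x * y) powi l * ((x * y) powi k * x)"
    using B assms glue_UV by (simp add: power_int_mult_distrib[of \<beta>] powi_simps(1)[of "x * y"] field_simps)
  also have "(x * y) powi k * x = x powi (k + 1) * y powi k"
    using glue_UV by (simp add: power_int_mult_distrib powi_simps)
  finally have "W_point (ChU (k + l)) (?X, ?Y) = W_point ChV (\<beta> * (x * y), a * (x * y) powi l * (x powi (k + 1) * y powi k))"
    by (subst W_point_UV[OF nz]) (simp add: xy)
  then show ?thesis
    unfolding glue_UV pre_T.simps e by simp
qed

lemma T_W_point: "\<beta> \<noteq> 0 \<Longrightarrow> a \<noteq> 0 \<Longrightarrow> T \<beta> a l (W_point i p) = pre_T \<beta> a l (i, p)"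
  unfolding T_def by (rule W_desc) (rule pre_T_cong)

lemma T_simps:
  assumes "\<beta> \<noteq> 0" "a \<noteq> 0"
  shows "T \<beta> a l (W_point (ChU k) (x, y)) =
     W_point (ChU (k + l)) (a * \<beta> powi (- (k + l)) * x, inverse a * \<beta> powi (k + l + 1) * y)"
    "T \<beta> a l (W_point ChV (w, x)) = W_point ChV (\<beta> * w, a * w powi l * x)"
  using assms by (simp_all add: T_W_point)

lemma wfun_T: "\<beta> \<noteq> 0 \<Longrightarrow> a \<noteq> 0 \<Longrightarrow> P \<in> topspace W_top \<Longrightarrow> wfun (T \<beta> a l P) = \<beta> * wfun P"
  by (erule topspace_W_cases) (simp_all add: T_simps powi_simps field_simps)

lemma T_in_W: "\<beta> \<noteq> 0 \<Longrightarrow> a \<noteq> 0 \<Longrightarrow> P \<in> topspace W_top \<Longrightarrow> T \<beta> a l P \<in> topspace W_top"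
  by (erule topspace_W_cases) (simp_all add: T_simps W_point_in_W)

text \<open>The factor \<open>\<beta>' powi l\<close> appears because w^l is evaluated at the first
  coordinate of the inner map.\<close>

lemma T_T:
  assumes "\<beta> \<noteq> 0" "a \<noteq> 0" "\<beta>' \<noteq> 0" "a' \<noteq> 0" "P \<in> topspace W_top"
  shows "T \<beta> a l (T \<beta>' a' l' P) = T (\<beta> * \<beta>') (a * a' * \<beta>' powi l) (l + l') P"
  using assms(5)
proof (cases rule: topspace_W_cases)
  case (1 k x y)
  have e: "k + (l + l') = k + l' + l" by simp
  have "a * \<beta> powi (- (k + l' + l)) * (a' * \<beta>' powi (- (k + l')) * x) =
    a * a' * \<beta>' powi l * (\<beta> * \<beta>') powi (- (k + l' + l)) * x"
    using assms by (simp add: power_int_mult_distrib powi_simps field_simps)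
  moreover have "inverse a * \<beta> powi (k + l' + l + 1) * (inverse a' * \<beta>' powi (k + l' + 1) * y) =
    inverse (a * a' * \<beta>' powi l) * (\<beta> * \<beta>') powi (k + l' + l + 1) * y"
    using assms by (simp add: power_int_mult_distrib powi_simps field_simps)
  ultimately show ?thesis
    unfolding 1 using assms by (simp only: T_simps e mult_eq_0_iff power_int_eq_0_iff simp_thms not_False_eq_True)
next
  case (2 w x)
  then show ?thesis
    using assms by (simp add: T_simps power_int_mult_distrib powi_simps ac_simps)
qed

lemma T_1: "P \<in> topspace W_top \<Longrightarrow> T 1 1 0 P = P"
  by (erule topspace_W_cases) (simp_all add: T_simps)

lemma T_inverse:
  assumes "\<beta> \<noteq> 0" "a \<noteq> 0" "P \<in> topspace W_top"
  shows "T \<beta> a l (T (inverse \<beta>) (inverse a * \<beta> powi l) (- l) P) = P"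
    "T (inverse \<beta>) (inverse a * \<beta> powi l) (- l) (T \<beta> a l P) = P"
proof -
  have "a * (inverse a * \<beta> powi l) * inverse \<beta> powi l = 1" 
    using assms by (simp add: power_int_inverse field_simps)
  then show "T \<beta> a l (T (inverse \<beta>) (inverse a * \<beta> powi l) (- l) P) = P"
    using assms by (simp add: T_T T_1)
  have "inverse a * \<beta> powi l * a * \<beta> powi - l = 1"
    using assms by (simp add: powi_simps field_simps)
  then show "T (inverse \<beta>) (inverse a * \<beta> powi l) (- l) (T \<beta> a l P) = P"
    using assms by (simp add: T_T T_1)
qed

lemma gamma_eq_T:
  assumes "\<alpha> \<noteq> 0" "P \<in> topspace W_top"
  shows "gamma m \<alpha> P = T \<alpha> 1 (int m) P"
  using assms(2)
proof (cases rule: topspace_W_cases)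
  case (1 k x y)
  then show ?thesis
    using gamma_W_point_ChU[OF assms(1), of m "k + int m" x y] assms(1) by (simp add: T_simps)
next
  case (2 w x)
  then show ?thesis
    using gamma_W_point_ChV[OF assms(1) 2(1), of m x] assms(1) by (simp add: T_simps)
qed

section \<open>Topology and holomorphic maps of \<open>W\<close>\<close>

lemma openin_W_top:
  "openin W_top B \<longleftrightarrow> B \<subseteq> topspace W_top \<and> (\<forall>i. open {p \<in> chart_dom i. W_point i p \<in> B})"
proof -
  have eq: "{x. (i, x) \<in> {x \<in> topspace (sum_topology (\<lambda>i. top_of_set (chart_dom i)) UNIV).
      (case x of (i, p) \<Rightarrow> W_point i p) \<in> B}} = {p \<in> chart_dom i. W_point i p \<in> B}" for i
    by auto
  have sub: "B \<subseteq> (\<lambda>(i, p). W_point i p) ` topspace (sum_topology (\<lambda>i. top_of_set (chart_dom i)) UNIV)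
     \<longleftrightarrow> B \<subseteq> topspace W_top"
    by (simp add: W_top_def del: topspace_sum_topology)
  have "openin W_top B \<longleftrightarrow> B \<subseteq> topspace W_top \<and>
      openin (sum_topology (\<lambda>i. top_of_set (chart_dom i)) UNIV)
        {x \<in> topspace (sum_topology (\<lambda>i. top_of_set (chart_dom i)) UNIV). (case x of (i, p) \<Rightarrow> W_point i p) \<in> B}"
    by (subst W_top_def, subst openin_quotient_topology) (simp only: sub)
  also have "\<dots> \<longleftrightarrow> B \<subseteq> topspace W_top \<and> (\<forall>i. openin (top_of_set (chart_dom i)) {p \<in> chart_dom i. W_point i p \<in> B})"
    by (subst openin_sum_topology) (auto simp: eq)
  also have "\<dots> \<longleftrightarrow> B \<subseteq> topspace W_top \<and> (\<forall>i. open {p \<in> chart_dom i. W_point i p \<in> B})"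
    by (simp add: openin_open_eq open_chart_dom)
  finally show ?thesis .
qed

lemma continuous_map_W_point: "continuous_map (top_of_set (chart_dom i)) W_top (W_point i)"
  unfolding continuous_map_alt
  by (auto simp: openin_W_top W_point_in_W vimage_def openin_open_eq open_chart_dom Int_def conj_commute)

lemma continuous_map_from_W:
  "continuous_map W_top Y f \<longleftrightarrow> (\<forall>i. continuous_map (top_of_set (chart_dom i)) Y (\<lambda>p. f (W_point i p)))"
proof
  assume "continuous_map W_top Y f"
  then show "\<forall>i. continuous_map (top_of_set (chart_dom i)) Y (\<lambda>p. f (W_point i p))"
    using continuous_map_compose[OF continuous_map_W_point] by (auto simp: o_def)
next
  assume c: "\<forall>i. continuous_map (top_of_set (chart_dom i)) Y (\<lambda>p. f (W_point i p))"
  show "continuous_map W_top Y f"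
    unfolding continuous_map_def
  proof (intro conjI allI impI)
    show "f \<in> topspace W_top \<rightarrow> topspace Y"
      using c by (auto simp: topspace_W_top continuous_map_def)
    fix U assume "openin Y U"
    then have "openin (top_of_set (chart_dom i)) {p \<in> chart_dom i. f (W_point i p) \<in> U}" for i
      using c by (auto simp: continuous_map_def)
    moreover have "{p \<in> chart_dom i. W_point i p \<in> {x \<in> topspace W_top. f x \<in> U}} =
      {p \<in> chart_dom i. f (W_point i p) \<in> U}" for i
      using W_point_in_W by auto
    ultimately show "openin W_top {x \<in> topspace W_top. f x \<in> U}"
      by (simp add: openin_W_top openin_open_eq open_chart_dom) 
  qed
qed

text \<open>The germ of F at a point, written in the charts i and j. Recording its value z' makes
  germs composable.\<close>

definition locally_holomorphic :: "(W_pt \<Rightarrow> W_pt) \<Rightarrow> chart_index \<Rightarrow> C2 \<Rightarrow> chart_index \<Rightarrow> C2 \<Rightarrow> bool" where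
  "locally_holomorphic F i z j z' \<longleftrightarrow> (\<exists>N \<theta>. open N \<and> z \<in> N \<and> N \<subseteq> chart_dom i \<and> \<theta> z = z' \<and>
     (\<forall>\<zeta>\<in>N. hol2_at \<theta> \<zeta> \<and> \<theta> \<zeta> \<in> chart_dom j \<and> F (W_point i \<zeta>) = W_point j (\<theta> \<zeta>)))"

lemma open_hol_preimage:
  assumes "open N" "\<And>z. z \<in> N \<Longrightarrow> hol2_at \<theta> z" "open M"
  shows "open {z \<in> N. \<theta> z \<in> M}"
proof -
  have "continuous_on N \<theta>"
    using assms hol2_at_imp_isCont continuous_at_imp_continuous_on by blast
  then have "open (N \<inter> \<theta> -` M)" using assms continuous_open_preimage by blast
  then show ?thesis by (simp add: Int_def vimage_def)
qed

lemma locally_holomorphic_compose: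
  assumes "locally_holomorphic F i z j z'" "locally_holomorphic G j z' k z''"
  shows "locally_holomorphic (\<lambda>P. G (F P)) i z k z''"
proof -
  obtain N \<theta> where N: "open N" "z \<in> N" "N \<subseteq> chart_dom i" "\<theta> z = z'"
    "\<And>\<zeta>. \<zeta> \<in> N \<Longrightarrow> hol2_at \<theta> \<zeta> \<and> \<theta> \<zeta> \<in> chart_dom j \<and> F (W_point i \<zeta>) = W_point j (\<theta> \<zeta>)"
    using assms(1) unfolding locally_holomorphic_def by blast
  obtain M \<eta> where M: "open M" "z' \<in> M" "M \<subseteq> chart_dom j" "\<eta> z' = z''"
    "\<And>\<zeta>. \<zeta> \<in> M \<Longrightarrow> hol2_at \<eta> \<zeta> \<and> \<eta> \<zeta> \<in> chart_dom k \<and> G (W_point j \<zeta>) = W_point k (\<eta> \<zeta>)"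
    using assms(2) unfolding locally_holomorphic_def by blast
  show ?thesis
    unfolding locally_holomorphic_def
  proof (intro exI[of _ "{\<zeta> \<in> N. \<theta> \<zeta> \<in> M}"] exI[of _ "\<lambda>\<zeta>. \<eta> (\<theta> \<zeta>)"] conjI ballI)
    fix \<zeta> assume "\<zeta> \<in> {\<zeta> \<in> N. \<theta> \<zeta> \<in> M}"
    then show "hol2_at (\<lambda>\<zeta>. \<eta> (\<theta> \<zeta>)) \<zeta>" using N(5) M(5) hol2_at_compose[of \<eta> \<theta> \<zeta>] by auto
    show "\<eta> (\<theta> \<zeta>) \<in> chart_dom k" "G (F (W_point i \<zeta>)) = W_point k (\<eta> (\<theta> \<zeta>))"
      using \<open>\<zeta> \<in> {\<zeta> \<in> N. \<theta> \<zeta> \<in> M}\<close> N(5) M(5) by auto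
  next
    show "open {\<zeta> \<in> N. \<theta> \<zeta> \<in> M}" using open_hol_preimage[of N \<theta> M] N M by blast
  qed (use N(2-4) M(2-4) in auto)
qed

lemma locally_holomorphic_global:
  assumes "open N" "z \<in> N" "N \<subseteq> chart_dom i" "\<And>\<zeta>. \<zeta> \<in> N \<Longrightarrow> hol2_at \<theta> \<zeta>"
    "\<And>\<zeta>. \<zeta> \<in> N \<Longrightarrow> \<theta> \<zeta> \<in> chart_dom j" "\<And>\<zeta>. \<zeta> \<in> N \<Longrightarrow> F (W_point i \<zeta>) = W_point j (\<theta> \<zeta>)"
  shows "locally_holomorphic F i z j (\<theta> z)"
  unfolding locally_holomorphic_def using assms by blast

lemma locally_holomorphic_id_refl: "z \<in> chart_dom i \<Longrightarrow> locally_holomorphic (\<lambda>P. P) i z i z"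
  by (rule locally_holomorphic_global[of "chart_dom i" z i "\<lambda>z. z"]) (auto simp: open_chart_dom hol2_at_def)

lemma open_fst_neq: "open {z :: C2. fst z \<noteq> 0}" "open {z :: C2. snd z \<noteq> 0}"
proof -
  have "{z :: C2. fst z \<noteq> 0} = fst -` (- {0})" "{z :: C2. snd z \<noteq> 0} = snd -` (- {0})" by auto
  then show "open {z :: C2. fst z \<noteq> 0}" "open {z :: C2. snd z \<noteq> 0}"
    by (auto intro!: open_vimage_fst open_vimage_snd)
qed

lemma open_fst_snd_neq: "open {z :: C2. fst z \<noteq> 0 \<and> snd z \<noteq> 0}"
  using open_Int[OF open_fst_neq] by (simp add: Int_def)

lemma locally_holomorphic_id_glue:
  assumes "glue (i, z) (j, z')"
  shows "locally_holomorphic (\<lambda>P. P) i z j z'" "locally_holomorphic (\<lambda>P. P) j z' i z"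
proof -
  from assms have "locally_holomorphic (\<lambda>P. P) i z j z' \<and> locally_holomorphic (\<lambda>P. P) j z' i z"
  proof cases
    case (glue_UU y k x)
    have 1: "locally_holomorphic (\<lambda>P. P) (ChU k) (x, y) (ChU (k + 1)) ((\<lambda>(x, y). (inverse y, x * y\<^sup>2)) (x, y))"
      by (rule locally_holomorphic_global[of "{z. snd z \<noteq> 0}"])
        (use glue_UU in \<open>auto simp: open_fst_neq W_point_UU[of _ k]\<close>)
    have g: "W_point (ChU (k + 1)) (u, v) = W_point (ChU k) (v * u\<^sup>2, inverse u)" if "u \<noteq> 0" for u v
      using W_point_UU[of "inverse u" k "v * u\<^sup>2"] that by (simp add: power2_eq_square field_simps)
    have 2: "locally_holomorphic (\<lambda>P. P) (ChU (k + 1)) (inverse y, x * y\<^sup>2) (ChU k)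
        ((\<lambda>(u, v). (v * u\<^sup>2, inverse u)) (inverse y, x * y\<^sup>2))"
      by (rule locally_holomorphic_global[of "{z. fst z \<noteq> 0}"])
        (use glue_UU in \<open>auto simp: open_fst_neq g\<close>)
    have e: "(\<lambda>(u, v). (v * u\<^sup>2, inverse u)) (inverse y, x * y\<^sup>2) = (x, y)"
      using glue_UU by (simp add: power2_eq_square field_simps)
    show ?thesis using 1 2[unfolded e] glue_UU by simp
  next
    case (glue_UV x y k)
    have 1: "locally_holomorphic (\<lambda>P. P) (ChU k) (x, y) ChV ((\<lambda>(x, y). (x * y, x powi (k + 1) * y powi k)) (x, y))"
      by (rule locally_holomorphic_global[of "{z. fst z \<noteq> 0 \<and> snd z \<noteq> 0}"])
        (use glue_UV in \<open>auto simp: open_fst_snd_neq W_point_UV\<close>)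
    let ?w = "x * y" let ?x = "x powi (k + 1) * y powi k"
    have 2: "locally_holomorphic (\<lambda>P. P) ChV (?w, ?x) (ChU k)
        ((\<lambda>(w, x). (w powi (- k) * x, w powi (k + 1) * inverse x)) (?w, ?x))"
      by (rule locally_holomorphic_global[of "{z. fst z \<noteq> 0 \<and> snd z \<noteq> 0}"])
        (use glue_UV in \<open>auto simp: open_fst_snd_neq W_point_VU[of _ _ k]\<close>)
    have e: "(\<lambda>(w, x). (w powi (- k) * x, w powi (k + 1) * inverse x)) (?w, ?x) = (x, y)"
      using glue_UV by (simp add: power_int_mult_distrib powi_simps field_simps)
    show ?thesis using 1 2[unfolded e] glue_UV by simp
  qed
  then show "locally_holomorphic (\<lambda>P. P) i z j z'" "locally_holomorphic (\<lambda>P. P) j z' i z" by auto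
qed

text \<open>In two charts the identity becomes the coordinate change, which is composed of gluing
  maps and their inverses along a chain from one representative to the other.\<close>

lemma locally_holomorphic_id:
  assumes z: "z \<in> chart_dom i" and eq: "W_point i z = W_point j z'"
  shows "locally_holomorphic (\<lambda>P. P) i z j z'"
proof -
  have "locally_holomorphic (\<lambda>P. P) i z (fst b) (snd b)" if "equivclp glue (i, z) b" for b
    using that
  proof (induction rule: equivclp_induct)
    case base
    then show ?case using z locally_holomorphic_id_refl by simp
  next
    case (step b c)
    have "locally_holomorphic (\<lambda>P. P) (fst b) (snd b) (fst c) (snd c)"
      using step(2) locally_holomorphic_id_glue by (metis prod.collapse)
    from locally_holomorphic_compose[OF step(3) this] show ?case .
  qed
  from this[of "(j, z')"] eq show ?thesis by (simp add: W_point_eq_iff)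
qed

lemma locally_holomorphic_change_chart:
  assumes "locally_holomorphic F i z j z'" "W_point j z' = W_point k z''"
  shows "locally_holomorphic F i z k z''"
proof -
  have "z' \<in> chart_dom j" using assms(1) by (auto simp: locally_holomorphic_def)
  from locally_holomorphic_compose[OF assms(1) locally_holomorphic_id[OF this assms(2)]] show ?thesis .
qed

text \<open>In any other chart, the image of M is locally a preimage of M under a coordinate change,
  and coordinate changes are continuous.\<close>

lemma openin_W_point_image:
  assumes "open M" "M \<subseteq> chart_dom i"
  shows "openin W_top (W_point i ` M)"
  unfolding openin_W_top
proof (intro conjI allI)
  show "W_point i ` M \<subseteq> topspace W_top" using assms W_point_in_W by blast
  fix j
  show "open {p \<in> chart_dom j. W_point j p \<in> W_point i ` M}"
  proof (subst open_subopen, intro ballI)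
    fix p assume "p \<in> {p \<in> chart_dom j. W_point j p \<in> W_point i ` M}"
    then obtain q where q: "p \<in> chart_dom j" "q \<in> M" "W_point j p = W_point i q" by auto
    obtain N \<theta> where N: "open N" "p \<in> N" "N \<subseteq> chart_dom j" "\<theta> p = q"
      "\<And>\<zeta>. \<zeta> \<in> N \<Longrightarrow> hol2_at \<theta> \<zeta>" "\<And>\<zeta>. \<zeta> \<in> N \<Longrightarrow> W_point j \<zeta> = W_point i (\<theta> \<zeta>)"
      using locally_holomorphic_id[OF q(1,3)] unfolding locally_holomorphic_def by blast
    show "\<exists>T. open T \<and> p \<in> T \<and> T \<subseteq> {p \<in> chart_dom j. W_point j p \<in> W_point i ` M}"
      by (rule exI[of _ "{\<zeta> \<in> N. \<theta> \<zeta> \<in> M}"])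
        (use N q assms open_hol_preimage[of N \<theta> M] in auto)
  qed
qed

lemma W_point_image_chart_dom_open: "openin W_top (W_point i ` chart_dom i)"
  by (simp add: openin_W_point_image open_chart_dom)

lemma locally_holomorphic_T:
  assumes "\<beta> \<noteq> 0" "a \<noteq> 0" "z \<in> chart_dom i"
  obtains j z' where "locally_holomorphic (T \<beta> a l) i z j z'"
proof (cases i)
  case (ChU k)
  have "locally_holomorphic (T \<beta> a l) i z (ChU (k + l))
     ((\<lambda>(x, y). (a * \<beta> powi (- (k + l)) * x, inverse a * \<beta> powi (k + l + 1) * y)) z)"
    by (rule locally_holomorphic_global[of UNIV]) (use assms ChU in \<open>auto simp: T_simps\<close>)
  then show ?thesis using that by blast
next
  case ChV
  have "locally_holomorphic (T \<beta> a l) i z ChV ((\<lambda>(w, x). (\<beta> * w, a * w powi l * x)) z)"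
    by (rule locally_holomorphic_global[of "chart_dom ChV"])
      (use assms ChV open_chart_dom[of ChV] in \<open>auto simp: T_simps\<close>)
  then show ?thesis using that by blast
qed

definition W_holomorphic :: "(W_pt \<Rightarrow> W_pt) \<Rightarrow> bool" where
  "W_holomorphic F \<longleftrightarrow> (\<forall>i. \<forall>z\<in>chart_dom i. \<exists>j z'. locally_holomorphic F i z j z')"

lemma W_holomorphic_T: "\<beta> \<noteq> 0 \<Longrightarrow> a \<noteq> 0 \<Longrightarrow> W_holomorphic (T \<beta> a l)"
  unfolding W_holomorphic_def by (metis locally_holomorphic_T)

lemma locally_holomorphic_value: "locally_holomorphic F i z j z' \<Longrightarrow> F (W_point i z) = W_point j z' \<and> z \<in> chart_dom i \<and> z' \<in> chart_dom j"
  by (auto simp: locally_holomorphic_def)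

lemma W_holomorphic_locally_holomorphic:
  assumes "W_holomorphic F" "z \<in> chart_dom i" "F (W_point i z) = W_point j z'"
  shows "locally_holomorphic F i z j z'"
  using assms locally_holomorphic_change_chart locally_holomorphic_value unfolding W_holomorphic_def by metis

lemma W_holomorphic_continuous:
  assumes F: "W_holomorphic F"
  shows "continuous_map W_top W_top F"
  unfolding continuous_map_from_W
proof
  fix i
  have img: "(\<lambda>p. F (W_point i p)) \<in> topspace (top_of_set (chart_dom i)) \<rightarrow> topspace W_top"
  proof
    fix z assume "z \<in> topspace (top_of_set (chart_dom i))"
    then show "F (W_point i z) \<in> topspace W_top"
      using F locally_holomorphic_value W_point_in_W unfolding W_holomorphic_def by (metis topspace_euclidean_subtopology)
  qed
  have c: "topcontinuous_at (top_of_set (chart_dom i)) W_top (\<lambda>p. F (W_point i p)) z"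
    if z: "z \<in> chart_dom i" for z
  proof -
    obtain j z' where "locally_holomorphic F i z j z'" using F z unfolding W_holomorphic_def by blast
    then obtain N \<theta> where N: "open N" "z \<in> N" "N \<subseteq> chart_dom i" "\<theta> z = z'"
      "\<And>\<zeta>. \<zeta> \<in> N \<Longrightarrow> hol2_at \<theta> \<zeta>" "\<And>\<zeta>. \<zeta> \<in> N \<Longrightarrow> \<theta> \<zeta> \<in> chart_dom j" 
      "\<And>\<zeta>. \<zeta> \<in> N \<Longrightarrow> F (W_point i \<zeta>) = W_point j (\<theta> \<zeta>)"
      unfolding locally_holomorphic_def by blast
    show ?thesis
      unfolding topcontinuous_at_def
    proof (intro conjI allI impI)
      show "z \<in> topspace (top_of_set (chart_dom i))" using z by simp
      show "(\<lambda>p. F (W_point i p)) \<in> topspace (top_of_set (chart_dom i)) \<rightarrow> topspace W_top" by (rule img)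
      fix V assume V: "openin W_top V \<and> F (W_point i z) \<in> V"
      define M where "M = {p \<in> chart_dom j. W_point j p \<in> V}"
      have "open M" using V by (auto simp: openin_W_top M_def)
      then have "open {\<zeta> \<in> N. \<theta> \<zeta> \<in> M}" using N open_hol_preimage by blast
      then show "\<exists>U. openin (top_of_set (chart_dom i)) U \<and> z \<in> U \<and> (\<forall>y\<in>U. F (W_point i y) \<in> V)"
        using N V N(6)[OF N(2)] by (intro exI[of _ "{\<zeta> \<in> N. \<theta> \<zeta> \<in> M}"])
          (auto simp: openin_open_eq open_chart_dom M_def)
    qed
  qed
  show "continuous_map (top_of_set (chart_dom i)) W_top (\<lambda>p. F (W_point i p))"
    unfolding continuous_map_eq_topcontinuous_at using c by simp
qed

text \<open>Each chart domain is connected and contains (1, 1), which represents the same point in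
  all charts.\<close>

lemma connected_space_W: "connected_space W_top"
proof -
  have dom: "connected (chart_dom i)" for i
  proof (cases i)
    case ChV
    have "chart_dom ChV = (- {0}) \<times> UNIV" by auto
    then show ?thesis
      using ChV by (auto intro!: connected_Times connected_punctured_universe)
  qed auto
  have "connectedin W_top (W_point i ` chart_dom i)" for i
    by (rule connectedin_continuous_map_image[OF continuous_map_W_point])
      (simp add: connectedin_absolute connectedin_subtopology dom)
  moreover have "W_point (ChU 0) (1, 1) \<in> W_point i ` chart_dom i" for i
    using W_point_1[of i] by (cases i) (auto intro!: image_eqI[of _ _ "(1, 1)"])
  ultimately have "connectedin W_top (\<Union>i. W_point i ` chart_dom i)"
    by (intro connectedin_Union) blast+
  then show ?thesis by (simp add: topspace_W_top[symmetric] connectedin_topspace)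
qed

section \<open>An equivariant function \<open>W \<rightarrow> \<real>\<close>\<close>

text \<open>In U_k the coordinate x is x_k^(k + 1) y_k^k, with nonnegative exponents for k >= 0 and
  nonpositive ones for k < 0. The second case works with 1 / x, so that neither formula divides by 0
  on the axes.\<close>

fun pre_tau :: "prepoint \<Rightarrow> real" where
  "pre_tau (ChU k, (x, y)) =
     (if k \<ge> 0 then cmod x ^ nat (k + 1) * cmod y ^ nat k / (1 + cmod x ^ nat (k + 1) * cmod y ^ nat k)
      else 1 / (1 + cmod x ^ nat (- k - 1) * cmod y ^ nat (- k)))"
| "pre_tau (ChV, (w, x)) = cmod x / (1 + cmod x)"

text \<open>The meromorphic function \<open>x\<close> on \<open>V\<close> extends to a map \<open>W \<rightarrow> P\<^sup>1\<close>, so that \<open>|x| / (1 + |x|)\<close>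
  extends to a continuous function on \<open>W\<close>.\<close>

definition tau :: "W_pt \<Rightarrow> real" where
  "tau = W_desc pre_tau"

lemma power_cancel:
  fixes X Y :: real
  assumes "Y \<noteq> 0"
  shows "inverse Y ^ Suc (Suc p) * (X * Y\<^sup>2) ^ Suc p = X ^ Suc p * Y ^ p"
    and "inverse Y ^ p * (X * Y\<^sup>2) ^ Suc p = X ^ Suc p * Y ^ Suc (Suc p)"
  using assms by (simp_all add: power_mult_distrib power2_eq_square power_inverse field_simps)

lemma pre_tau_cong:
  assumes "glue a b"
  shows "pre_tau a = pre_tau b"
  using assms
proof cases
  case (glue_UU y k x)
  have y: "cmod y \<noteq> 0" using glue_UU by simp
  \<comment> \<open>The formula changes between k = -1 and k = 0, so the gluing of U_(-1) with U_0
    is a case of its own.\<close>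
  consider p where "k = int p" | "k = -1" | p where "k = - int p - 2"
  proof -
    consider "k \<ge> 0" | "k = -1" | "- k - 2 \<ge> 0" by linarith
    then show ?thesis
    proof cases
      case 1
      then show ?thesis using that(1) nonneg_int_cases by metis
    next
      case 3
      then obtain p where "- k - 2 = int p" using nonneg_int_cases by metis
      then show ?thesis using that(3)[of p] by simp
    qed (rule that)
  qed
  then show ?thesis
  proof cases
    case 1
    have "nat (k + 1) = Suc p" "nat (k + 1 + 1) = Suc (Suc p)" "nat k = p" using 1 by auto
    moreover have "k \<ge> 0" "k + 1 \<ge> 0" using 1 by auto
    ultimately show ?thesis
      unfolding glue_UU(1,2) pre_tau.simps norm_mult norm_inverse norm_power
      by (simp only: power_cancel[OF y] if_True)
  next
    case 2
    then show ?thesis using y by (simp add: glue_UU(1,2) norm_divide field_simps)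
  next
    case 3
    have "nat (- k - 1) = Suc p" "nat (- k) = Suc (Suc p)" "nat (- (k + 1) - 1) = p" "nat (- (k + 1)) = Suc p"
      "\<not> k \<ge> 0" "\<not> k + 1 \<ge> 0" using 3 by auto
    then show ?thesis
      unfolding glue_UU(1,2) pre_tau.simps norm_mult norm_inverse norm_power
      by (simp only: power_cancel[OF y] if_False)
  qed
next
  case (glue_UV x y k)
  have nz: "cmod x \<noteq> 0" "cmod y \<noteq> 0" using glue_UV by auto
  show ?thesis
  proof (cases "k \<ge> 0")
    case True
    then have "cmod (x powi (k + 1) * y powi k) = cmod x ^ nat (k + 1) * cmod y ^ nat k"
      by (simp add: norm_mult norm_power power_int_def)
    with True show ?thesis by (simp add: glue_UV(1,2))
  next
    case False
    then have "cmod (x powi (k + 1) * y powi k) = inverse (cmod x ^ nat (- k - 1) * cmod y ^ nat (- k))"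
      by (cases "k = -1") (auto simp: norm_mult norm_power norm_inverse power_int_def power_inverse)
    then have e: "pre_tau b = inverse M / (1 + inverse M)"
      if "M = cmod x ^ nat (- k - 1) * cmod y ^ nat (- k)" for M using that by (simp add: glue_UV)
    have "M > 0 \<Longrightarrow> inverse M / (1 + inverse M) = 1 / (1 + M)" for M :: real
      by (simp add: field_simps)
    from this[of "cmod x ^ nat (- k - 1) * cmod y ^ nat (- k)"] show ?thesis
      unfolding e[OF refl] using False nz by (simp only: glue_UV(1) pre_tau.simps) simp
  qed
qed

lemma tau_W_point: "tau (W_point i p) = pre_tau (i, p)"
  unfolding tau_def by (rule W_desc) (rule pre_tau_cong)

text \<open>The image has x-coordinate a w^l x = a x_k^(k + l + 1) y_k^(k + l), in which \<beta>
  does not occur. The two cases are the signs of the exponents, as in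
  \<open>pre_tau\<close>.\<close>

lemma tau_T_ChU:
  assumes "\<beta> \<noteq> 0" "a \<noteq> 0"
  shows "k + l = int p \<Longrightarrow> tau (T \<beta> a l (W_point (ChU k) (x, y))) =
      cmod a * cmod x ^ Suc p * cmod y ^ p / (1 + cmod a * cmod x ^ Suc p * cmod y ^ p)"
    and "k + l = - int p - 1 \<Longrightarrow> tau (T \<beta> a l (W_point (ChU k) (x, y))) =
      1 / (1 + cmod x ^ p * cmod y ^ Suc p / cmod a)"
proof -
  define B where "B = cmod \<beta> ^ p"
  have nz: "B \<noteq> 0" "cmod \<beta> \<noteq> 0" "cmod a \<noteq> 0" using assms by (auto simp: B_def)
  {
    assume kl: "k + l = int p"
    have e: "cmod (a * \<beta> powi (- (k + l)) * x) = cmod a / B * cmod x"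
      "cmod (inverse a * \<beta> powi (k + l + 1) * y) = B * cmod \<beta> / cmod a * cmod y"
      using assms unfolding kl
      by (simp_all add: norm_mult norm_divide norm_power_int power_int_minus powi_simps(1) B_def norm_inverse norm_power field_simps)
    have "(cmod a / B * cmod x) ^ Suc p * (B * cmod \<beta> / cmod a * cmod y) ^ p = cmod a * cmod x ^ Suc p * cmod y ^ p"
      using nz by (simp add: power_mult_distrib power_divide field_simps) (simp add: B_def)
    then show "tau (T \<beta> a l (W_point (ChU k) (x, y))) =
      cmod a * cmod x ^ Suc p * cmod y ^ p / (1 + cmod a * cmod x ^ Suc p * cmod y ^ p)"
      unfolding T_simps[OF assms] tau_W_point pre_tau.simps e
      by (simp add: kl nat_add_distrib)
  }
  {
    assume kl: "k + l = - int p - 1"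
    have kl1: "k + l + 1 = - int p" "- (k + l) = int p + 1" using kl by simp_all
    have e: "cmod (a * \<beta> powi (- (k + l)) * x) = cmod a * B * cmod \<beta> * cmod x"
      "cmod (inverse a * \<beta> powi (k + l + 1) * y) = cmod y / (cmod a * B)"
      using assms unfolding kl1
      by (simp_all add: norm_mult norm_divide norm_power_int power_int_minus powi_simps(1) B_def norm_inverse norm_power field_simps)
    have "(cmod a * B * cmod \<beta> * cmod x) ^ p * (cmod y / (cmod a * B)) ^ Suc p = cmod x ^ p * cmod y ^ Suc p / cmod a"
      using nz by (simp add: power_mult_distrib power_divide field_simps) (simp add: B_def)
    moreover have "nat (- (k + l) - 1) = p" "nat (- (k + l)) = Suc p" "\<not> k + l \<ge> 0" using kl by auto
    ultimately show "tau (T \<beta> a l (W_point (ChU k) (x, y))) =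
      1 / (1 + cmod x ^ p * cmod y ^ Suc p / cmod a)"
      unfolding T_simps[OF assms] tau_W_point pre_tau.simps e by simp
  }
qed

definition clamp01 :: "real \<Rightarrow> real" where
  "clamp01 v = min 1 (max 0 (3 * v - 1))"

text \<open>A continuous step function: X / (1 + X) passes from 1/3 to 2/3 as X grows from 1/2 to 2.
  So its value is 0 where |w| and |x| are at most 1/2, and 1 where one of them is at least 2; here x
  takes values in P^1.\<close>

definition clamped :: "W_pt \<Rightarrow> real" where
  "clamped P = clamp01 (max (cmod (wfun P) / (1 + cmod (wfun P))) (tau P))"

lemma continuous_map_clamped: "continuous_map W_top euclideanreal clamped"
  unfolding continuous_map_from_W
proof
  fix i
  have nz: "1 + cmod u \<noteq> 0" "1 + cmod u ^ a * cmod v ^ b \<noteq> 0" for u v a b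
    by (metis add_pos_nonneg less_numeral_extra(1,3) norm_ge_zero mult_nonneg_nonneg zero_le_power)+
  have w: "continuous_on UNIV (\<lambda>p. wfun (W_point i p))"
  proof (cases i)
    case (ChU k)
    have eq: "(\<lambda>p. wfun (W_point i p)) = (\<lambda>p. fst p * snd p)" by (auto simp: ChU)
    show ?thesis unfolding eq by (auto intro!: continuous_intros)
  next
    case ChV
    have eq: "(\<lambda>p. wfun (W_point i p)) = (\<lambda>p. fst p)" by (auto simp: ChV)
    show ?thesis unfolding eq by (auto intro!: continuous_intros)
  qed
  have "continuous_on UNIV (\<lambda>p. tau (W_point i p))"
  proof (cases i)
    case (ChU k)
    show ?thesis
    proof (cases "k \<ge> 0")
      case True
      then have eq: "(\<lambda>p. tau (W_point i p)) =
          (\<lambda>p. cmod (fst p) ^ nat (k + 1) * cmod (snd p) ^ nat k / (1 + cmod (fst p) ^ nat (k + 1) * cmod (snd p) ^ nat k))"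
        by (auto simp: tau_W_point ChU)
      show ?thesis unfolding eq using nz by (auto intro!: continuous_intros)
    next
      case False
      then have eq: "(\<lambda>p. tau (W_point i p)) = (\<lambda>p. 1 / (1 + cmod (fst p) ^ nat (- k - 1) * cmod (snd p) ^ nat (- k)))"
        by (auto simp: tau_W_point ChU)
      show ?thesis unfolding eq using nz by (auto intro!: continuous_intros)
    qed
  next
    case ChV
    have eq: "(\<lambda>p. tau (W_point i p)) = (\<lambda>p. cmod (snd p) / (1 + cmod (snd p)))"
      by (auto simp: tau_W_point ChV)
    show ?thesis unfolding eq using nz by (auto intro!: continuous_intros)
  qed
  then have "continuous_on UNIV (\<lambda>p. clamped (W_point i p))"
    unfolding clamped_def clamp01_def using w nz by (auto intro!: continuous_intros)
  then show "continuous_map (top_of_set (chart_dom i)) euclideanreal (\<lambda>p. clamped (W_point i p))"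
    using continuous_on_subset[OF _ subset_UNIV] by auto
qed

lemma clamp01_eq: "v \<le> 1 / 3 \<Longrightarrow> clamp01 v = 0" "v \<ge> 2 / 3 \<Longrightarrow> clamp01 v = 1"
  by (auto simp: clamp01_def min_def max_def)

lemma clamped_eq_1: "cmod (wfun P) \<ge> 2 \<or> tau P \<ge> 2 / 3 \<Longrightarrow> clamped P = 1"
proof -
  assume "cmod (wfun P) \<ge> 2 \<or> tau P \<ge> 2 / 3"
  moreover have "cmod (wfun P) / (1 + cmod (wfun P)) \<ge> 2 / 3" if "cmod (wfun P) \<ge> 2"
    using that by (simp add: field_simps)
  ultimately show ?thesis
    unfolding clamped_def by (intro clamp01_eq(2)) (metis le_max_iff_disj)
qed

lemma fraction_le_third: "0 \<le> X \<Longrightarrow> X \<le> 1 / 2 \<Longrightarrow> X / (1 + X) \<le> 1 / (3 :: real)"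
  by (simp add: field_simps)

lemma clamped_eq_0: "cmod (wfun P) \<le> 1 / 2 \<Longrightarrow> tau P \<le> 1 / 3 \<Longrightarrow> clamped P = 0"
  unfolding clamped_def by (intro clamp01_eq(1) max.boundedI fraction_le_third) auto

section \<open>Iterates of gamma and growth estimates\<close>

lemma eventually_quadratic_nonpos:
  fixes a b c :: real
  assumes "a < 0"
  shows "eventually (\<lambda>n::nat. a * real n ^ 2 + b * real n + c \<le> 0) sequentially"
  using assms by real_asymp

lemma eventually_linear_nonpos:
  fixes b c :: real
  assumes "b < 0"
  shows "eventually (\<lambda>n::nat. b * real n + c \<le> 0) sequentially"
  using assms by real_asymp

text \<open>The exponents in the iterates of gamma, also for negative n: gamma^n is (w, x) ->
  (\<alpha>^n w, \<alpha>^(m tri n) w^(m n) x). Their quadratic growth beats the linear exponents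
  that compete with them in the estimates below.\<close>

definition tri :: "int \<Rightarrow> int" where
  "tri n = n * (n - 1) div 2"

lemma two_tri: "2 * tri n = n * (n - 1)"
  by (simp add: tri_def)

lemma tri_add: "tri (n + k) = tri n + tri k + n * k"
proof -
  have "2 * tri (n + k) = 2 * (tri n + tri k + n * k)"
    by (simp add: two_tri distrib_left del: distrib_left_numeral) (simp add: algebra_simps two_tri)
  then show ?thesis by simp
qed

locale inoue =
  fixes m :: nat and \<alpha> :: complex
  assumes m: "m > 0" and \<alpha>_pos: "0 < cmod \<alpha>" and \<alpha>_less: "cmod \<alpha> < 1"
begin

lemma \<alpha>_nz: "\<alpha> \<noteq> 0"
  using \<alpha>_pos by auto

definition gamma_pow :: "int \<Rightarrow> W_pt \<Rightarrow> W_pt" where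
  "gamma_pow n = T (\<alpha> powi n) (\<alpha> powi (int m * tri n)) (int m * n)"

lemma gamma_pow_in_W: "P \<in> topspace W_top \<Longrightarrow> gamma_pow n P \<in> topspace W_top"
  by (simp add: gamma_pow_def T_in_W \<alpha>_nz)

lemma gamma_pow_0: "P \<in> topspace W_top \<Longrightarrow> gamma_pow 0 P = P"
  by (simp add: gamma_pow_def T_1 tri_def)

lemma gamma_pow_add: "P \<in> topspace W_top \<Longrightarrow> gamma_pow n (gamma_pow k P) = gamma_pow (n + k) P"
proof -
  assume P: "P \<in> topspace W_top"
  have "\<alpha> powi (int m * tri n) * \<alpha> powi (int m * tri k) * (\<alpha> powi k) powi (int m * n) =
      \<alpha> powi (int m * tri n + int m * tri k + k * (int m * n))"
    using \<alpha>_nz by (simp add: power_int_add power_int_mult)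
  also have "int m * tri n + int m * tri k + k * (int m * n) = int m * tri (n + k)"
    by (simp add: tri_add algebra_simps)
  finally show ?thesis
    using P \<alpha>_nz by (simp add: gamma_pow_def T_T power_int_add algebra_simps)
qed

lemma gamma_pow_1: "P \<in> topspace W_top \<Longrightarrow> gamma_pow 1 P = gamma m \<alpha> P"
  by (simp add: gamma_pow_def gamma_eq_T \<alpha>_nz tri_def)

text \<open>With this sign the values at a given point are 0 for n near minus infinity and 1 for n
  near infinity.\<close>

definition cutoff :: "int \<Rightarrow> W_pt \<Rightarrow> real" where
  "cutoff n P = clamped (gamma_pow (- n) P)"

lemma continuous_map_cutoff: "continuous_map W_top euclideanreal (cutoff n)"
proof -
  have "continuous_map W_top W_top (gamma_pow (- n))"
    unfolding gamma_pow_def using \<alpha>_nz by (intro W_holomorphic_continuous W_holomorphic_T) auto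
  from continuous_map_compose[OF this continuous_map_clamped] show ?thesis
    by (simp add: o_def cutoff_def[abs_def])
qed

lemma cutoff_gamma: "P \<in> topspace W_top \<Longrightarrow> cutoff n (gamma m \<alpha> P) = cutoff (n - 1) P"
  by (simp add: cutoff_def gamma_pow_1[symmetric] gamma_pow_add)

lemma wfun_gamma_pow: "P \<in> topspace W_top \<Longrightarrow> cmod (wfun (gamma_pow n P)) = cmod \<alpha> powi n * cmod (wfun P)"
  by (simp add: gamma_pow_def wfun_T \<alpha>_nz norm_mult norm_power_int)

lemma ln_\<alpha>: "ln (cmod \<alpha>) < 0"
  using \<alpha>_pos \<alpha>_less by simp

lemma powi_le_iff_ln:
  "0 < A \<Longrightarrow> 0 < B \<Longrightarrow> cmod \<alpha> powi n * A \<le> B \<longleftrightarrow> real_of_int n * ln (cmod \<alpha>) + ln A \<le> ln B"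
proof -
  assume "0 < A" "0 < B"
  then have "cmod \<alpha> powi n * A = exp (real_of_int n * ln (cmod \<alpha>) + ln A)" 
    using \<alpha>_pos by (simp add: exp_add powr_real_of_int' [symmetric] powr_def)
  then show ?thesis using \<open>0 < B\<close> by (metis exp_le_cancel_iff exp_ln)
qed

text \<open>Under gamma^j both |w| and |x| become small: the factor \<alpha>^(m tri j) of x decays
  like the exponential of a negative quadratic, while x_k and y_k contribute at most R^(2 p + 1)
  with p linear in j.\<close>

lemma cutoff_0_ChU:
  assumes "R \<ge> 1"
  shows "eventually (\<lambda>j. \<forall>x y. cmod x \<le> R \<longrightarrow> cmod y \<le> R \<longrightarrow> cutoff (- int j) (W_point (ChU k) (x, y)) = 0) sequentially"
proof -
  define L where "L = ln (cmod \<alpha>)"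
  have L: "L < 0" using ln_\<alpha> by (simp add: L_def)
  \<comment> \<open>After taking logarithms: condition 1 is |\<alpha>|^j R^2 <= 1/2, condition 2 is
    |\<alpha>|^(m tri j) R^(2 p + 1) <= 1/2 for p = k + m j, and condition 3 gives p >= 0.\<close>
  have 1: "eventually (\<lambda>j. L * real j + (2 * ln R + ln 2) \<le> 0) sequentially"
    by (rule eventually_linear_nonpos[OF L])
  have mL: "L * real m / 2 < 0" using L m by (simp add: field_simps mult_neg_pos)
  have 2: "eventually (\<lambda>j. (L * real m / 2) * real j ^ 2 + (2 * real m * ln R - L * real m / 2) * real j +
      ((2 * real_of_int k + 1) * ln R + ln 2) \<le> 0) sequentially"
    by (rule eventually_quadratic_nonpos[OF mL])
  have 3: "eventually (\<lambda>j. j \<ge> nat (- k)) sequentially" by (rule eventually_ge_at_top)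
  show ?thesis
    using 1 2 3
  proof eventually_elim
    case (elim j)
    show ?case
    proof (intro allI impI)
      fix x y assume xy: "cmod x \<le> R" "cmod y \<le> R"
      have "j \<le> m * j" using m by simp
      then have "k + int m * int j \<ge> 0" using elim(3) by (smt (verit, best) int_nat_eq of_nat_mono of_nat_mult)
      then obtain p where p: "k + int m * int j = int p" using zero_le_imp_eq_int by blast
      let ?P = "gamma_pow (int j) (W_point (ChU k) (x, y))"
      have W: "W_point (ChU k) (x, y) \<in> topspace W_top" by (simp add: W_point_in_W)
      have "cmod (wfun ?P) = cmod \<alpha> powi int j * (cmod x * cmod y)"
        by (simp add: wfun_gamma_pow W norm_mult del: power_int_of_nat)
      also have "\<dots> \<le> cmod \<alpha> powi int j * (R * R)"
        using xy assms by (intro mult_left_mono mult_mono) auto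
      also have "\<dots> \<le> 1 / 2"
        using elim(1) assms by (subst powi_le_iff_ln) (auto simp: ln_mult ln_div L_def algebra_simps)
      finally have w: "cmod (wfun ?P) \<le> 1 / 2" .
      have "cmod x ^ Suc p * cmod y ^ p \<le> R ^ Suc p * R ^ p"
        using xy assms by (intro mult_mono power_mono) auto
      then have "cmod (\<alpha> powi (int m * tri (int j))) * (cmod x ^ Suc p * cmod y ^ p) \<le> cmod \<alpha> powi (int m * tri (int j)) * (R ^ Suc p * R ^ p)"
        unfolding norm_power_int by (intro mult_left_mono) auto
      also have "\<dots> \<le> 1 / 2"
      proof (subst powi_le_iff_ln)
        have pk: "real p = real_of_int k + real m * real j"
          by (metis p of_int_add of_int_mult of_int_of_nat_eq)
        have tj: "real_of_int (tri (int j)) = (real j ^ 2 - real j) / 2"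
        proof -
          have "2 * real_of_int (tri (int j)) = real_of_int (int j * (int j - 1))"
            by (metis two_tri of_int_mult of_int_numeral)
          then show ?thesis by (simp add: power2_eq_square algebra_simps)
        qed
        have "ln (R ^ Suc p * R ^ p) = (2 * real p + 1) * ln R"
          using assms by (simp add: ln_mult ln_realpow algebra_simps)
        then show "real_of_int (int m * tri (int j)) * ln (cmod \<alpha>) + ln (R ^ Suc p * R ^ p) \<le> ln (1 / 2)"
          using elim(2) by (simp add: tj pk ln_div L_def[symmetric] field_simps)
      qed (use assms in auto)
      finally have X: "cmod (\<alpha> powi (int m * tri (int j))) * cmod x ^ Suc p * cmod y ^ p \<le> 1 / 2"
        by (simp add: mult.assoc)
      have "tau ?P = cmod (\<alpha> powi (int m * tri (int j))) * cmod x ^ Suc p * cmod y ^ p /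
          (1 + cmod (\<alpha> powi (int m * tri (int j))) * cmod x ^ Suc p * cmod y ^ p)"
        unfolding gamma_pow_def by (rule tau_T_ChU(1)) (use \<alpha>_nz p in auto)
      also have "\<dots> \<le> 1 / 3" by (rule fraction_le_third[OF _ X]) simp
      finally have "tau ?P \<le> 1 / 3" .
      with w show "cutoff (- int j) (W_point (ChU k) (x, y)) = 0"
        by (simp add: cutoff_def clamped_eq_0)
    qed
  qed
qed

text \<open>Under gamma^(-n) a point with w = 0 never reaches large |w|, so there are two ways out.
  If |w| is still below 2 after the move, then |x_k y_k| <= 2 |\<alpha>|^n, and this smallness makes
  |1 / x| small.\<close>

lemma cutoff_1_ChU:
  assumes "R \<ge> 1"
  shows "eventually (\<lambda>n. \<forall>x y. cmod x \<le> R \<longrightarrow> cmod y \<le> R \<longrightarrow> cutoff (int n) (W_point (ChU k) (x, y)) = 1) sequentially"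
proof -
  define L where "L = ln (cmod \<alpha>)"
  have L: "L < 0" using ln_\<alpha> by (simp add: L_def)
  have mL: "L * real m / 2 < 0" using L m by (simp add: field_simps mult_neg_pos)
  \<comment> \<open>The logarithm of 2 R (2 |\<alpha>|^n)^p / |\<alpha>|^(m tri (- n)) for p = m n -
    k - 1. The numerator contributes m n^2 to the exponent of |\<alpha>| and the denominator takes
    away half of it, which leaves the leading coefficient m / 2.\<close>
  have 2: "eventually (\<lambda>n. (L * real m / 2) * real n ^ 2 +
      (real m * ln 2 - L * (real_of_int k + 1) - L * real m / 2) * real n +
      (ln R + ln 2 - (real_of_int k + 1) * ln 2) \<le> 0) sequentially"
    by (rule eventually_quadratic_nonpos[OF mL])
  have 3: "eventually (\<lambda>j. j \<ge> nat (k + 1)) sequentially" by (rule eventually_ge_at_top)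
  show ?thesis
    using 2 3
  proof eventually_elim
    case (elim n)
    show ?case
    proof (intro allI impI)
      fix x y assume xy: "cmod x \<le> R" "cmod y \<le> R"
      have "n \<le> m * n" using m by simp
      then have "int m * int n - k - 1 \<ge> 0" using elim(2) by (smt (verit, best) int_nat_eq of_nat_mono of_nat_mult)
      then obtain p where p: "int m * int n - k - 1 = int p" using zero_le_imp_eq_int by blast
      let ?P = "gamma_pow (- int n) (W_point (ChU k) (x, y))"
      have W: "W_point (ChU k) (x, y) \<in> topspace W_top" by (simp add: W_point_in_W)
      have w: "cmod (wfun ?P) = cmod \<alpha> powi (- int n) * (cmod x * cmod y)"
        by (simp add: wfun_gamma_pow W norm_mult del: power_int_of_nat power_int_minus)
      have "tau ?P \<ge> 2 / 3" if "\<not> cmod (wfun ?P) \<ge> 2"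
      proof -
        have xy2: "cmod x * cmod y \<le> 2 * cmod \<alpha> ^ n"
          using that \<alpha>_pos by (simp add: w power_int_minus field_simps)
        have "cmod x ^ p * cmod y ^ Suc p = (cmod x * cmod y) ^ p * cmod y" by (simp add: power_mult_distrib)
        also have "\<dots> \<le> (2 * cmod \<alpha> ^ n) ^ p * R"
          by (intro mult_mono[OF power_mono[OF xy2] xy(2)]) auto
        finally have "cmod x ^ p * cmod y ^ Suc p \<le> (2 * cmod \<alpha> ^ n) ^ p * R" .
        then have "cmod \<alpha> powi (- (int m * tri (- int n))) * (cmod x ^ p * cmod y ^ Suc p) \<le>
           cmod \<alpha> powi (- (int m * tri (- int n))) * ((2 * cmod \<alpha> ^ n) ^ p * R)"
          by (rule mult_left_mono) (rule zero_le_power_int, rule norm_ge_zero)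
        also have "\<dots> \<le> 1 / 2"
        proof (subst powi_le_iff_ln)
          have pk: "real p = real m * real n - real_of_int k - 1"
          proof -
            have "real_of_int (int m * int n - k - 1) = real_of_int (int p)" by (simp only: p)
            then show ?thesis by simp
          qed
          have tj: "real_of_int (tri (- int n)) = (real n ^ 2 + real n) / 2"
          proof -
            have "2 * real_of_int (tri (- int n)) = real_of_int ((- int n) * (- int n - 1))"
              by (metis two_tri of_int_mult of_int_numeral)
            then show ?thesis by (simp add: power2_eq_square algebra_simps)
          qed
          have "ln ((2 * cmod \<alpha> ^ n) ^ p * R) = real p * (ln 2 + real n * L) + ln R"
            using assms \<alpha>_pos by (simp add: ln_mult ln_realpow L_def algebra_simps)
          then show "real_of_int (- (int m * tri (- int n))) * ln (cmod \<alpha>) + ln ((2 * cmod \<alpha> ^ n) ^ p * R) \<le> ln (1 / 2)"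
            using elim(1) by (simp add: tj pk ln_div L_def[symmetric] field_simps power2_eq_square)
        qed (use assms \<alpha>_pos in auto)
        finally have X: "cmod x ^ p * cmod y ^ Suc p / cmod (\<alpha> powi (int m * tri (- int n))) \<le> 1 / 2"
          by (simp add: norm_power_int power_int_minus field_simps)
        have frac: "1 / (1 + X) \<ge> 2 / 3" if "0 \<le> X" "X \<le> 1 / 2" for X :: real
          using that by (simp add: field_simps)
        have "tau ?P = 1 / (1 + cmod x ^ p * cmod y ^ Suc p / cmod (\<alpha> powi (int m * tri (- int n))))"
          unfolding gamma_pow_def by (rule tau_T_ChU(2)) (use \<alpha>_nz p in auto)
        also have "\<dots> \<ge> 2 / 3" by (rule frac[OF _ X]) simp
        finally show "tau ?P \<ge> 2 / 3" .
      qed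
      then show "cutoff (int n) (W_point (ChU k) (x, y)) = 1"
        unfolding cutoff_def by (intro clamped_eq_1) blast
    qed
  qed
qed

text \<open>On compact subsets of V the modulus of w is bounded below, so that |w| alone becomes
  large under gamma^(-n).\<close>

lemma cutoff_ChV:
  assumes "R \<ge> 1"
  shows "eventually (\<lambda>n. \<forall>w x. inverse R \<le> cmod w \<longrightarrow> cmod w \<le> R \<longrightarrow> cmod x \<le> R \<longrightarrow>
    cutoff (int n) (W_point ChV (w, x)) = 1 \<and> cutoff (- int n) (W_point ChV (w, x)) = 0) sequentially"
proof -
  define L where "L = ln (cmod \<alpha>)"
  have L: "L < 0" using ln_\<alpha> by (simp add: L_def)
  have mL: "L * real m / 2 < 0" using L m by (simp add: field_simps mult_neg_pos)
  have 1: "eventually (\<lambda>n. L * real n + (ln R + ln 2) \<le> 0) sequentially"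
    by (rule eventually_linear_nonpos[OF L])
  have 2: "eventually (\<lambda>n. (L * real m / 2) * real n ^ 2 + (real m * ln R - L * real m / 2) * real n +
      (ln R + ln 2) \<le> 0) sequentially"
    by (rule eventually_quadratic_nonpos[OF mL])
  show ?thesis
    using 1 2
  proof eventually_elim
    case (elim n)
    show ?case
    proof (intro allI impI)
      fix w x assume wx: "inverse R \<le> cmod w" "cmod w \<le> R" "cmod x \<le> R"
      have w0: "w \<noteq> 0" using wx(1) assms by (auto simp: field_simps)
      have W: "W_point ChV (w, x) \<in> topspace W_top" using w0 by (simp add: W_point_in_W)
      have qR: "cmod \<alpha> powi int n * R \<le> 1 / 2"
        using elim(1) assms by (subst powi_le_iff_ln) (auto simp: ln_mult ln_div L_def algebra_simps)
      have "cmod (wfun (gamma_pow (- int n) (W_point ChV (w, x)))) = cmod w / cmod \<alpha> ^ n"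
        by (simp add: wfun_gamma_pow W power_int_minus field_simps)
      also have "\<dots> \<ge> inverse R / cmod \<alpha> ^ n"
        using wx by (intro divide_right_mono) auto
      also have "inverse R / cmod \<alpha> ^ n \<ge> 2"
        using qR assms \<alpha>_pos by (simp add: field_simps)
      finally have g1: "cutoff (int n) (W_point ChV (w, x)) = 1"
        unfolding cutoff_def by (intro clamped_eq_1) simp
      let ?P = "gamma_pow (int n) (W_point ChV (w, x))"
      have "cmod (wfun ?P) = cmod \<alpha> powi int n * cmod w"
        by (simp add: wfun_gamma_pow W del: power_int_of_nat)
      also have "\<dots> \<le> cmod \<alpha> powi int n * R" using wx by (intro mult_left_mono) auto
      finally have w: "cmod (wfun ?P) \<le> 1 / 2" using qR by simp
      define X where "X = cmod \<alpha> powi (int m * tri (int n)) * (cmod w ^ (m * n) * cmod x)"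
      have "X \<le> cmod \<alpha> powi (int m * tri (int n)) * (R ^ (m * n) * R)"
        unfolding X_def using wx assms by (intro mult_left_mono mult_mono power_mono) auto
      also have "\<dots> \<le> 1 / 2"
      proof (subst powi_le_iff_ln)
        have tj: "real_of_int (tri (int n)) = (real n ^ 2 - real n) / 2"
        proof -
          have "2 * real_of_int (tri (int n)) = real_of_int (int n * (int n - 1))"
            by (metis two_tri of_int_mult of_int_numeral)
          then show ?thesis by (simp add: power2_eq_square algebra_simps)
        qed
        have "ln (R ^ (m * n) * R) = real m * real n * ln R + ln R"
          using assms by (simp add: ln_mult ln_realpow)
        then show "real_of_int (int m * tri (int n)) * ln (cmod \<alpha>) + ln (R ^ (m * n) * R) \<le> ln (1 / 2)"
          using elim(2) by (simp add: tj ln_div L_def[symmetric] field_simps)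
      qed (use assms in auto)
      finally have X: "X \<le> 1 / 2" .
      have X0: "0 \<le> X" by (simp add: X_def)
      have "(int m * int n) = int (m * n)" by simp
      then have "tau ?P = X / (1 + X)"
        using \<alpha>_nz by (simp add: gamma_pow_def T_simps tau_W_point X_def norm_mult norm_power_int norm_power mult.assoc del: of_nat_mult)
      also have "\<dots> \<le> 1 / 3" using X X0 by (simp add: field_simps)
      finally have g0: "cutoff (- int n) (W_point ChV (w, x)) = 0"
        using w by (simp add: cutoff_def clamped_eq_0)
      show "cutoff (int n) (W_point ChV (w, x)) = 1 \<and> cutoff (- int n) (W_point ChV (w, x)) = 0"
        using g0 g1 by simp
    qed
  qed
qed

text \<open>This makes the regularised sum \<open>h\<close> locally a finite one, hence
  continuous.\<close>

lemma cutoff_locally_finite: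
  assumes z: "z \<in> chart_dom i"
  obtains N and n0 :: nat where "open N" "z \<in> N" "N \<subseteq> chart_dom i"
    "\<And>p n. p \<in> N \<Longrightarrow> n \<ge> n0 \<Longrightarrow> cutoff (int n) (W_point i p) = 1"
    "\<And>p n. p \<in> N \<Longrightarrow> n \<ge> n0 \<Longrightarrow> cutoff (- int n) (W_point i p) = 0"
proof -
  obtain u v where uv: "z = (u, v)" by (metis surj_pair)
  show thesis
  proof (cases i)
    case (ChU k)
    define R where "R = 1 + cmod u + cmod v"
    have R: "R \<ge> 1" by (simp add: R_def)
    obtain n0 where n0: "\<And>n x y. n \<ge> n0 \<Longrightarrow> cmod x \<le> R \<Longrightarrow> cmod y \<le> R \<Longrightarrow>
       cutoff (- int n) (W_point (ChU k) (x, y)) = 0 \<and> cutoff (int n) (W_point (ChU k) (x, y)) = 1"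
      using eventually_conj[OF cutoff_0_ChU[OF R, of k] cutoff_1_ChU[OF R, of k]]
      unfolding eventually_sequentially by blast
    show thesis
      by (rule that[of "ball 0 R \<times> ball 0 R" n0])
        (use n0 ChU in \<open>auto simp: open_Times uv R_def add_pos_nonneg add_nonneg_pos\<close>)
  next
    case ChV
    have u: "u \<noteq> 0" using z uv ChV by simp
    define R where "R = 1 + cmod u + cmod v + inverse (cmod u)"
    have R: "R \<ge> 1" by (simp add: R_def)
    obtain n0 where n0: "\<And>n w x. n \<ge> n0 \<Longrightarrow> inverse R \<le> cmod w \<Longrightarrow> cmod w \<le> R \<Longrightarrow> cmod x \<le> R \<Longrightarrow>
       cutoff (int n) (W_point ChV (w, x)) = 1 \<and> cutoff (- int n) (W_point ChV (w, x)) = 0"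
      using cutoff_ChV[OF R] unfolding eventually_sequentially by blast
    have "inverse (cmod u) < R" by (simp add: R_def add_pos_nonneg)
    then have "inverse R < cmod u" using u R
      by (metis inverse_inverse_eq inverse_less_imp_less inverse_less_iff_less inverse_positive_iff_positive zero_less_norm_iff)
    moreover have "inverse R > 0" using R by simp
    ultimately show thesis
      by (intro that[of "(ball 0 R - cball 0 (inverse R)) \<times> ball 0 R" n0])
        (use n0 ChV u in \<open>auto simp: open_Times uv R_def[symmetric] open_Diff intro: order.strict_trans1\<close>,
          auto simp: R_def add_pos_nonneg add_nonneg_pos add_strict_increasing)
  qed
qed

text \<open>The symmetric partial sums of the following series: 1 - \<open>cutoff n P\<close> summed
  over n >= 0, minus \<open>cutoff n P\<close> summed over n < 0. The summand N collects the
  ones.\<close>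

definition cutoff_count :: "nat \<Rightarrow> W_pt \<Rightarrow> real" where
  "cutoff_count N P = real N - (\<Sum>n\<in>{- int N..<int N}. cutoff n P)"

definition h :: "W_pt \<Rightarrow> real" where
  "h P = lim (\<lambda>N. cutoff_count N P)"

lemma cutoff_count_Suc: "cutoff_count (Suc N) P = cutoff_count N P + 1 - cutoff (int N) P - cutoff (- int N - 1) P"
proof -
  have "{- int (Suc N)..<int (Suc N)} = insert (int N) (insert (- int N - 1) {- int N..<int N})" by auto
  then show ?thesis by (simp add: cutoff_count_def)
qed

lemma cutoff_count_constant:
  assumes "\<And>n. n \<ge> n0 \<Longrightarrow> cutoff (int n) P = 1" "\<And>n. n \<ge> n0 \<Longrightarrow> cutoff (- int n) P = 0" "N \<ge> n0"
  shows "cutoff_count N P = cutoff_count n0 P"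
  using assms(3)
proof (induction N rule: dec_induct)
  case (step N)
  have "- int N - 1 = - int (Suc N)" by simp
  then have "cutoff (- int N - 1) P = 0" using assms(2)[of "Suc N"] step by (simp only: le_SucI)
  then show ?case using step assms(1)[of N] by (simp add: cutoff_count_Suc)
qed simp

lemma h_eq_cutoff_count:
  assumes "\<And>n. n \<ge> n0 \<Longrightarrow> cutoff (int n) P = 1" "\<And>n. n \<ge> n0 \<Longrightarrow> cutoff (- int n) P = 0" "N \<ge> n0"
  shows "h P = cutoff_count N P"
proof -
  have "(\<lambda>N. cutoff_count N P) \<longlonglongrightarrow> cutoff_count n0 P"
  proof (rule tendsto_eventually)
    show "eventually (\<lambda>N. cutoff_count N P = cutoff_count n0 P) sequentially"
      unfolding eventually_sequentially
    proof (intro exI allI impI)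
      fix N assume "n0 \<le> N"
      show "cutoff_count N P = cutoff_count n0 P" by (rule cutoff_count_constant[OF assms(1,2) \<open>n0 \<le> N\<close>])
    qed
  qed
  then show ?thesis using cutoff_count_constant[OF assms] by (simp add: h_def limI)
qed

lemma continuous_map_h: "continuous_map W_top euclideanreal h"
  unfolding continuous_map_from_W
proof
  fix i
  have cN: "continuous_on (chart_dom i) (\<lambda>p. cutoff_count N (W_point i p))" for N
  proof -
    have "continuous_on (chart_dom i) (\<lambda>p. cutoff n (W_point i p))" for n
      using continuous_map_cutoff[of n] unfolding continuous_map_from_W by auto
    then show ?thesis unfolding cutoff_count_def by (intro continuous_intros)
  qed
  have "isCont (\<lambda>p. h (W_point i p)) z" if z: "z \<in> chart_dom i" for z
  proof -
    obtain N and n0 :: nat where N: "open N" "z \<in> N" "N \<subseteq> chart_dom i"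
      "\<And>p n. p \<in> N \<Longrightarrow> n \<ge> n0 \<Longrightarrow> cutoff (int n) (W_point i p) = 1"
      "\<And>p n. p \<in> N \<Longrightarrow> n \<ge> n0 \<Longrightarrow> cutoff (- int n) (W_point i p) = 0"
      using cutoff_locally_finite[OF z] by blast
    have "continuous_on N (\<lambda>p. h (W_point i p))"
    proof (rule continuous_on_eq[OF continuous_on_subset[OF cN N(3)]])
      fix p assume "p \<in> N"
      show "cutoff_count n0 (W_point i p) = h (W_point i p)"
        by (rule h_eq_cutoff_count[symmetric, OF N(4)[OF \<open>p \<in> N\<close>] N(5)[OF \<open>p \<in> N\<close>] order_refl])
    qed
    then show ?thesis using N(1,2) continuous_on_eq_continuous_at by blast
  qed
  then show "continuous_map (top_of_set (chart_dom i)) euclideanreal (\<lambda>p. h (W_point i p))"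
    by (simp add: continuous_at_imp_continuous_on)
qed

text \<open>gamma shifts the index of the cutoffs by one, so that inside the window a term 1 at the
  upper end is exchanged for a term 0 at the lower end.\<close>

lemma h_gamma:
  assumes "P \<in> topspace W_top"
  shows "h (gamma m \<alpha> P) = h P + 1"
proof -
  obtain i z where z: "z \<in> chart_dom i" "P = W_point i z" using assms by (auto simp: topspace_W_top)
  obtain n0 :: nat where n0: "\<And>n. n \<ge> n0 \<Longrightarrow> cutoff (int n) P = 1" "\<And>n. n \<ge> n0 \<Longrightarrow> cutoff (- int n) P = 0"
    using cutoff_locally_finite[OF z(1)] z(2) by metis
  have gg: "cutoff n (gamma m \<alpha> P) = cutoff (n - 1) P" for n by (rule cutoff_gamma[OF assms])
  \<comment> \<open>One more than n0, because the n-th cutoff at gamma P is the one with index n - 1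
    at P.\<close>
  define N where "N = Suc n0"
  have 1: "cutoff (int n) (gamma m \<alpha> P) = 1" if "n \<ge> N" for n
    using n0(1)[of "n - 1"] that by (simp add: gg N_def of_nat_diff)
  have e: "- int n - 1 = - int (Suc n)" for n by simp
  have 2: "cutoff (- int n) (gamma m \<alpha> P) = 0" if "n \<ge> N" for n
    using n0(2)[of "Suc n"] that unfolding gg e N_def by simp
  have "(\<Sum>n\<in>{- int N..<int N}. cutoff (n - 1) P) = (\<Sum>n\<in>{- int N - 1..<int N - 1}. cutoff n P)"
    by (rule sum.reindex_bij_witness[of _ "\<lambda>n. n + 1" "\<lambda>n. n - 1"]) auto
  moreover have "insert (int N - 1) {- int N - 1..<int N - 1} = insert (- int N - 1) {- int N..<int N}"
    by (auto simp: N_def)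
  then have "sum (\<lambda>n. cutoff n P) (insert (int N - 1) {- int N - 1..<int N - 1}) =
      sum (\<lambda>n. cutoff n P) (insert (- int N - 1) {- int N..<int N})" by simp
  then have "cutoff (int N - 1) P + (\<Sum>n\<in>{- int N - 1..<int N - 1}. cutoff n P) =
      cutoff (- int N - 1) P + (\<Sum>n\<in>{- int N..<int N}. cutoff n P)" by simp
  moreover have "cutoff (int N - 1) P = 1" using n0(1)[of n0] by (simp add: N_def)
  moreover have "cutoff (- int N - 1) P = 0" unfolding e by (rule n0(2)) (simp add: N_def)
  ultimately have "cutoff_count N (gamma m \<alpha> P) = cutoff_count N P + 1" by (simp add: cutoff_count_def gg)
  moreover have "h P = cutoff_count N P" by (rule h_eq_cutoff_count[OF n0]) (auto simp: N_def)
  moreover have "h (gamma m \<alpha> P) = cutoff_count N (gamma m \<alpha> P)" by (rule h_eq_cutoff_count[OF 1 2]) auto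
  ultimately show ?thesis by simp
qed

end

section \<open>The covering \<open>W \<rightarrow> S\<close> and lifting\<close>

lemma connected_integer_valued_constant:
  assumes "connected A" "A \<subseteq> \<int>" "a \<in> A" "b \<in> A"
  shows "a = (b :: real)"
proof (rule ccontr)
  assume "a \<noteq> b"
  have False if "u < v" "u \<in> A" "v \<in> A" for u v
  proof -
    have "u \<in> \<int>" "v \<in> \<int>" using that assms by auto
    then obtain k l :: int where kl: "u = k" "v = l" by (auto elim!: Ints_cases)
    then have "k < l" using that by simp
    then have "u + 1 / 2 \<in> {u..v}" using kl by (auto simp: field_simps)
    then have "u + 1 / 2 \<in> \<int>"
      using connected_contains_Icc[OF assms(1) that(2,3)] assms(2) by blast
    then obtain j :: int where "u + 1 / 2 = j" by (auto elim!: Ints_cases)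
    then have "2 * (j - k) = 1" using kl by (metis (mono_tags) add_diff_cancel_left' field_sum_of_halves of_int_1 of_int_diff of_int_eq_iff of_int_mult of_int_numeral mult_2)
    then show False by presburger
  qed
  with \<open>a \<noteq> b\<close> assms show False by (metis linorder_neqE_linordered_idom)
qed

text \<open>The difference of f and g is an integer multiple of 2 pi i and varies
  continuously.\<close>

lemma exp_eq_on_connected:
  fixes f g :: "'a::topological_space \<Rightarrow> complex"
  assumes "connected A" "continuous_on A f" "continuous_on A g"
    and eq: "\<And>z. z \<in> A \<Longrightarrow> exp (f z) = exp (g z)" and a: "a \<in> A" "f a = g a" and z: "z \<in> A"
  shows "f z = g z"
proof -
  define d where "d = (\<lambda>z. Im (f z - g z) / (2 * pi))"
  have fg: "\<exists>n::int. f z - g z = of_int n * (2 * of_real pi * \<i>)" if zA: "z \<in> A" for z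
  proof -
    obtain n :: int where "f z = g z + of_real (real_of_int (2 * n) * pi) * \<i>"
      using eq[OF zA] unfolding exp_eq by blast
    then show ?thesis by (intro exI[of _ n]) simp
  qed
  have "connected (d ` A)"
    unfolding d_def using assms by (intro connected_continuous_image continuous_intros) auto
  moreover have "d ` A \<subseteq> \<int>"
  proof
    fix t assume "t \<in> d ` A"
    then obtain z where z: "z \<in> A" "t = d z" by blast
    obtain n :: int where "f z - g z = of_int n * (2 * of_real pi * \<i>)" using fg[OF z(1)] by blast
    then have "t = of_int n" by (simp add: z(2) d_def del: minus_complex.sel)
    then show "t \<in> \<int>" by simp
  qed
  ultimately have "d z = d a" using connected_integer_valued_constant a z by blast
  then have "Im (f z - g z) = 0" using a by (simp add: d_def)
  moreover obtain n :: int where n: "f z - g z = of_int n * (2 * of_real pi * \<i>)" using fg[OF z] by blast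
  ultimately have "Im (of_int n * (2 * of_real pi * \<i>)) = 0" by metis
  then have "n = 0" by simp
  with n show ?thesis by simp
qed

lemma connected_punctured: "connected (- {0 :: complex})"
  by (rule connected_punctured_universe) simp

text \<open>All charts contain the point with coordinates \<open>(1, 1)\<close> and meet in connected sets, hence
  logarithms on the charts agree once they are normalised there.\<close>

lemma W_continuous_logarithm:
  assumes K: "continuous_map W_top euclidean K" and nz: "\<And>P. P \<in> topspace W_top \<Longrightarrow> K P \<noteq> (0 :: complex)"
  obtains L where "continuous_map W_top euclidean L" "\<And>P. P \<in> topspace W_top \<Longrightarrow> exp (L P) = K P"
proof -
  define P1 where "P1 = W_point (ChU 0) (1, 1)"
  have P1: "W_point i (1, 1) = P1" for i unfolding P1_def by (rule W_point_1)
  have P1nz: "K P1 \<noteq> 0" by (rule nz) (simp add: P1_def W_point_in_W)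
  have contK: "continuous_on (chart_dom i) (\<lambda>z. K (W_point i z))" for i
    using K unfolding continuous_map_from_W by auto
  \<comment> \<open>Logarithms on C^2, normalised by the principal value at the chosen point
    c.\<close>
  have log: "\<exists>l. continuous_on UNIV l \<and> (\<forall>z. exp (l z) = k z) \<and> l c = Ln (k c)"
    if k: "continuous_on UNIV k" "\<And>z. k z \<noteq> 0" for k :: "C2 \<Rightarrow> complex" and c
  proof -
    obtain l where l: "continuous_on UNIV l" "\<And>z. k z = exp (l z)"
      using continuous_logarithm_on_contractible[OF k(1) convex_imp_contractible[OF convex_UNIV]] k(2)
      by auto
    show ?thesis
      by (rule exI[of _ "\<lambda>z. l z + (Ln (k c) - l c)"])
        (use l k in \<open>auto intro!: continuous_intros simp: exp_add exp_diff\<close>)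
  qed
  have "\<exists>l. continuous_on UNIV l \<and> (\<forall>z. exp (l z) = K (W_point (ChU k) z)) \<and> l (1, 1) = Ln (K P1)" for k
    using log[of "\<lambda>z. K (W_point (ChU k) z)" "(1, 1)"] contK[of "ChU k"] nz W_point_in_W[of _ "ChU k"] by (simp add: P1)
  then obtain l where l: "\<And>k. continuous_on UNIV (l k)" "\<And>k z. exp (l k z) = K (W_point (ChU k) z)"
    "\<And>k. l k (1, 1) = Ln (K P1)"
    by metis
  have lo: "continuous_on A (\<lambda>z. l k (g z))" if "continuous_on A g" for A k and g :: "C2 \<Rightarrow> C2"
    using continuous_on_compose2[OF l(1) that] by auto
  \<comment> \<open>V is not simply connected, so its logarithm is first taken on the covering (u,
    x) -> (exp u, x).\<close>
  have "continuous_on UNIV (\<lambda>z. K (W_point ChV (exp (fst z), snd z)))"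
    by (rule continuous_on_compose2[OF contK[of ChV], of UNIV "\<lambda>z. (exp (fst z), snd z)"])
      (auto intro!: continuous_intros)
  then obtain M where M: "continuous_on UNIV M" "\<And>u x. exp (M (u, x)) = K (W_point ChV (exp u, x))"
    "M (0, 1) = Ln (K P1)"
    using log[of "\<lambda>z. K (W_point ChV (exp (fst z), snd z))" "(0, 1)"] nz W_point_in_W[of _ ChV] by (auto simp: P1)
  have Mo: "continuous_on A (\<lambda>z. M (g z))" if "continuous_on A g" for A and g :: "'b::topological_space \<Rightarrow> C2"
    using continuous_on_compose2[OF M(1) that] by auto
  \<comment> \<open>For nonzero x the same point has coordinates (x, w / x) in U_0, where a
    logarithm is already defined. So M depends on u only through exp u: the loop around w = 0 bounds
    a disc in U_0.\<close>
  have Ml: "M (u, x) = l 0 (x, exp u / x)" if "x \<noteq> 0" for u x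
  proof -
    have "M (u, x) = l 0 (snd (u, x), exp (fst (u, x)) / snd (u, x))"
    proof (rule exp_eq_on_connected[of "UNIV \<times> (- {0})" M "\<lambda>z. l 0 (snd z, exp (fst z) / snd z)" "(0, 1)" "(u, x)"])
      show "connected ((UNIV :: complex set) \<times> (- {0 :: complex}))"
        by (intro connected_Times connected_punctured) auto
      show "continuous_on (UNIV \<times> - {0}) M" using M(1) continuous_on_subset by blast
      show "continuous_on (UNIV \<times> - {0}) (\<lambda>z. l 0 (snd z, exp (fst z) / snd z))"
        by (intro lo continuous_intros) auto
      fix z :: C2 assume "z \<in> UNIV \<times> - {0}"
      then obtain u x where z: "z = (u, x)" "x \<noteq> 0" by auto
      then show "exp (M z) = exp (l 0 (snd z, exp (fst z) / snd z))"
        using W_point_VU[of "exp u" x 0] by (simp add: M(2) l(2) divide_inverse)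
    qed (use that M(3) l(3) in auto)
    then show ?thesis by simp
  qed
  have Mper: "M (u, x) = M (v, x)" if "exp u = exp v" for u v x
  proof (cases "x = 0")
    case True
    \<comment> \<open>The chart U_0 does not contain the points with x = 0; there the periodicity
      follows by continuity.\<close>
    have c: "((\<lambda>x. M (u, x)) \<longlongrightarrow> M (u, 0)) (at 0)" for u
      using Mo[of UNIV "\<lambda>x. (u, x)"] continuous_on_def by (force intro!: continuous_intros)
    have "((\<lambda>x. M (u, x)) \<longlongrightarrow> M (v, 0)) (at 0)"
      by (rule Lim_transform_eventually[OF c[of v]])
        (auto simp: eventually_at Ml that intro: exI[of _ 1])
    from tendsto_unique[OF _ c[of u] this] show ?thesis using True by simp
  qed (simp add: Ml that)
  have lk: "l k (x, y) = l 0 (x powi (k + 1) * y powi k, x * y / (x powi (k + 1) * y powi k))"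
    if "x \<noteq> 0" "y \<noteq> 0" for k x y
  proof -
    define g where "g = (\<lambda>z :: C2. (fst z powi (k + 1) * snd z powi k, fst z * snd z / (fst z powi (k + 1) * snd z powi k)))"
    have "l k (x, y) = l 0 (g (x, y))"
    proof (rule exp_eq_on_connected[of "(- {0}) \<times> (- {0})" "l k" "\<lambda>z. l 0 (g z)" "(1, 1)" "(x, y)"])
      show "connected ((- {0 :: complex}) \<times> (- {0 :: complex}))"
        by (intro connected_Times connected_punctured)
      show "continuous_on ((- {0}) \<times> (- {0})) (l k)" using l(1) continuous_on_subset by blast
      show "continuous_on ((- {0}) \<times> (- {0})) (\<lambda>z. l 0 (g z))"
        unfolding g_def by (intro lo continuous_intros) auto
      fix z :: C2 assume "z \<in> (- {0}) \<times> (- {0})"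
      then obtain x y where z: "z = (x, y)" "x \<noteq> 0" "y \<noteq> 0" by auto
      then show "exp (l k z) = exp (l 0 (g z))"
        using W_point_VU[of "x * y" "x powi (k + 1) * y powi k" 0]
        by (simp add: l(2) g_def W_point_UV[of x y k] divide_inverse)
    qed (use that l(3) in \<open>auto simp: g_def\<close>)
    then show ?thesis by (simp add: g_def)
  qed
  have lkk: "l k (x, y) = l (k + 1) (inverse y, x * y\<^sup>2)" if "y \<noteq> 0" for k x y
  proof -
    have "l k (x, y) = l (k + 1) (inverse (snd (x, y)), fst (x, y) * (snd (x, y))\<^sup>2)"
    proof (rule exp_eq_on_connected[of "UNIV \<times> (- {0})" "l k"
          "\<lambda>z. l (k + 1) (inverse (snd z), fst z * (snd z)\<^sup>2)" "(1, 1)" "(x, y)"])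
      show "connected ((UNIV :: complex set) \<times> (- {0 :: complex}))"
        by (intro connected_Times connected_punctured) auto
      show "continuous_on (UNIV \<times> (- {0})) (l k)" using l(1) continuous_on_subset by blast
      show "continuous_on (UNIV \<times> (- {0})) (\<lambda>z. l (k + 1) (inverse (snd z), fst z * (snd z)\<^sup>2))"
        by (intro lo continuous_intros) auto
      fix z :: C2 assume "z \<in> UNIV \<times> (- {0})"
      then obtain x y where z: "z = (x, y)" "y \<noteq> 0" by auto
      then show "exp (l k z) = exp (l (k + 1) (inverse (snd z), fst z * (snd z)\<^sup>2))"
        by (simp add: l(2) W_point_UU[of y k x])
    qed (use that l(3) in auto)
    then show ?thesis by (simp only: fst_conv snd_conv)
  qed
  define q where "q = (\<lambda>c. case c of (ChU k, z) \<Rightarrow> l k z | (ChV, (w, x)) \<Rightarrow> M (Ln w, x))"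
  have qc: "q a = q b" if "glue a b" for a b
    using that
  proof cases
    case (glue_UU y k x)
    then show ?thesis by (simp add: q_def lkk[symmetric])
  next
    case (glue_UV x y k)
    then show ?thesis
      using lk[of x y k] Ml[of "x powi (k + 1) * y powi k" "Ln (x * y)"] by (simp add: q_def)
  qed
  define L where "L = W_desc q"
  have L: "L (W_point i z) = q (i, z)" for i z
    unfolding L_def by (rule W_desc) (rule qc)
  show thesis
  proof (rule that)
    show "continuous_map W_top euclidean L"
      unfolding continuous_map_from_W
    proof
      fix i
      show "continuous_map (top_of_set (chart_dom i)) euclidean (\<lambda>z. L (W_point i z))"
      proof (cases i)
        case (ChU k)
        then show ?thesis using l(1) by (simp add: L q_def)
      next
        case ChV
        have "isCont (\<lambda>z. M (Ln (fst z), snd z)) z0" if z0: "fst z0 \<noteq> 0" for z0 :: C2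
        proof (cases "fst z0 \<in> \<real>\<^sub>\<le>\<^sub>0")
          case False
          have "isCont (\<lambda>z. (Ln (fst z), snd z)) z0" using False by (intro continuous_intros) auto
          moreover have "isCont M (Ln (fst z0), snd z0)" using M(1) by (simp add: continuous_on_eq_continuous_at)
          ultimately show ?thesis using continuous_within_compose3[of M] by (auto intro: isCont_o2)
        next
          \<comment> \<open>On the branch cut, M being periodic in u, Ln w may be replaced by Ln (-
            w) + pi i, which is continuous there.\<close>
          case True
          then have "- fst z0 \<notin> \<real>\<^sub>\<le>\<^sub>0" using z0
            by (auto elim!: nonpos_Reals_cases)
          then have "isCont (\<lambda>z. (Ln (- fst z) + of_real pi * \<i>, snd z)) z0" by (intro continuous_intros) auto
          moreover have "isCont M (Ln (- fst z0) + of_real pi * \<i>, snd z0)" using M(1) by (simp add: continuous_on_eq_continuous_at)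
          ultimately have c: "isCont (\<lambda>z. M (Ln (- fst z) + of_real pi * \<i>, snd z)) z0"
            by (auto intro: isCont_o2)
          have "M (Ln (fst z), snd z) = M (Ln (- fst z) + of_real pi * \<i>, snd z)" if "fst z \<noteq> 0" for z :: C2
            by (rule Mper) (use that in \<open>simp add: exp_add\<close>)
          moreover have "eventually (\<lambda>z :: C2. fst z \<noteq> 0) (nhds z0)"
            using eventually_nhds open_fst_neq(1) z0 by auto
          ultimately have "eventually (\<lambda>z. M (Ln (fst z), snd z) = M (Ln (- fst z) + of_real pi * \<i>, snd z)) (nhds z0)"
            by (auto elim: eventually_mono)
          from isCont_cong[OF this] c show ?thesis by simp
        qed
        then have "continuous_on (chart_dom ChV) (\<lambda>z. M (Ln (fst z), snd z))"
          by (intro continuous_at_imp_continuous_on) auto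
        then show ?thesis by (simp add: L q_def ChV case_prod_unfold)
      qed
    qed
    fix P assume "P \<in> topspace W_top"
    then show "exp (L P) = K P"
      by (cases rule: topspace_W_cases) (simp_all add: L q_def l M)
  qed
qed

context inoue begin

abbreviation W where "W \<equiv> topspace W_top"
abbreviation S where "S \<equiv> topspace (S_top m \<alpha>)"
abbreviation p where "p \<equiv> S_proj m \<alpha>"

lemma h_gamma_pow: "P \<in> W \<Longrightarrow> h (gamma_pow n P) = h P + of_int n"
proof -
  have 1: "h (gamma_pow (int k) P) = h P + real k" if "P \<in> W" for k P
  proof (induction k)
    case (Suc k)
    have "gamma_pow (int (Suc k)) P = gamma m \<alpha> (gamma_pow (int k) P)"
      using that gamma_pow_add[of P 1 "int k"] gamma_pow_1[OF gamma_pow_in_W[OF that]] by (simp add: add.commute)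
    then show ?case using h_gamma[OF gamma_pow_in_W[OF that]] Suc by simp
  qed (simp add: gamma_pow_0 that)
  assume P: "P \<in> W"
  show ?thesis
  proof (cases n rule: int_cases2)
    case (nonpos k)
    have "gamma_pow (int k) (gamma_pow n P) = P" using P nonpos by (simp add: gamma_pow_add gamma_pow_0)
    then show ?thesis using 1[OF gamma_pow_in_W[OF P], of k n] nonpos by simp
  qed (simp add: 1 P)
qed

text \<open>The subgroup generated by gamma consists of its integer powers, and these are the maps
  \<open>gamma_pow n\<close> restricted to W.\<close>

lemma S_proj_eq: "P \<in> W \<Longrightarrow> p P = {gamma_pow n P | n. True}"
proof -
  assume P: "P \<in> W"
  let ?G = "BijGroup W"
  interpret group ?G by (rule group_BijGroup)
  define f where "f n = (\<lambda>P\<in>W. gamma_pow n P)" for n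
  have fB: "f n \<in> Bij W" for n
  proof -
    have "bij_betw (f n) W W"
      by (rule bij_betw_byWitness[of _ "gamma_pow (- n)"]) (auto simp: f_def gamma_pow_add gamma_pow_0 gamma_pow_in_W)
    then show ?thesis by (simp add: Bij_def f_def)
  qed
  have fm: "f n \<otimes>\<^bsub>?G\<^esub> f k = f (n + k)" for n k
    using fB by (auto simp: BijGroup_def compose_def f_def gamma_pow_add gamma_pow_in_W fun_eq_iff restrict_def)
  have f0: "f 0 = \<one>\<^bsub>?G\<^esub>" by (auto simp: f_def BijGroup_def gamma_pow_0 fun_eq_iff restrict_def)
  have f1: "f 1 = gamma m \<alpha>"
    using gamma_in_Bij[OF \<alpha>_nz, of m] by (auto simp: f_def Bij_def extensional_def fun_eq_iff restrict_def gamma_pow_1)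
  have fc: "f n \<in> carrier ?G" for n using fB by (simp add: BijGroup_def)
  have pow: "f 1 [^]\<^bsub>?G\<^esub> k = f (int k)" for k :: nat
  proof (induction k)
    case (Suc k)
    then show ?case by (simp add: fm add.commute)
  qed (simp add: f0)
  have ipow: "f 1 [^]\<^bsub>?G\<^esub> n = f n" for n :: int
  proof (cases n rule: int_cases2)
    case (nonneg k)
    then show ?thesis by (simp add: int_pow_int pow)
  next
    case (nonpos k)
    have "inv\<^bsub>?G\<^esub> (f (int k)) = f (- int k)"
      by (rule inv_equality) (auto simp: fm f0 fc)
    then show ?thesis using nonpos fc by (simp add: int_pow_neg int_pow_int pow)
  qed
  have "carrier (subgroup_generated ?G {gamma m \<alpha>}) = {f 1 [^]\<^bsub>?G\<^esub> n | n :: int. True}"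
    unfolding carrier_subgroup_generated_by_singleton[OF fc[of 1, unfolded f1], unfolded f1]
    using carrier_subgroup_generated_by_singleton[OF fc[of 1, unfolded f1]] f1 by auto
  then have c: "carrier (subgroup_generated ?G {gamma m \<alpha>}) = {f n | n. True}"
    unfolding ipow .
  have "p P = {f n P | n. True}"
    unfolding S_proj_def orbit_def c by blast
  then show ?thesis using P by (simp add: f_def)
qed

section \<open>Points and topology of the quotient\<close>

lemma p_eq_iff: "P \<in> W \<Longrightarrow> Q \<in> W \<Longrightarrow> p P = p Q \<longleftrightarrow> (\<exists>n. Q = gamma_pow n P)"
proof
  assume PQ: "P \<in> W" "Q \<in> W" and "p P = p Q"
  moreover have "Q \<in> p Q" using gamma_pow_0[OF PQ(2)] by (auto simp: S_proj_eq PQ intro!: exI[of _ 0])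
  ultimately show "\<exists>n. Q = gamma_pow n P" by (auto simp: S_proj_eq)
next
  assume PQ: "P \<in> W" "Q \<in> W" and "\<exists>n. Q = gamma_pow n P"
  then obtain n where n: "Q = gamma_pow n P" by blast
  have "gamma_pow k P = gamma_pow (k - n) Q" "gamma_pow k Q = gamma_pow (k + n) P" for k using PQ by (simp_all add: n gamma_pow_add)
  then have "{gamma_pow n P | n. True} = {gamma_pow n Q | n. True}"
    by (intro subset_antisym subsetI; clarify; metis)
  then show "p P = p Q" using PQ by (simp add: S_proj_eq)
qed

lemma p_gamma_pow: "P \<in> W \<Longrightarrow> p (gamma_pow n P) = p P"
  using p_eq_iff gamma_pow_in_W by metis

lemma topspace_S: "S = p ` W"
  by (simp add: S_top_def)

lemma openin_S: "openin (S_top m \<alpha>) B \<longleftrightarrow> B \<subseteq> S \<and> openin W_top {P \<in> W. p P \<in> B}"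
  by (simp add: S_top_def openin_quotient_topology)

lemma continuous_map_from_S: "continuous_map (S_top m \<alpha>) Y g \<longleftrightarrow> continuous_map W_top Y (\<lambda>P. g (p P))"
proof
  have *: "continuous_map W_top (S_top m \<alpha>) p"
    using openin_S topspace_S by (auto simp: continuous_map_def)
  assume "continuous_map (S_top m \<alpha>) Y g"
  from continuous_map_compose[OF * this] show "continuous_map W_top Y (\<lambda>P. g (p P))" by (simp add: o_def)
next
  assume c: "continuous_map W_top Y (\<lambda>P. g (p P))"
  show "continuous_map (S_top m \<alpha>) Y g"
    unfolding continuous_map_def
  proof (intro conjI allI impI)
    show "g \<in> S \<rightarrow> topspace Y" using c by (auto simp: topspace_S continuous_map_def)
    fix U assume "openin Y U"
    then have "openin W_top {P \<in> W. g (p P) \<in> U}" using c by (auto simp: continuous_map_def)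
    moreover have "{P \<in> W. p P \<in> {x \<in> S. g x \<in> U}} = {P \<in> W. g (p P) \<in> U}"
      by (auto simp: topspace_S)
    ultimately show "openin (S_top m \<alpha>) {x \<in> S. g x \<in> U}" by (auto simp: openin_S)
  qed
qed

lemma continuous_map_p: "continuous_map W_top (S_top m \<alpha>) p"
  using continuous_map_from_S[of "S_top m \<alpha>" "\<lambda>x. x"] by simp

lemma W_holomorphic_gamma_pow: "W_holomorphic (gamma_pow n)"
  unfolding gamma_pow_def using \<alpha>_nz by (intro W_holomorphic_T) auto

lemma open_p_image:
  assumes "openin W_top B"
  shows "openin (S_top m \<alpha>) (p ` B)"
proof -
  have B: "B \<subseteq> W" using assms openin_subset by blast
  have "{P \<in> W. p P \<in> p ` B} = (\<Union>n. {P \<in> W. gamma_pow n P \<in> B})"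
  proof (intro subset_antisym subsetI)
    fix P assume "P \<in> {P \<in> W. p P \<in> p ` B}"
    then obtain Q where Q: "P \<in> W" "Q \<in> B" "p P = p Q" by auto
    then obtain n where "Q = gamma_pow n P" using p_eq_iff[of P Q] B by auto
    then show "P \<in> (\<Union>n. {P \<in> W. gamma_pow n P \<in> B})" using Q by blast
  next
    fix P assume "P \<in> (\<Union>n. {P \<in> W. gamma_pow n P \<in> B})"
    then obtain n where "P \<in> W" "gamma_pow n P \<in> B" by auto
    then show "P \<in> {P \<in> W. p P \<in> p ` B}" using p_gamma_pow[of P n] imageI[of "gamma_pow n P" B p] by simp
  qed
  moreover have "openin W_top {P \<in> W. gamma_pow n P \<in> B}" for n
    using W_holomorphic_continuous[OF W_holomorphic_gamma_pow] assms by (auto simp: continuous_map_def)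
  ultimately show ?thesis using B by (auto simp: openin_S topspace_S)
qed

text \<open>Bands play the role of evenly covered sets: gamma^n with n nonzero changes h by at least
  1, while h varies by less than 1 on a band.\<close>

definition band :: "real \<Rightarrow> W_pt set" where
  "band c = {P \<in> W. \<bar>h P - c\<bar> < 1 / 2}"

lemma openin_band: "openin W_top (band c)"
proof -
  have "openin W_top {P \<in> W. h P \<in> U}" if "open U" for U
    using continuous_map_h that by (auto simp: continuous_map_def)
  then have "openin W_top {P \<in> W. h P \<in> ball c (1 / 2)}" by blast
  moreover have "{P \<in> W. h P \<in> ball c (1 / 2)} = band c"
    by (auto simp: band_def dist_real_def abs_minus_commute)
  ultimately show ?thesis by simp
qed

lemma p_h_inj:
  assumes "P \<in> W" "Q \<in> W" "p P = p Q" "\<bar>h P - h Q\<bar> < 1"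
  shows "P = Q"
proof -
  obtain n where n: "Q = gamma_pow n P" using assms p_eq_iff by blast
  then have "\<bar>real_of_int n\<bar> < 1" using assms h_gamma_pow[of P n] by simp
  then have "n = 0" by linarith
  then show ?thesis using n assms gamma_pow_0 by simp
qed

lemma inj_on_band: "inj_on p (band c)"
proof (rule inj_onI)
  fix P Q assume "P \<in> band c" "Q \<in> band c" "p P = p Q"
  moreover have "\<bar>h P - h Q\<bar> \<le> \<bar>h P - c\<bar> + \<bar>h Q - c\<bar>" by linarith
  ultimately show "P = Q" by (intro p_h_inj) (auto simp: band_def)
qed

text \<open>The difference of h along the two lifts is continuous and integer valued, hence constant
  on the connected space W; its value is n.\<close>

lemma lift_unique:
  assumes "continuous_map W_top W_top F" "continuous_map W_top W_top F'"
    and eq: "\<And>P. P \<in> W \<Longrightarrow> p (F P) = p (F' P)"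
  obtains n where "\<And>P. P \<in> W \<Longrightarrow> F' P = gamma_pow n (F P)"
proof -
  have FW: "F P \<in> W" "F' P \<in> W" if "P \<in> W" for P
    using assms that by (auto simp: continuous_map_def)
  have ex: "\<exists>n. F' P = gamma_pow n (F P)" if "P \<in> W" for P
    using p_eq_iff[OF FW[OF that]] eq[OF that] by blast
  define d where "d = (\<lambda>P. h (F' P) - h (F P))"
  have "continuous_map W_top euclideanreal d"
    unfolding d_def using continuous_map_compose[OF assms(1) continuous_map_h] continuous_map_compose[OF assms(2) continuous_map_h]
    by (intro continuous_map_diff) (auto simp: o_def)
  then have "connected (d ` W)"
    using connectedin_continuous_map_image[of W_top euclideanreal d W] connected_space_W
    by (simp add: connectedin_topspace)
  moreover have dn: "d P = of_int n" if "P \<in> W" "F' P = gamma_pow n (F P)" for P n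
    using that h_gamma_pow[OF FW(1)] by (simp add: d_def)
  then have "d ` W \<subseteq> \<int>" using ex by (metis Ints_of_int image_subsetI)
  ultimately have dc: "d P = d Q" if "P \<in> W" "Q \<in> W" for P Q
    using connected_integer_valued_constant that by blast
  define P0 where "P0 = W_point (ChU 0) (1, 1)"
  have P0: "P0 \<in> W" by (simp add: P0_def W_point_in_W)
  obtain n where n: "F' P0 = gamma_pow n (F P0)" using ex P0 by blast
  show thesis
  proof (rule that)
    fix P assume P: "P \<in> W"
    obtain k where k: "F' P = gamma_pow k (F P)" using ex P by blast
    have "k = n" using dn[OF P k] dn[OF P0 n] dc[OF P P0] by simp
    then show "F' P = gamma_pow n (F P)" using k by simp
  qed
qed

text \<open>A point of S determines h modulo 1, so exp (2 pi i h) does not depend on the preimage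
  that is picked.\<close>

definition circle_map :: "S_pt \<Rightarrow> complex" where
  "circle_map s = exp (2 * of_real pi * \<i> * of_real (h (SOME Q. Q \<in> W \<and> p Q = s)))"

lemma circle_map_p: "P \<in> W \<Longrightarrow> circle_map (p P) = exp (2 * of_real pi * \<i> * of_real (h P))"
proof -
  assume P: "P \<in> W"
  define Q where "Q = (SOME Q. Q \<in> W \<and> p Q = p P)"
  have Q: "Q \<in> W \<and> p Q = p P" unfolding Q_def by (rule someI[of _ P]) (use P in auto)
  then obtain n where "Q = gamma_pow n P" using p_eq_iff P by metis
  then have "h Q = h P + of_int n" using h_gamma_pow P by simp
  then have "2 * of_real pi * \<i> * of_real (h Q) = 2 * of_real pi * \<i> * of_real (h P) + of_real (real_of_int (2 * n) * pi) * \<i>"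
    by (simp add: algebra_simps)
  then show ?thesis unfolding circle_map_def Q_def[symmetric] exp_eq by blast
qed

lemma continuous_map_circle_map: "continuous_map (S_top m \<alpha>) euclidean circle_map"
proof -
  have "continuous_map W_top euclidean (\<lambda>P. exp (2 * of_real pi * \<i> * of_real (h P)))"
    using continuous_map_compose[OF continuous_map_h, of euclidean "\<lambda>t. exp (2 * of_real pi * \<i> * of_real t)"]
    by (simp add: o_def continuous_intros)
  then show ?thesis
    unfolding continuous_map_from_S by (rule continuous_map_eq) (simp add: circle_map_p)
qed

text \<open>A logarithm of \<open>circle_map \<circ> f \<circ> p\<close> prescribes the value of \<open>h\<close> at the lift, and \<open>h\<close> separates
  the points of a fibre of \<open>p\<close>.\<close>

lemma lift_exists:
  assumes f: "continuous_map (S_top m \<alpha>) (S_top m \<alpha>) f"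
  obtains F where "continuous_map W_top W_top F" "\<And>P. P \<in> W \<Longrightarrow> p (F P) = f (p P)"
proof -
  have fp: "continuous_map W_top (S_top m \<alpha>) (\<lambda>P. f (p P))" using f continuous_map_from_S by blast
  have fS: "f (p P) \<in> S" if "P \<in> W" for P using fp that by (auto simp: continuous_map_def)
  have "continuous_map W_top euclidean (\<lambda>P. circle_map (f (p P)))"
    using continuous_map_compose[OF fp continuous_map_circle_map] by (simp add: o_def)
  then obtain L where L: "continuous_map W_top euclidean L" "\<And>P. P \<in> W \<Longrightarrow> exp (L P) = circle_map (f (p P))"
    by (rule W_continuous_logarithm) (auto simp: circle_map_def)
  \<comment> \<open>By the choice of L, \<open>el P\<close> is congruent modulo 1 to h at every
    preimage of f (p P), so that some preimage has exactly this height.\<close>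
  define el where "el P = Im (L P) / (2 * pi)" for P
  have "continuous_map W_top euclideanreal el"
    using continuous_map_compose[OF L(1), of euclideanreal "\<lambda>z. Im z / (2 * pi)"]
    by (simp add: o_def el_def[abs_def] continuous_intros)
  then have elo: "openin W_top {P \<in> W. el P \<in> U}" if "open U" for U
    using that by (auto simp: continuous_map_def)
  have ex: "\<exists>Q. Q \<in> W \<and> p Q = f (p P) \<and> h Q = el P" if P: "P \<in> W" for P
  proof -
    obtain Q where Q: "Q \<in> W" "p Q = f (p P)" using fS[OF P] by (auto simp: topspace_S)
    have "exp (L P) = exp (2 * of_real pi * \<i> * of_real (h Q))" using L(2)[OF P] circle_map_p[OF Q(1)] Q(2) by simp
    then obtain n :: int where "L P = 2 * of_real pi * \<i> * of_real (h Q) + of_real (real_of_int (2 * n) * pi) * \<i>"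
      unfolding exp_eq by blast
    then have "el P = h Q + n" by (simp add: el_def field_simps)
    then have "h (gamma_pow n Q) = el P" using h_gamma_pow[OF Q(1)] by simp
    then show ?thesis using Q p_gamma_pow gamma_pow_in_W by metis
  qed
  define F where "F P = (SOME Q. Q \<in> W \<and> p Q = f (p P) \<and> h Q = el P)" for P
  have F: "F P \<in> W" "p (F P) = f (p P)" "h (F P) = el P" if "P \<in> W" for P
    using someI_ex[OF ex[OF that]] unfolding F_def by auto
  have "continuous_map W_top W_top F"
    unfolding continuous_map_eq_topcontinuous_at topcontinuous_at_def
  proof (intro ballI conjI allI impI)
    fix P0 V assume P0: "P0 \<in> W" and V: "openin W_top V \<and> F P0 \<in> V"
    define O' where "O' = V \<inter> band (h (F P0))"
    have O': "openin W_top O'" "F P0 \<in> O'"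
      using V openin_band F(1)[OF P0] by (auto simp: O'_def openin_Int, simp add: band_def)
    \<comment> \<open>For P in N, the point f (p P) has a preimage Q in O' whose height is within
      1/2 of h (F P0), and so is \<open>el P\<close>. So F P and Q lie in one fibre at heights less
      than 1 apart and coincide.\<close>
    define N where "N = {P \<in> W. f (p P) \<in> p ` O'} \<inter> {P \<in> W. el P \<in> ball (h (F P0)) (1 / 2)}"
    have "openin W_top {P \<in> W. f (p P) \<in> p ` O'}"
      using fp open_p_image[OF O'(1)] by (auto simp: continuous_map_def)
    then have "openin W_top N" unfolding N_def by (intro openin_Int elo open_ball)
    moreover have "f (p P0) \<in> p ` O'" using F(2)[OF P0] O'(2) by (metis imageI)
    then have "P0 \<in> N" unfolding N_def using F[OF P0] P0 by simp
    moreover have "F P \<in> V" if PN: "P \<in> N" for P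
    proof -
      obtain Q where Q: "Q \<in> O'" "f (p P) = p Q" and P: "P \<in> W" and l: "\<bar>el P - h (F P0)\<bar> < 1 / 2"
        using PN by (auto simp: N_def dist_real_def abs_minus_commute)
      have QW: "Q \<in> W" "\<bar>h Q - h (F P0)\<bar> < 1 / 2" using Q by (auto simp: O'_def band_def)
      have "\<bar>el P - h Q\<bar> \<le> \<bar>el P - h (F P0)\<bar> + \<bar>h Q - h (F P0)\<bar>" by linarith
      then have "F P = Q"
        by (intro p_h_inj) (use F[OF P] Q QW l in auto)
      then show ?thesis using Q by (auto simp: O'_def)
    qed
    ultimately show "\<exists>U. openin W_top U \<and> P0 \<in> U \<and> (\<forall>P\<in>U. F P \<in> V)" by blast
  qed (use F in auto)
  then show thesis using that F by blast
qed

section \<open>Holomorphy of lifts and of the maps they induce\<close>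

definition S_chart :: "W_pt set \<Rightarrow> chart_index \<Rightarrow> S_pt \<Rightarrow> C2" where
  "S_chart B i = (\<lambda>q. inv_into (chart_dom i) (W_point i) (inv_into B p q))"

lemma S_atlas_eq:
  "S_atlas m \<alpha> = {(p ` B, S_chart B i) | B i. openin W_top B \<and> inj_on p B \<and> B \<subseteq> W_point i ` chart_dom i}"
  unfolding S_atlas_def quotient_atlas_def W_atlas_def S_chart_def by blast

lemma S_chart_simps:
  assumes "inj_on p B" "B \<subseteq> W_point i ` chart_dom i" "\<zeta> \<in> chart_dom i" "W_point i \<zeta> \<in> B"
  shows "S_chart B i (p (W_point i \<zeta>)) = \<zeta>" "inv_into (p ` B) (S_chart B i) \<zeta> = p (W_point i \<zeta>)"
proof -
  have 1: "S_chart B i (p (W_point i \<zeta>)) = \<zeta>" if "\<zeta> \<in> chart_dom i" "W_point i \<zeta> \<in> B" for \<zeta>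
    using that assms(1) by (simp add: S_chart_def inj_on_W_point inv_into_f_f)
  then show "S_chart B i (p (W_point i \<zeta>)) = \<zeta>" using assms by blast
  have "inj_on (S_chart B i) (p ` B)"
  proof (rule inj_onI)
    fix q q' assume "q \<in> p ` B" "q' \<in> p ` B" and eq: "S_chart B i q = S_chart B i q'"
    then obtain \<zeta> \<zeta>' where q: "\<zeta> \<in> chart_dom i" "W_point i \<zeta> \<in> B" "q = p (W_point i \<zeta>)"
      "\<zeta>' \<in> chart_dom i" "W_point i \<zeta>' \<in> B" "q' = p (W_point i \<zeta>')"
      using assms(2) by blast
    then have "\<zeta> = \<zeta>'" using eq 1 by simp
    then show "q = q'" using q by simp
  qed
  then show "inv_into (p ` B) (S_chart B i) \<zeta> = p (W_point i \<zeta>)"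
    using 1[OF assms(3,4)] assms(4) by (intro inv_into_f_eq) auto
qed

text \<open>On charts cut down to bands the projection is injective, and the coordinate expression
  of f there is also one of F.\<close>

lemma lift_holomorphic:
  assumes f: "holomorphic_map (S_top m \<alpha>) (S_atlas m \<alpha>) (S_top m \<alpha>) (S_atlas m \<alpha>) f"
    and F: "continuous_map W_top W_top F" "\<And>P. P \<in> W \<Longrightarrow> p (F P) = f (p P)"
  shows "W_holomorphic F"
  unfolding W_holomorphic_def
proof (intro allI ballI)
  fix i z assume z: "z \<in> chart_dom i"
  let ?P = "W_point i z"
  have PW: "?P \<in> W" using z by (rule W_point_in_W)
  have FW: "F P \<in> W" if "P \<in> W" for P using F that by (auto simp: continuous_map_def)
  obtain j z' where z': "z' \<in> chart_dom j" "F ?P = W_point j z'"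
    using FW[OF PW] by (auto simp: topspace_W_top)
  define B' where "B' = band (h (F ?P)) \<inter> W_point j ` chart_dom j"
  have B': "openin W_top B'" "inj_on p B'" "B' \<subseteq> W_point j ` chart_dom j" "F ?P \<in> B'"
    using openin_band W_point_image_chart_dom_open inj_on_band[of "h (F ?P)"] FW[OF PW] z'
    by (auto simp: B'_def openin_Int inj_on_Int, simp add: band_def)
  define B where "B = band (h ?P) \<inter> W_point i ` chart_dom i \<inter> {P \<in> W. F P \<in> B'}"
  have "openin W_top {P \<in> W. F P \<in> B'}" using F(1) B'(1) by (auto simp: continuous_map_def)
  then have B: "openin W_top B" "inj_on p B" "B \<subseteq> W_point i ` chart_dom i" "?P \<in> B"
    using openin_band W_point_image_chart_dom_open inj_on_band[of "h ?P"] B'(4) PW z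
    by (auto simp: B_def openin_Int inj_on_Int, simp add: band_def)
  have "(p ` B, S_chart B i) \<in> S_atlas m \<alpha>" "(p ` B', S_chart B' j) \<in> S_atlas m \<alpha>"
    using B B' unfolding S_atlas_eq by blast+
  then have hol: "holomorphic2_on (\<lambda>z. S_chart B' j (f (inv_into (p ` B) (S_chart B i) z)))
      (S_chart B i ` {x \<in> p ` B. f x \<in> p ` B'})"
    using f unfolding holomorphic_map_def by fastforce
  define N where "N = {\<zeta> \<in> chart_dom i. W_point i \<zeta> \<in> B}"
  have No: "open N" "z \<in> N" using B z by (auto simp: N_def openin_W_top)
  define \<theta> where "\<theta> = (\<lambda>z. S_chart B' j (f (inv_into (p ` B) (S_chart B i) z)))"
  have "hol2_at \<theta> \<zeta> \<and> \<theta> \<zeta> \<in> chart_dom j \<and> F (W_point i \<zeta>) = W_point j (\<theta> \<zeta>)" if "\<zeta> \<in> N" for \<zeta>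
  proof -
    have \<zeta>: "\<zeta> \<in> chart_dom i" "W_point i \<zeta> \<in> B" using that by (auto simp: N_def)
    note s = S_chart_simps[OF B(2,3) \<zeta>]
    have FB': "F (W_point i \<zeta>) \<in> B'" using \<zeta> by (auto simp: B_def)
    have e: "f (p (W_point i \<zeta>)) = p (F (W_point i \<zeta>))" using F(2) W_point_in_W \<zeta> by metis
    obtain \<eta> where \<eta>: "\<eta> \<in> chart_dom j" "F (W_point i \<zeta>) = W_point j \<eta>" using FB' B'(3) by blast
    have "\<theta> \<zeta> = \<eta>"
      unfolding \<theta>_def s e \<eta>(2) by (rule S_chart_simps[OF B'(2,3) \<eta>(1)]) (use FB' \<eta> in simp)
    moreover have "\<zeta> \<in> S_chart B i ` {x \<in> p ` B. f x \<in> p ` B'}"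
      using s(1) \<zeta> e FB' by (intro image_eqI[of _ _ "p (W_point i \<zeta>)"]) auto
    then have "hol2_at \<theta> \<zeta>" using hol unfolding holomorphic2_on_iff \<theta>_def by blast
    ultimately show ?thesis using \<eta> by simp
  qed
  then have "locally_holomorphic F i z j (\<theta> z)"
    unfolding locally_holomorphic_def using No by (intro exI[of _ N] exI[of _ \<theta>]) (auto simp: N_def)
  then show "\<exists>j z'. locally_holomorphic F i z j z'" by blast
qed

lemma W_holomorphic_compose:
  assumes "W_holomorphic F" "W_holomorphic G"
  shows "W_holomorphic (\<lambda>P. G (F P))"
  unfolding W_holomorphic_def
proof (intro allI ballI)
  fix i z assume "z \<in> chart_dom i"
  then obtain j z' where 1: "locally_holomorphic F i z j z'" using assms unfolding W_holomorphic_def by blast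
  then have "z' \<in> chart_dom j" using locally_holomorphic_value by blast
  then obtain k z'' where "locally_holomorphic G j z' k z''" using assms unfolding W_holomorphic_def by blast
  with 1 show "\<exists>j z'. locally_holomorphic (\<lambda>P. G (F P)) i z j z'" using locally_holomorphic_compose by blast
qed

text \<open>The chart of the target may lie on another sheet than the values of F. So f is
  represented there by gamma^n composed with F, where n is determined at the point considered and
  still works nearby.\<close>

lemma descend_holomorphic:
  assumes F: "W_holomorphic F" and fp: "\<And>P. P \<in> W \<Longrightarrow> p (F P) = f (p P)"
  shows "holomorphic_map (S_top m \<alpha>) (S_atlas m \<alpha>) (S_top m \<alpha>) (S_atlas m \<alpha>) f"
proof -
  have Fc: "continuous_map W_top W_top F" by (rule W_holomorphic_continuous[OF F])
  have FW: "F P \<in> W" if "P \<in> W" for P using Fc that by (auto simp: continuous_map_def)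
  have "continuous_map W_top (S_top m \<alpha>) (\<lambda>P. p (F P))"
    using continuous_map_compose[OF Fc continuous_map_p] by (simp add: o_def)
  then have cont: "continuous_map (S_top m \<alpha>) (S_top m \<alpha>) f"
    unfolding continuous_map_from_S by (rule continuous_map_eq) (simp add: fp)
  have "holomorphic2_on (\<lambda>z. S_chart B' j (f (inv_into (p ` B) (S_chart B i) z)))
      (S_chart B i ` {x \<in> p ` B. f x \<in> p ` B'})"
    if B: "openin W_top B" "inj_on p B" "B \<subseteq> W_point i ` chart_dom i"
      and B': "openin W_top B'" "inj_on p B'" "B' \<subseteq> W_point j ` chart_dom j" for B B' i j
  proof -
    let ?D = "S_chart B i ` {x \<in> p ` B. f x \<in> p ` B'}"
    let ?g = "\<lambda>z. S_chart B' j (f (inv_into (p ` B) (S_chart B i) z))"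
    have "\<exists>N. open N \<and> \<zeta>0 \<in> N \<and> N \<subseteq> ?D \<and> hol2_at ?g \<zeta>0" if zD: "\<zeta>0 \<in> ?D" for \<zeta>0
    proof -
      obtain P where P: "P \<in> B" "f (p P) \<in> p ` B'" "\<zeta>0 = S_chart B i (p P)" using zD by blast
      obtain \<zeta> where \<zeta>: "\<zeta> \<in> chart_dom i" "P = W_point i \<zeta>" using P(1) B(3) by blast
      have \<zeta>0: "\<zeta>0 = \<zeta>" using S_chart_simps(1)[OF B(2,3) \<zeta>(1)] P \<zeta> by simp
      have PW: "P \<in> W" using \<zeta> W_point_in_W by simp
      obtain Q where Q: "Q \<in> B'" "p (F P) = p Q" using P(2) fp[OF PW] by auto
      have QW: "Q \<in> W" using Q B'(1) openin_subset by blast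
      obtain n where n: "Q = gamma_pow n (F P)" using p_eq_iff[OF FW[OF PW] QW] Q(2) by blast
      obtain z' where z': "z' \<in> chart_dom j" "Q = W_point j z'" using Q(1) B'(3) by blast
      have "locally_holomorphic (\<lambda>P. gamma_pow n (F P)) i \<zeta> j z'"
        by (rule W_holomorphic_locally_holomorphic[OF W_holomorphic_compose[OF F W_holomorphic_gamma_pow] \<zeta>(1)])
          (use n z' \<zeta> in simp)
      then obtain N \<theta> where N: "open N" "\<zeta> \<in> N" "N \<subseteq> chart_dom i" "\<theta> \<zeta> = z'"
        "\<And>\<zeta>. \<zeta> \<in> N \<Longrightarrow> hol2_at \<theta> \<zeta>" "\<And>\<zeta>. \<zeta> \<in> N \<Longrightarrow> \<theta> \<zeta> \<in> chart_dom j"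
        "\<And>\<zeta>. \<zeta> \<in> N \<Longrightarrow> gamma_pow n (F (W_point i \<zeta>)) = W_point j (\<theta> \<zeta>)"
        unfolding locally_holomorphic_def by blast
      define N' where "N' = {\<zeta> \<in> N. \<theta> \<zeta> \<in> {\<eta> \<in> chart_dom j. W_point j \<eta> \<in> B'}} \<inter> {\<zeta> \<in> chart_dom i. W_point i \<zeta> \<in> B}"
      have "open {\<zeta> \<in> N. \<theta> \<zeta> \<in> {\<eta> \<in> chart_dom j. W_point j \<eta> \<in> B'}}"
        by (rule open_hol_preimage[OF N(1,5)]) (use B'(1) in \<open>auto simp: openin_W_top\<close>)
      then have N'o: "open N'" using B(1) unfolding N'_def by (intro open_Int) (auto simp: openin_W_top)
      have N'\<zeta>: "\<zeta> \<in> N'" using N \<zeta> P Q z' by (auto simp: N'_def)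
      have key: "?g \<eta> = \<theta> \<eta> \<and> \<eta> \<in> ?D" if "\<eta> \<in> N'" for \<eta>
      proof -
        have \<eta>: "\<eta> \<in> N" "\<eta> \<in> chart_dom i" "W_point i \<eta> \<in> B" "\<theta> \<eta> \<in> chart_dom j" "W_point j (\<theta> \<eta>) \<in> B'"
          using that by (auto simp: N'_def)
        have \<eta>W: "W_point i \<eta> \<in> W" using \<eta> W_point_in_W by blast
        note s = S_chart_simps[OF B(2,3) \<eta>(2,3)]
        have e: "f (p (W_point i \<eta>)) = p (W_point j (\<theta> \<eta>))"
          using fp[OF \<eta>W] p_gamma_pow[OF FW[OF \<eta>W], of n] N(7)[OF \<eta>(1)] by simp
        have "?g \<eta> = \<theta> \<eta>" unfolding s e by (rule S_chart_simps[OF B'(2,3) \<eta>(4,5)])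
        moreover have "\<eta> \<in> ?D"
          using s(1) \<eta> e by (intro image_eqI[of _ _ "p (W_point i \<eta>)"]) auto
        ultimately show ?thesis by blast
      qed
      have "hol2_at ?g \<zeta>"
        by (rule hol2_at_cong[OF N(5)[OF N(2)] N'o N'\<zeta>]) (use key in blast)
      moreover have "N' \<subseteq> ?D" using key by blast
      ultimately show ?thesis using N'o N'\<zeta> unfolding \<zeta>0 by (intro exI[of _ N'] conjI)
    qed
    note loc = this
    show ?thesis unfolding holomorphic2_on_iff
    proof (intro conjI ballI)
      show "open ?D"
      proof (rule Topological_Spaces.openI)
        fix x assume "x \<in> ?D"
        then obtain N where "open N" "x \<in> N" "N \<subseteq> ?D" using loc by meson
        then show "\<exists>T. open T \<and> x \<in> T \<and> T \<subseteq> ?D" by (intro exI[of _ N] conjI)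
      qed
      fix z assume "z \<in> ?D"
      then show "hol2_at ?g z" using loc by meson
    qed
  qed
  note chart = this
  show ?thesis
    unfolding holomorphic_map_def
  proof (intro conjI cont ballI)
    fix a assume "a \<in> S_atlas m \<alpha>"
    then obtain B i where a: "a = (p ` B, S_chart B i)" "openin W_top B" "inj_on p B" "B \<subseteq> W_point i ` chart_dom i"
      unfolding S_atlas_eq by blast
    show "case a of (U, \<phi>) \<Rightarrow> \<forall>(V, \<psi>)\<in>S_atlas m \<alpha>.
        holomorphic2_on (\<lambda>z. \<psi> (f (inv_into U \<phi> z))) (\<phi> ` {x \<in> U. f x \<in> V})"
      unfolding a(1) prod.case
    proof
      fix b assume "b \<in> S_atlas m \<alpha>"
      then obtain B' j where b: "b = (p ` B', S_chart B' j)" "openin W_top B'" "inj_on p B'" "B' \<subseteq> W_point j ` chart_dom j"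
        unfolding S_atlas_eq by blast
      show "case b of (V, \<psi>) \<Rightarrow> holomorphic2_on (\<lambda>z. \<psi> (f (inv_into (p ` B) (S_chart B i) z)))
          (S_chart B i ` {x \<in> p ` B. f x \<in> V})"
        unfolding b(1) prod.case by (rule chart[OF a(2-4) b(2-4)])
    qed
  qed
qed

end

section \<open>Classification of the automorphisms\<close>

text \<open>The points (x0 + t, y0 + t) avoid both axes for small nonzero t and tend to z0.\<close>

lemma eq_by_density:
  fixes u v :: "C2 \<Rightarrow> complex"
  assumes u: "isCont u z0" and v: "isCont v z0" and N: "open N" "z0 \<in> N"
    and eq: "\<And>x y. (x, y) \<in> N \<Longrightarrow> x \<noteq> 0 \<Longrightarrow> y \<noteq> 0 \<Longrightarrow> u (x, y) = v (x, y)"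
  shows "u z0 = v z0"
proof -
  obtain x0 y0 where z0: "z0 = (x0, y0)" by (metis surj_pair)
  let ?c = "\<lambda>t. (x0 + t, y0 + t)"
  have c: "isCont ?c 0" by (intro continuous_intros)
  have uc: "((\<lambda>t. u (?c t)) \<longlongrightarrow> u z0) (at 0)"
    using isCont_o2[OF c, of u] u by (simp add: z0 isCont_def)
  have vc: "((\<lambda>t. v (?c t)) \<longlongrightarrow> v z0) (at 0)"
    using isCont_o2[OF c, of v] v by (simp add: z0 isCont_def)
  have "eventually (\<lambda>t. ?c t \<in> N) (at 0)"
    using c N by (intro topological_tendstoD[of ?c "?c 0"]) (auto simp: isCont_def z0)
  moreover have nz: "eventually (\<lambda>t. a + t \<noteq> 0) (at 0)" for a :: complex
  proof (cases "a = 0")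
    case False
    have "((\<lambda>t. a + t) \<longlongrightarrow> a + 0) (at 0)" by (intro tendsto_intros)
    then show ?thesis using False by (intro tendsto_imp_eventually_ne[of _ "a + 0"]) auto
  qed (simp add: eventually_at_filter)
  ultimately have "eventually (\<lambda>t. u (?c t) = v (?c t)) (at 0)"
    using nz[of x0] nz[of y0] by eventually_elim (rule eq)
  from Lim_transform_eventually[OF uc this] show ?thesis
    using tendsto_unique[OF _ _ vc] by simp
qed

lemma hol_at_wfun_W_point: "hol_at (\<lambda>z. wfun (W_point i z)) z"
proof (cases i)
  case (ChU k)
  have "(\<lambda>z. wfun (W_point i z)) = (\<lambda>z. fst z * snd z)" by (auto simp: ChU)
  then show ?thesis by simp
next
  case ChV
  have "(\<lambda>z. wfun (W_point i z)) = fst" by (auto simp: ChV)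
  then show ?thesis by simp
qed

lemma hol_at_wfun:
  assumes "W_holomorphic H" "z \<in> chart_dom i"
  shows "hol_at (\<lambda>z. wfun (H (W_point i z))) z"
proof -
  obtain j z' where "locally_holomorphic H i z j z'" using assms unfolding W_holomorphic_def by blast
  then obtain N \<theta> where N: "open N" "z \<in> N" 
    "\<And>\<zeta>. \<zeta> \<in> N \<Longrightarrow> hol2_at \<theta> \<zeta> \<and> H (W_point i \<zeta>) = W_point j (\<theta> \<zeta>)"
    unfolding locally_holomorphic_def by blast
  have "hol_at (\<lambda>\<zeta>. wfun (W_point j (\<theta> \<zeta>))) z"
    using hol_at_compose[of "\<lambda>z. wfun (W_point j z)" \<theta> z] hol_at_wfun_W_point N by blast
  then show ?thesis by (rule hol_at_cong[OF _ N(1,2)]) (simp add: N(3))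
qed

lemma holomorphic_slice_fst:
  assumes "\<And>t. t \<in> A \<Longrightarrow> hol_at f (t, c)"
  shows "(\<lambda>t. f (t, c)) holomorphic_on A"
  unfolding holomorphic_on_def
proof
  fix t assume "t \<in> A"
  have "(\<lambda>t. f (t, c)) field_differentiable (at t)"
    by (rule hol_at_curve[of f "\<lambda>t. t" t "\<lambda>t. c" 1 0, OF assms[OF \<open>t \<in> A\<close>] DERIV_ident DERIV_const])
  then show "(\<lambda>t. f (t, c)) field_differentiable (at t within A)"
    by (rule field_differentiable_at_within)
qed

lemma holomorphic_slice_snd:
  assumes "\<And>t. t \<in> A \<Longrightarrow> hol_at f (c, t)"
  shows "(\<lambda>t. f (c, t)) holomorphic_on A"
  unfolding holomorphic_on_def
proof
  fix t assume "t \<in> A"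
  have "(\<lambda>t. f (c, t)) field_differentiable (at t)"
    by (rule hol_at_curve[of f "\<lambda>t. c" t "\<lambda>t. t" 0 1, OF assms[OF \<open>t \<in> A\<close>] DERIV_const DERIV_ident])
  then show "(\<lambda>t. f (c, t)) field_differentiable (at t within A)"
    by (rule field_differentiable_at_within)
qed

text \<open>The composite of w with H is constant on the fibres of w in V. The curve t -> (1, t) in
  U_0 is a section of w also over 0, which yields an entire \<psi>; density extends the identity to
  the points with w = 0.\<close>

lemma wfun_fibre:
  assumes H: "W_holomorphic H"
  obtains \<psi> where "\<psi> holomorphic_on UNIV" "\<And>P. P \<in> topspace W_top \<Longrightarrow> wfun (H P) = \<psi> (wfun P)"
proof -
  define \<phi> where "\<phi> w x = wfun (H (W_point ChV (w, x)))" for w x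
  define \<psi> where "\<psi> = (\<lambda>t. wfun (H (W_point (ChU 0) (1, t))))"
  have \<psi>: "\<psi> holomorphic_on UNIV"
    unfolding \<psi>_def
    by (rule holomorphic_slice_snd[of UNIV "\<lambda>z. wfun (H (W_point (ChU 0) z))" 1, OF hol_at_wfun[OF H]]) simp_all
  have h\<phi>: "hol_at (\<lambda>(w, x). \<phi> w x) z" if "fst z \<noteq> 0" for z
    using hol_at_wfun[OF H, of z ChV] that by (simp add: \<phi>_def case_prod_unfold)
  have \<phi>1: "\<phi> w x = \<psi> w" if "w \<noteq> 0" for w x
  proof -
    have "\<phi> w x = \<phi> w 1"
    proof (rule holomorphic_on_charts_fibre_constant[OF _ _ _ that])
      show "continuous_on ((- {0}) \<times> UNIV) (\<lambda>(w, x). \<phi> w x)"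
        by (intro continuous_at_imp_continuous_on ballI hol_at_imp_isCont h\<phi>) auto
      show "\<phi> w holomorphic_on UNIV" if "w \<noteq> 0" for w
        using holomorphic_slice_snd[of UNIV "\<lambda>(w, x). \<phi> w x" w, OF h\<phi>] that by simp
      fix k :: int and x :: complex assume x: "x \<noteq> 0"
      show "\<exists>Y. Y holomorphic_on UNIV \<and> (\<forall>y. y \<noteq> 0 \<longrightarrow> Y y = \<phi> (x * y) (x powi (k + 1) * y powi k))"
      proof (intro exI conjI allI impI)
        show "(\<lambda>y. wfun (H (W_point (ChU k) (x, y)))) holomorphic_on UNIV"
          by (rule holomorphic_slice_snd[of UNIV "\<lambda>z. wfun (H (W_point (ChU k) z))" x, OF hol_at_wfun[OF H]]) simp_all
      qed (simp add: \<phi>_def W_point_UV x)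
    qed
    also have "\<dots> = \<psi> w" using that by (simp add: \<phi>_def \<psi>_def W_point_UV)
    finally show ?thesis .
  qed
  have "wfun (H P) = \<psi> (wfun P)" if "P \<in> topspace W_top" for P
    using that
  proof (cases rule: topspace_W_cases)
    case (1 k x y)
    have "(\<lambda>z. wfun (H (W_point (ChU k) z))) (x, y) = (\<lambda>z. \<psi> (fst z * snd z)) (x, y)"
    proof (rule eq_by_density[where u = "\<lambda>z. wfun (H (W_point (ChU k) z))" and v = "\<lambda>z. \<psi> (fst z * snd z)" and N = UNIV])
      show "isCont (\<lambda>z. wfun (H (W_point (ChU k) z))) (x, y)"
        by (intro hol_at_imp_isCont hol_at_wfun[OF H]) simp
      have "isCont \<psi> (fst (x, y) * snd (x, y))"
        using holomorphic_on_imp_continuous_on[OF \<psi>] continuous_on_eq_continuous_at[OF open_UNIV, of \<psi>] by blast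
      then show "isCont (\<lambda>z. \<psi> (fst z * snd z)) (x, y)"
        by (intro isCont_o2[of _ "\<lambda>z. fst z * snd z" \<psi>] continuous_intros)
      fix u v :: complex assume "u \<noteq> 0" "v \<noteq> 0"
      then show "wfun (H (W_point (ChU k) (u, v))) = \<psi> (fst (u, v) * snd (u, v))"
        using \<phi>1[of "u * v"] by (simp add: W_point_UV \<phi>_def)
    qed auto
    then show ?thesis using 1 by simp
  next
    case (2 w x)
    then show ?thesis using \<phi>1[of w x] by (simp add: \<phi>_def)
  qed
  with \<psi> that show thesis by blast
qed

text \<open>This amounts to the Hausdorff property of \<open>W\<close>.\<close>

lemma W_identity_by_density:
  assumes H: "W_holomorphic H" and V: "\<And>w x. w \<noteq> 0 \<Longrightarrow> H (W_point ChV (w, x)) = W_point ChV (w, x)"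
    and P: "P \<in> topspace W_top"
  shows "H P = P"
  using P
proof (cases rule: topspace_W_cases)
  case (1 k x0 y0)
  show ?thesis
  proof (cases "x0 \<noteq> 0 \<and> y0 \<noteq> 0")
    case True
    then have "P = W_point ChV (x0 * y0, x0 powi (k + 1) * y0 powi k)" using 1 W_point_UV by blast
    then show ?thesis using V True by simp
  next
    case False
    obtain j z' where l: "locally_holomorphic H (ChU k) (x0, y0) j z'"
      using H[unfolded W_holomorphic_def, rule_format, of "(x0, y0)" "ChU k"] by auto
    then obtain N \<theta> where N: "open N" "(x0, y0) \<in> N" "\<theta> (x0, y0) = z'"
      "\<And>\<zeta>. \<zeta> \<in> N \<Longrightarrow> hol2_at \<theta> \<zeta>" "\<And>\<zeta>. \<zeta> \<in> N \<Longrightarrow> \<theta> \<zeta> \<in> chart_dom j"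
      "\<And>\<zeta>. \<zeta> \<in> N \<Longrightarrow> H (W_point (ChU k) \<zeta>) = W_point j (\<theta> \<zeta>)"
      unfolding locally_holomorphic_def by blast
    have eqN: "W_point j (\<theta> (x, y)) = W_point ChV (x * y, x powi (k + 1) * y powi k)"
      if "(x, y) \<in> N" "x \<noteq> 0" "y \<noteq> 0" for x y
      using N(6)[OF that(1)] V[of "x * y"] that by (simp add: W_point_UV)
    have c: "isCont (\<lambda>z. fst (\<theta> z)) (x0, y0)" "isCont (\<lambda>z. snd (\<theta> z)) (x0, y0)"
      using hol2_at_imp_isCont[OF N(4)[OF N(2)]] by (auto intro: continuous_fst continuous_snd)
    note dens = eq_by_density[OF _ _ N(1,2)]
    show ?thesis
    proof (cases j)
      case ChV
      \<comment> \<open>The limit point would have w = x0 y0 = 0, which does not occur in V.\<close>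
      have "fst (\<theta> (x0, y0)) = fst (x0, y0) * snd (x0, y0)"
      proof (rule dens[OF c(1)])
        show "isCont (\<lambda>z. fst z * snd z) (x0, y0)" by (intro continuous_intros)
        fix x y assume "(x, y) \<in> N" "x \<noteq> 0" "y \<noteq> 0"
        then have "wfun (W_point j (\<theta> (x, y))) = x * y" using eqN by simp
        then show "fst (\<theta> (x, y)) = fst (x, y) * snd (x, y)"
          by (cases "\<theta> (x, y)") (simp add: ChV)
      qed
      then show ?thesis using N(5)[OF N(2)] False by (auto simp: ChV)
    next
      case (ChU k')
      \<comment> \<open>Off the axes \<theta> is the coordinate change from U_k to U_k', a monomial
        map with exponents depending on k - k'.\<close>
      have \<theta>: "fst (\<theta> (x, y)) = x powi (1 + (k - k')) * y powi (k - k') \<and>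
          snd (\<theta> (x, y)) = x powi (- (k - k')) * y powi (1 - (k - k'))"
        if "(x, y) \<in> N" "x \<noteq> 0" "y \<noteq> 0" for x y
      proof -
        let ?w = "x * y" let ?x = "x powi (k + 1) * y powi k"
        have "W_point (ChU k') (\<theta> (x, y)) = W_point (ChU k') (?w powi (- k') * ?x, ?w powi (k' + 1) * inverse ?x)"
          using eqN[OF that] W_point_VU[of ?w ?x k'] that by (simp add: ChU)
        then have "\<theta> (x, y) = (?w powi (- k') * ?x, ?w powi (k' + 1) * inverse ?x)"
          using inj_on_W_point[of "ChU k'"] by (simp add: inj_on_eq_iff)
        moreover have "?w powi (- k') * ?x = x powi (1 + (k - k')) * y powi (k - k')"
          using that by (simp add: power_int_mult_distrib powi_simps field_simps)
        moreover have "?w powi (k' + 1) * inverse ?x = x powi (- (k - k')) * y powi (1 - (k - k'))"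
          using that by (simp add: power_int_mult_distrib powi_simps field_simps)
        ultimately show ?thesis by simp
      qed
      consider "k' = k" | d where "k' = k - int d - 1" | d where "k' = k + int d + 1"
      proof -
        consider "k' = k" | "k - k' - 1 \<ge> 0" | "k' - k - 1 \<ge> 0" by linarith
        then show ?thesis
        proof cases
          case 2
          then obtain d where "k - k' - 1 = int d" using nonneg_int_cases by metis
          then show ?thesis using that(2)[of d] by simp
        next
          case 3
          then obtain d where "k' - k - 1 = int d" using nonneg_int_cases by metis
          then show ?thesis using that(3)[of d] by simp
        qed (rule that)
      qed
      then show ?thesis
      proof cases
        case 1
        have "fst (\<theta> (x0, y0)) = fst (x0, y0)" "snd (\<theta> (x0, y0)) = snd (x0, y0)"
          by (rule dens[OF c(1)], simp, simp add: \<theta> 1, rule dens[OF c(2)], simp, simp add: \<theta> 1)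
        then have "\<theta> (x0, y0) = (x0, y0)" by (simp add: prod_eq_iff)
        then show ?thesis using N(6)[OF N(2)] \<open>P = _\<close> ChU 1 by simp
      next
        case (2 d)
        have e: "k - k' = int (d + 1)" "1 + int (d + 1) = int (d + 2)" "1 - int (d + 1) = - int d" using 2 by auto
        \<comment> \<open>This product is 1 off the axes, hence also in the limit. That forces x0 to
          be nonzero, so y0 = 0, and then d = 0: only the adjacent chart remains, and there the
          limit point is another representative of P.\<close>
        have "snd (\<theta> (x0, y0)) * fst (x0, y0) ^ (d + 1) * snd (x0, y0) ^ d = 1"
        proof (rule dens)
          show "isCont (\<lambda>z. snd (\<theta> z) * fst z ^ (d + 1) * snd z ^ d) (x0, y0)"
            by (intro continuous_intros c)
          fix x y assume "(x, y) \<in> N" "x \<noteq> 0" "y \<noteq> 0"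
          then show "snd (\<theta> (x, y)) * fst (x, y) ^ (d + 1) * snd (x, y) ^ d = 1"
            using \<theta>[of x y] unfolding e minus_minus powi_simps(2)[OF \<open>x \<noteq> 0\<close>] powi_simps(2)[OF \<open>y \<noteq> 0\<close>] power_int_of_nat
            by (simp add: field_simps)
        qed simp
        then have x0: "snd (\<theta> (x0, y0)) * x0 ^ (d + 1) * y0 ^ d = 1" by simp
        then have "x0 \<noteq> 0" by auto
        then have y0: "y0 = 0" using False by simp
        then have d: "d = 0" using x0 by (cases d) auto
        have "fst (\<theta> (x0, y0)) = fst (x0, y0) ^ (d + 2) * snd (x0, y0) ^ (d + 1)"
        proof (rule dens[OF c(1)])
          show "isCont (\<lambda>z. fst z ^ (d + 2) * snd z ^ (d + 1)) (x0, y0)" by (intro continuous_intros)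
          fix x y assume "(x, y) \<in> N" "x \<noteq> 0" "y \<noteq> 0"
          then show "fst (\<theta> (x, y)) = fst (x, y) ^ (d + 2) * snd (x, y) ^ (d + 1)"
            using \<theta>[of x y] unfolding e power_int_of_nat by simp
        qed
        then have "\<theta> (x0, y0) = (0, inverse x0)" 
          using x0 \<open>x0 \<noteq> 0\<close> by (simp add: prod_eq_iff y0 d field_simps)
        then have "H P = W_point (ChU k') (0, inverse x0)"
          using N(6)[OF N(2)] \<open>P = _\<close> ChU by simp
        also have "\<dots> = W_point (ChU k) (x0, 0)"
          using W_point_UU[of "inverse x0" k' 0] \<open>x0 \<noteq> 0\<close> 2 d by simp
        finally show ?thesis using \<open>P = _\<close> y0 by simp
      next
        case (3 d)
        have e: "k - k' = - int (d + 1)" "1 + - int (d + 1) = - int d" "1 - - int (d + 1) = int (d + 2)" using 3 by auto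
        \<comment> \<open>The mirror image of the previous case, with the roles of the two
          coordinates exchanged.\<close>
        have "fst (\<theta> (x0, y0)) * fst (x0, y0) ^ d * snd (x0, y0) ^ (d + 1) = 1"
        proof (rule dens)
          show "isCont (\<lambda>z. fst (\<theta> z) * fst z ^ d * snd z ^ (d + 1)) (x0, y0)"
            by (intro continuous_intros c)
          fix x y assume "(x, y) \<in> N" "x \<noteq> 0" "y \<noteq> 0"
          then show "fst (\<theta> (x, y)) * fst (x, y) ^ d * snd (x, y) ^ (d + 1) = 1"
            using \<theta>[of x y] unfolding e minus_minus powi_simps(2)[OF \<open>x \<noteq> 0\<close>] powi_simps(2)[OF \<open>y \<noteq> 0\<close>] power_int_of_nat
            by (simp add: field_simps)
        qed simp
        then have y0: "fst (\<theta> (x0, y0)) * x0 ^ d * y0 ^ (d + 1) = 1" by simp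
        then have "y0 \<noteq> 0" by auto
        then have x0: "x0 = 0" using False by simp
        then have d: "d = 0" using y0 by (cases d) auto
        have "snd (\<theta> (x0, y0)) = fst (x0, y0) ^ (d + 1) * snd (x0, y0) ^ (d + 2)"
        proof (rule dens[OF c(2)])
          show "isCont (\<lambda>z. fst z ^ (d + 1) * snd z ^ (d + 2)) (x0, y0)" by (intro continuous_intros)
          fix x y assume "(x, y) \<in> N" "x \<noteq> 0" "y \<noteq> 0"
          then show "snd (\<theta> (x, y)) = fst (x, y) ^ (d + 1) * snd (x, y) ^ (d + 2)"
            using \<theta>[of x y] unfolding e minus_minus power_int_of_nat by simp
        qed
        then have "\<theta> (x0, y0) = (inverse y0, 0)" 
          using y0 \<open>y0 \<noteq> 0\<close> by (simp add: prod_eq_iff x0 d field_simps)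
        then have "H P = W_point (ChU k') (inverse y0, 0)"
          using N(6)[OF N(2)] \<open>P = _\<close> ChU by simp
        also have "\<dots> = W_point (ChU k) (0, y0)"
          using W_point_UU[of y0 k 0] \<open>y0 \<noteq> 0\<close> 3 d by simp
        finally show ?thesis using \<open>P = _\<close> x0 by simp
      qed
    qed
  qed
next
  case (2 w x)
  then show ?thesis using V by simp
qed

lemma wfun_nz_ChV:
  assumes "Q \<in> topspace W_top" "wfun Q \<noteq> 0"
  obtains x where "Q = W_point ChV (wfun Q, x)"
  using assms(1)
proof (cases rule: topspace_W_cases)
  case (1 k x y)
  then show ?thesis using assms(2) that W_point_UV[of x y k] by simp
next
  case (2 w x)
  then show ?thesis using that by simp
qed

text \<open>As b is nonzero, H preserves the condition that w is nonzero and so maps V into V; \<Xi>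
  is the second coordinate of this map.\<close>

lemma fibre_map:
  assumes H: "W_holomorphic H" and HW: "\<And>P. P \<in> topspace W_top \<Longrightarrow> H P \<in> topspace W_top"
    and b: "b \<noteq> 0" "\<And>P. P \<in> topspace W_top \<Longrightarrow> wfun (H P) = b * wfun P"
  obtains \<Xi> where "\<And>w x. w \<noteq> 0 \<Longrightarrow> H (W_point ChV (w, x)) = W_point ChV (b * w, \<Xi> (w, x))"
    "\<And>z. fst z \<noteq> 0 \<Longrightarrow> hol_at \<Xi> z"
proof -
  have "\<exists>X. H (W_point ChV (w, x)) = W_point ChV (b * w, X)" if w: "w \<noteq> 0" for w x
  proof -
    have P: "W_point ChV (w, x) \<in> topspace W_top" using w by (simp add: W_point_in_W)
    have "wfun (H (W_point ChV (w, x))) = b * w" using b(2)[OF P] by simp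
    then show ?thesis using wfun_nz_ChV[OF HW[OF P]] b(1) w by (metis mult_eq_0_iff)
  qed
  then obtain X where X: "\<And>w x. w \<noteq> 0 \<Longrightarrow> H (W_point ChV (w, x)) = W_point ChV (b * w, X w x)" by metis
  define \<Xi> where "\<Xi> z = X (fst z) (snd z)" for z
  have H\<Xi>: "H (W_point ChV (w, x)) = W_point ChV (b * w, \<Xi> (w, x))" if "w \<noteq> 0" for w x
    using X that by (simp add: \<Xi>_def)
  have "hol_at \<Xi> z" if z: "fst z \<noteq> 0" for z
  proof -
    obtain w x where wx: "z = (w, x)" "w \<noteq> 0" using z by (cases z) auto
    have "locally_holomorphic H ChV z ChV (b * w, \<Xi> (w, x))"
      by (rule W_holomorphic_locally_holomorphic[OF H]) (use wx H\<Xi> in auto)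
    then obtain N \<theta> where N: "open N" "z \<in> N" "N \<subseteq> chart_dom ChV"
      "\<And>\<zeta>. \<zeta> \<in> N \<Longrightarrow> hol2_at \<theta> \<zeta> \<and> \<theta> \<zeta> \<in> chart_dom ChV \<and> H (W_point ChV \<zeta>) = W_point ChV (\<theta> \<zeta>)"
      unfolding locally_holomorphic_def by blast
    have "\<Xi> \<zeta> = snd (\<theta> \<zeta>)" if \<zeta>N: "\<zeta> \<in> N" for \<zeta>
    proof -
      obtain w' x' where \<zeta>: "\<zeta> = (w', x')" "w' \<noteq> 0" using N(3) \<zeta>N by (cases \<zeta>) auto
      have "W_point ChV (\<theta> \<zeta>) = W_point ChV (b * w', \<Xi> \<zeta>)" using N(4)[OF \<zeta>N] H\<Xi>[of w' x'] \<zeta> by simp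
      then have "\<theta> \<zeta> = (b * w', \<Xi> \<zeta>)"
        using inj_on_eq_iff[OF inj_on_W_point[of ChV], of "\<theta> \<zeta>" "(b * w', \<Xi> \<zeta>)"] N(4)[OF \<zeta>N] b(1) \<zeta> by simp
      then show ?thesis by simp
    qed
    then show ?thesis
      using hol_at_cong[of "\<lambda>\<zeta>. snd (\<theta> \<zeta>)" z N \<Xi>] N by (auto simp: hol2_at_def)
  qed
  with H\<Xi> that show thesis by blast
qed

context inoue begin

lemma alpha_powi_inj: "\<alpha> powi n = \<alpha> powi k \<Longrightarrow> n = k"
proof -
  assume "\<alpha> powi n = \<alpha> powi k"
  then have "cmod \<alpha> powi n = cmod \<alpha> powi k" by (metis norm_power_int)
  then have "real_of_int n * ln (cmod \<alpha>) = real_of_int k * ln (cmod \<alpha>)"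
    using \<alpha>_pos by (simp add: powr_real_of_int'[symmetric] powr_def)
  then show "n = k" using ln_\<alpha> by simp
qed

lemma lift_of_automorphism:
  assumes F: "W_holomorphic F" and G: "W_holomorphic G"
    and GF: "\<And>P. P \<in> W \<Longrightarrow> G (F P) = gamma_pow j P" and FG: "\<And>P. P \<in> W \<Longrightarrow> F (G P) = gamma_pow j' P"
    and F\<gamma>: "\<And>P. P \<in> W \<Longrightarrow> F (gamma_pow 1 P) = gamma_pow n (F P)"
  obtains b a l where "b \<noteq> 0" "a \<noteq> 0" "b ^ m = \<alpha> powi l" "\<And>P. P \<in> W \<Longrightarrow> F P = T b a l P"
proof -
  have FW: "F P \<in> W" and GW: "G P \<in> W" if "P \<in> W" for P
    using W_holomorphic_continuous[OF F] W_holomorphic_continuous[OF G] that by (auto simp: continuous_map_def)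
  obtain \<psi> where \<psi>: "\<psi> holomorphic_on UNIV" "\<And>P. P \<in> W \<Longrightarrow> wfun (F P) = \<psi> (wfun P)"
    using wfun_fibre[OF F] by blast
  obtain \<eta> where \<eta>: "\<eta> holomorphic_on UNIV" "\<And>P. P \<in> W \<Longrightarrow> wfun (G P) = \<eta> (wfun P)"
    using wfun_fibre[OF G] by blast
  have wG: "wfun (gamma_pow i P) = \<alpha> powi i * wfun P" if "P \<in> W" for i P
    using that by (simp add: gamma_pow_def wfun_T \<alpha>_nz)
  \<comment> \<open>A section of w over the whole plane, turning identities on W into identities
    between entire functions.\<close>
  define R where "R w = W_point (ChU 0) (1, w)" for w
  have R: "R w \<in> W" "wfun (R w) = w" for w by (auto simp: R_def W_point_in_W)
  have \<eta>\<psi>: "\<eta> (\<psi> w) = \<alpha> powi j * w" for w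
    using GF[OF R(1)] wG[OF R(1), of j] \<eta>(2)[OF FW[OF R(1)]] \<psi>(2)[OF R(1)] by (metis R(2))
  have \<psi>\<eta>: "\<psi> (\<eta> w) = \<alpha> powi j' * w" for w
    using FG[OF R(1)] wG[OF R(1), of j'] \<psi>(2)[OF GW[OF R(1)]] \<eta>(2)[OF R(1)] by (metis R(2))
  have \<psi>\<alpha>: "\<psi> (\<alpha> * w) = \<alpha> powi n * \<psi> w" for w
    using F\<gamma>[OF R(1)] wG[OF FW[OF R(1)], of n] wG[OF R(1), of 1] \<psi>(2)[OF gamma_pow_in_W[OF R(1)]] \<psi>(2)[OF R(1)]
    by (metis R(2) power_int_1_right)
  obtain b c where b: "b \<noteq> 0" and bc: "\<And>z. \<psi> z = b * z + c"
    using entire_left_inverse_imp_affine[OF \<psi>(1) \<eta>(1), of "\<alpha> powi j"] \<eta>\<psi> \<alpha>_nz by auto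
  \<comment> \<open>Coefficients are compared in \<psi>(\<alpha> w) = \<alpha>^n \<psi>(w): the
    constant term gives c = \<alpha>^n c, the linear one \<alpha> = \<alpha>^n. Hence n = 1, and
    then c = 0.\<close>
  have c1: "c = \<alpha> powi n * c" using \<psi>\<alpha>[of 0] by (simp add: bc)
  have "b * \<alpha> + c = \<alpha> powi n * (b + c)" using \<psi>\<alpha>[of 1] by (simp add: bc)
  then have "b * \<alpha> + c = \<alpha> powi n * b + c" using c1 by (metis distrib_left)
  then have "b * \<alpha> = b * \<alpha> powi n" by (simp add: mult.commute)
  then have "\<alpha> powi n = \<alpha> powi 1" using b by simp
  then have n1: "n = 1" by (rule alpha_powi_inj)
  have "c = 0"
  proof (rule ccontr)
    assume "c \<noteq> 0"
    then have "\<alpha> = 1" using c1 by (simp add: n1)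
    then show False using \<alpha>_less by simp
  qed
  then have \<psi>b: "wfun (F P) = b * wfun P" if "P \<in> W" for P using \<psi>(2)[OF that] bc by simp
  define b' where "b' = \<alpha> powi j' / b"
  have b': "b' \<noteq> 0" using b \<alpha>_nz by (simp add: b'_def)
  have "wfun (G P) = b' * wfun P" if "P \<in> W" for P
    using \<psi>\<eta>[of "wfun P"] \<eta>(2)[OF that] b \<open>c = 0\<close> by (simp add: bc b'_def field_simps)
  from fibre_map[OF G GW b' this] obtain \<Upsilon> where \<Upsilon>:
    "\<And>w x. w \<noteq> 0 \<Longrightarrow> G (W_point ChV (w, x)) = W_point ChV (b' * w, \<Upsilon> (w, x))" "\<And>z. fst z \<noteq> 0 \<Longrightarrow> hol_at \<Upsilon> z"
    by blast
  from fibre_map[OF F FW b \<psi>b] obtain \<Xi> where \<Xi>: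
    "\<And>w x. w \<noteq> 0 \<Longrightarrow> F (W_point ChV (w, x)) = W_point ChV (b * w, \<Xi> (w, x))" "\<And>z. fst z \<noteq> 0 \<Longrightarrow> hol_at \<Xi> z"
    by blast
  have VW: "W_point ChV (w, x) \<in> W" if "w \<noteq> 0" for w x using that by (simp add: W_point_in_W)
  have V_eq: "x = x'" if "W_point ChV (w, x) = W_point ChV (w', x')" "w \<noteq> 0" "w' \<noteq> 0" for w x w' x'
    using inj_on_eq_iff[OF inj_on_W_point[of ChV], of "(w, x)" "(w', x')"] that by simp
  have aff: "\<exists>A B. A \<noteq> 0 \<and> (\<forall>x. \<Xi> (w, x) = A * x + B)" if w: "w \<noteq> 0" for w
  proof -
    have 1: "(\<lambda>x. \<Xi> (w, x)) holomorphic_on UNIV" by (rule holomorphic_slice_snd) (use \<Xi>(2) w in auto)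
    have 2: "(\<lambda>x. \<Upsilon> (b * w, x)) holomorphic_on UNIV" by (rule holomorphic_slice_snd) (use \<Upsilon>(2) w b in auto)
    \<comment> \<open>The second coordinate of \<open>G (F P) = gamma_pow j P\<close> on V: up to a
      nonzero factor the fibre map of G inverts that of F, as
      \<open>entire_left_inverse_imp_affine\<close> requires.\<close>
    have 3: "\<Upsilon> (b * w, \<Xi> (w, x)) = (\<alpha> powi (int m * tri j) * w powi (int m * j)) * x" for x
    proof -
      have "G (F (W_point ChV (w, x))) = W_point ChV (b' * (b * w), \<Upsilon> (b * w, \<Xi> (w, x)))"
        using w b by (simp add: \<Xi>(1) \<Upsilon>(1))
      moreover have "gamma_pow j (W_point ChV (w, x)) =
          W_point ChV (\<alpha> powi j * w, \<alpha> powi (int m * tri j) * w powi (int m * j) * x)"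
        using \<alpha>_nz by (simp add: gamma_pow_def T_simps)
      ultimately show ?thesis
        using GF[OF VW[OF w]] V_eq w b b' \<alpha>_nz by (metis mult_eq_0_iff power_int_eq_0_iff)
    qed
    have 4: "\<alpha> powi (int m * tri j) * w powi (int m * j) \<noteq> 0" using w \<alpha>_nz by simp
    obtain A B where "A \<noteq> 0" "\<And>x. \<Xi> (w, x) = A * x + B"
      using entire_left_inverse_imp_affine[OF 1 2 4 3] by blast
    then show ?thesis by blast
  qed
  define B where "B w = \<Xi> (w, 0)" for w
  define A where "A w = \<Xi> (w, 1) - \<Xi> (w, 0)" for w
  have AB: "\<Xi> (w, x) = A w * x + B w" and A0: "A w \<noteq> 0" if "w \<noteq> 0" for w x
    using aff[OF that] by (auto simp: A_def B_def)
  have Bh: "B holomorphic_on (- {0})"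
    unfolding B_def by (rule holomorphic_slice_fst) (use \<Xi>(2) in auto)
  have "(\<lambda>w. \<Xi> (w, 1)) holomorphic_on (- {0})"
    by (rule holomorphic_slice_fst) (use \<Xi>(2) in auto)
  then have Ah: "A holomorphic_on (- {0})"
    using holomorphic_on_diff[OF _ Bh] unfolding A_def B_def by blast
  \<comment> \<open>The second coordinates of F gamma = gamma F. The value at x = 0 is a functional
    equation for B, the coefficient of x one for A.\<close>
  have equi: "\<Xi> (\<alpha> * w, w ^ m * x) = (b * w) ^ m * \<Xi> (w, x)" if w: "w \<noteq> 0" for w x
  proof -
    have g: "gamma_pow 1 (W_point ChV (v, x)) = W_point ChV (\<alpha> * v, v ^ m * x)" for v x
      using \<alpha>_nz by (simp add: gamma_pow_def T_simps tri_def)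
    have "W_point ChV (b * (\<alpha> * w), \<Xi> (\<alpha> * w, w ^ m * x)) = F (gamma_pow 1 (W_point ChV (w, x)))"
      using w \<alpha>_nz by (simp add: g \<Xi>(1))
    also have "\<dots> = gamma_pow 1 (F (W_point ChV (w, x)))" using F\<gamma>[OF VW[OF w]] n1 by simp
    also have "\<dots> = W_point ChV (\<alpha> * (b * w), (b * w) ^ m * \<Xi> (w, x))" using w by (simp add: g \<Xi>(1))
    finally show ?thesis using V_eq w b \<alpha>_nz by (metis mult_eq_0_iff)
  qed
  have B0: "B w = 0" if "w \<noteq> 0" for w
  proof (rule multiplier_periodic_zero[OF \<alpha>_pos \<alpha>_less m _ Bh _ that])
    show "b ^ m \<noteq> 0" using b by simp
    show "B (\<alpha> * w) = b ^ m * w ^ m * B w" if "w \<noteq> 0" for w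
      using equi[OF that, of 0] by (simp add: B_def power_mult_distrib)
  qed
  have Aeq: "A (\<alpha> * w) = b ^ m * A w" if w: "w \<noteq> 0" for w
  proof -
    have aw: "\<alpha> * w \<noteq> 0" using w \<alpha>_nz by simp
    have "A (\<alpha> * w) * w ^ m = (b ^ m * A w) * w ^ m"
      using equi[OF w, of 1] unfolding AB[OF w] AB[OF aw] B0[OF w] B0[OF aw]
      by (simp add: power_mult_distrib ac_simps)
    then show ?thesis using w by simp
  qed
  obtain a l where a: "a \<noteq> 0" and l: "\<And>w. w \<noteq> 0 \<Longrightarrow> A w = a * w powi l"
    using multiplier_periodic_monomial[OF \<alpha>_pos \<alpha>_less Ah A0 Aeq] by blast
  have bl: "b ^ m = \<alpha> powi l"
    using Aeq[of 1] l[of 1] l[of \<alpha>] a \<alpha>_nz by simp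
  have FV: "F (W_point ChV (w, x)) = T b a l (W_point ChV (w, x))" if w: "w \<noteq> 0" for w x
    using \<Xi>(1)[OF w] AB[OF w] B0[OF w] l[OF w] a b by (simp add: T_simps)
  \<comment> \<open>F followed by the inverse of \<open>T b a l\<close> is the identity on V, and
    density carries this over to the curves.\<close>
  define H where "H P = T (inverse b) (inverse a * b powi l) (- l) (F P)" for P
  have "W_holomorphic H"
    unfolding H_def using b a by (intro W_holomorphic_compose[OF F] W_holomorphic_T) auto
  then have H: "H P = P" if "P \<in> W" for P
    by (rule W_identity_by_density) (use that in \<open>auto simp: H_def FV T_inverse b a VW\<close>)
  have "F P = T b a l P" if "P \<in> W" for P
    using H[OF that] T_inverse(1)[OF b a FW[OF that], of l] by (simp add: H_def)
  with b a bl that show thesis by blast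
qed

text \<open>With F and G lifting f and its inverse, both composites of F and G lift the identity,
  and F and F gamma lift the same map. So uniqueness of lifts supplies the powers of gamma in
  \<open>lift_of_automorphism\<close>.\<close>

lemma automorphism_classification:
  assumes f: "f \<in> carrier (Aut_S m \<alpha>)"
  obtains b a l where "b \<noteq> 0" "a \<noteq> 0" "b ^ m = \<alpha> powi l" "\<And>P. P \<in> W \<Longrightarrow> f (p P) = p (T b a l P)"
proof -
  define g where "g = inv_into S f"
  have hol: "holomorphic_map (S_top m \<alpha>) (S_atlas m \<alpha>) (S_top m \<alpha>) (S_atlas m \<alpha>) f"
    "holomorphic_map (S_top m \<alpha>) (S_atlas m \<alpha>) (S_top m \<alpha>) (S_atlas m \<alpha>) g"
    and bij: "bij_betw f S S"
    using f by (auto simp: Aut_S_def holomorphic_aut_group_def Bij_def g_def)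
  obtain F where F: "continuous_map W_top W_top F" "\<And>P. P \<in> W \<Longrightarrow> p (F P) = f (p P)"
    using lift_exists[of f] hol(1) unfolding holomorphic_map_def by blast
  obtain G where G: "continuous_map W_top W_top G" "\<And>P. P \<in> W \<Longrightarrow> p (G P) = g (p P)"
    using lift_exists[of g] hol(2) unfolding holomorphic_map_def by blast
  have FW: "F P \<in> W" and GW: "G P \<in> W" if "P \<in> W" for P
    using F(1) G(1) that by (auto simp: continuous_map_def)
  have pS: "p P \<in> S" if "P \<in> W" for P using that by (auto simp: topspace_S)
  have gf: "g (f s) = s" "f (g s) = s" if "s \<in> S" for s
    using bij that unfolding g_def by (simp_all add: bij_betw_inv_into_left bij_betw_inv_into_right)
  have id: "continuous_map W_top W_top (\<lambda>P. P)" by simp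
  have GF: "continuous_map W_top W_top (\<lambda>P. G (F P))" "continuous_map W_top W_top (\<lambda>P. F (G P))"
    using continuous_map_compose[OF F(1) G(1)] continuous_map_compose[OF G(1) F(1)] by (auto simp: o_def)
  obtain j where j: "\<And>P. P \<in> W \<Longrightarrow> G (F P) = gamma_pow j P"
    using lift_unique[OF id GF(1)] G(2)[OF FW] F(2) gf(1)[OF pS] by metis
  obtain j' where j': "\<And>P. P \<in> W \<Longrightarrow> F (G P) = gamma_pow j' P"
    using lift_unique[OF id GF(2)] F(2)[OF GW] G(2) gf(2)[OF pS] by metis
  have "continuous_map W_top W_top (gamma_pow 1)" by (intro W_holomorphic_continuous W_holomorphic_gamma_pow)
  from continuous_map_compose[OF this F(1)] have F1: "continuous_map W_top W_top (\<lambda>P. F (gamma_pow 1 P))" by (simp add: o_def)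
  obtain n where n: "\<And>P. P \<in> W \<Longrightarrow> F (gamma_pow 1 P) = gamma_pow n (F P)"
    using lift_unique[OF F(1) F1] F(2) p_gamma_pow gamma_pow_in_W by metis
  obtain b a l where "b \<noteq> 0" "a \<noteq> 0" "b ^ m = \<alpha> powi l" "\<And>P. P \<in> W \<Longrightarrow> F P = T b a l P"
    using lift_of_automorphism[OF lift_holomorphic[OF hol(1) F] lift_holomorphic[OF hol(2) G] j j' n] by blast
  then show thesis using that F(2) by metis
qed

end

section \<open>The automorphism group\<close>

lemma primitive_root_of_unity:
  fixes m :: nat
  assumes "m > 0"
  obtains \<omega> :: complex where "\<omega> ^ m = 1" "\<And>l. \<omega> powi l = 1 \<Longrightarrow> int m dvd l"
proof
  define \<omega> :: complex where "\<omega> = exp (2 * of_real pi * \<i> / of_nat m)"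
  have p: "\<omega> ^ j = exp (2 * of_real pi * \<i> * of_nat j / of_nat m)" for j
    by (simp add: \<omega>_def exp_of_nat_mult[symmetric] mult_ac)
  have d: "\<omega> ^ j = 1 \<longleftrightarrow> m dvd j" for j
    unfolding p using complex_root_unity_eq_1[of m j] assms by simp
  then show "\<omega> ^ m = 1" by simp
  fix l assume l: "\<omega> powi l = 1"
  show "int m dvd l"
  proof (cases l rule: int_cases2)
    case (nonneg n)
    then show ?thesis using l d by simp
  next
    case (nonpos n)
    then show ?thesis using l d by (simp add: power_int_minus)
  qed
qed

lemma power_eq_1_powi: "s ^ m = 1 \<Longrightarrow> s powi (int m * n) = (1 :: complex)"
  by (simp add: power_int_mult)

context inoue begin

text \<open>The relation b^m = \<alpha>^l says that \<open>T b a l\<close> commutes with gamma, so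
  that it descends to S.\<close>

definition admissible :: "complex \<Rightarrow> complex \<Rightarrow> int \<Rightarrow> bool" where
  "admissible b a l \<longleftrightarrow> b \<noteq> 0 \<and> a \<noteq> 0 \<and> b ^ m = \<alpha> powi l"

definition S_aut :: "complex \<Rightarrow> complex \<Rightarrow> int \<Rightarrow> S_pt \<Rightarrow> S_pt" where
  "S_aut b a l = (\<lambda>s\<in>S. p (T b a l (SOME P. P \<in> W \<and> p P = s)))"

lemma T_gamma_pow:
  assumes "admissible b a l" "P \<in> W"
  shows "T b a l (gamma_pow n P) = gamma_pow n (T b a l P)"
proof -
  have "b powi (int m * n) = \<alpha> powi (l * n)"
    using assms by (simp add: admissible_def power_int_mult)
  moreover have "(\<alpha> powi n) powi l = \<alpha> powi (l * n)" by (simp add: power_int_mult[symmetric] mult.commute)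
  ultimately show ?thesis
    using assms \<alpha>_nz unfolding gamma_pow_def by (simp add: admissible_def T_T add.commute mult_ac)
qed

lemma S_aut_p: "admissible b a l \<Longrightarrow> P \<in> W \<Longrightarrow> S_aut b a l (p P) = p (T b a l P)"
proof -
  assume a: "admissible b a l" and P: "P \<in> W"
  define Q where "Q = (SOME Q. Q \<in> W \<and> p Q = p P)"
  have Q: "Q \<in> W \<and> p Q = p P" unfolding Q_def by (rule someI[of _ P]) (use P in auto)
  then obtain n where "Q = gamma_pow n P" using p_eq_iff P by metis
  then have "p (T b a l Q) = p (T b a l P)"
    using T_gamma_pow[OF a P] p_gamma_pow[OF T_in_W] a P by (simp add: admissible_def)
  then show ?thesis using P by (simp add: S_aut_def Q_def[symmetric] topspace_S)
qed

lemma S_aut_in_S: "admissible b a l \<Longrightarrow> s \<in> S \<Longrightarrow> S_aut b a l s \<in> S"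
  by (auto simp: topspace_S S_aut_p T_in_W admissible_def)

lemma S_aut_S_aut:
  assumes "admissible b a l" "admissible b' a' l'" "s \<in> S"
  shows "S_aut b a l (S_aut b' a' l' s) = S_aut (b * b') (a * a' * b' powi l) (l + l') s"
proof -
  have "admissible (b * b') (a * a' * b' powi l) (l + l')"
    using assms \<alpha>_nz by (simp add: admissible_def power_mult_distrib powi_simps)
  then show ?thesis
    using assms by (auto simp: topspace_S S_aut_p T_in_W T_T admissible_def)
qed

lemma admissible_1: "admissible 1 1 0"
  by (simp add: admissible_def)

lemma S_aut_1: "s \<in> S \<Longrightarrow> S_aut 1 1 0 s = s"
  by (auto simp: topspace_S S_aut_p admissible_1 T_1)

lemma admissible_inverse: "admissible b a l \<Longrightarrow> admissible (inverse b) (inverse a * b powi l) (- l)"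
  using \<alpha>_nz by (simp add: admissible_def power_inverse powi_simps)

lemma S_aut_inverse:
  assumes a: "admissible b a l" and s: "s \<in> S"
  shows "S_aut b a l (S_aut (inverse b) (inverse a * b powi l) (- l) s) = s"
    "S_aut (inverse b) (inverse a * b powi l) (- l) (S_aut b a l s) = s"
  using s a admissible_inverse[OF a]
  by (auto simp: topspace_S S_aut_p T_in_W T_inverse admissible_def)

lemma S_aut_in_Aut:
  assumes a: "admissible b a l"
  shows "S_aut b a l \<in> carrier (Aut_S m \<alpha>)"
proof -
  let ?b = "inverse b" let ?a = "inverse a * b powi l"
  note a' = admissible_inverse[OF a]
  have bij: "bij_betw (S_aut b a l) S S"
    by (rule bij_betw_byWitness[of _ "S_aut ?b ?a (- l)"])
      (auto simp: S_aut_inverse[OF a] S_aut_in_S[OF a] S_aut_in_S[OF a'])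
  have "inv_into S (S_aut b a l) s = S_aut ?b ?a (- l) s" if "s \<in> S" for s
    using bij S_aut_inverse[OF a that] S_aut_in_S[OF a' that] by (metis bij_betw_inv_into_left)
  then have "p (T ?b ?a (- l) P) = inv_into S (S_aut b a l) (p P)" if "P \<in> W" for P
    using that by (simp add: S_aut_p[OF a'] topspace_S)
  moreover have "W_holomorphic (T ?b ?a (- l))" "W_holomorphic (T b a l)"
    using a a' by (auto simp: admissible_def intro!: W_holomorphic_T)
  ultimately have "holomorphic_map (S_top m \<alpha>) (S_atlas m \<alpha>) (S_top m \<alpha>) (S_atlas m \<alpha>) (S_aut b a l)"
    "holomorphic_map (S_top m \<alpha>) (S_atlas m \<alpha>) (S_top m \<alpha>) (S_atlas m \<alpha>) (inv_into S (S_aut b a l))"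
    using descend_holomorphic[of "T b a l"] descend_holomorphic[of "T ?b ?a (- l)"] by (auto simp: S_aut_p[OF a])
  then show ?thesis
    using bij by (simp add: Aut_S_def holomorphic_aut_group_def Bij_def) (simp add: S_aut_def)
qed

lemma Aut_S_extensional: "f \<in> carrier (Aut_S m \<alpha>) \<Longrightarrow> f \<in> extensional S"
  by (auto simp: Aut_S_def holomorphic_aut_group_def Bij_def)

lemma Aut_S_S_aut:
  assumes f: "f \<in> carrier (Aut_S m \<alpha>)"
  obtains b a l where "admissible b a l" "f = S_aut b a l"
proof -
  obtain b a l where bal: "b \<noteq> 0" "a \<noteq> 0" "b ^ m = \<alpha> powi l" "\<And>P. P \<in> W \<Longrightarrow> f (p P) = p (T b a l P)"
    using automorphism_classification[OF f] by blast
  then have a: "admissible b a l" by (simp add: admissible_def)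
  have "f = S_aut b a l"
    by (rule extensionalityI[OF Aut_S_extensional[OF f]])
      (use bal a S_aut_p in \<open>auto simp: topspace_S\<close>, simp add: S_aut_def topspace_S)
  with a that show thesis by blast
qed

lemma Aut_S_mult:
  assumes "f \<in> carrier (Aut_S m \<alpha>)" "g \<in> carrier (Aut_S m \<alpha>)"
  shows "f \<otimes>\<^bsub>Aut_S m \<alpha>\<^esub> g = (\<lambda>s\<in>S. f (g s))"
  using assms by (auto simp: Aut_S_def holomorphic_aut_group_def BijGroup_def compose_def)

lemma S_aut_mult:
  assumes "admissible b a l" "admissible b' a' l'"
  shows "S_aut b a l \<otimes>\<^bsub>Aut_S m \<alpha>\<^esub> S_aut b' a' l' = S_aut (b * b') (a * a' * b' powi l) (l + l')"
  using assms by (simp add: Aut_S_mult S_aut_in_Aut S_aut_S_aut fun_eq_iff restrict_def) (simp add: S_aut_def)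

lemma Aut_S_one: "\<one>\<^bsub>Aut_S m \<alpha>\<^esub> = S_aut 1 1 0"
proof (rule extensionalityI[of _ S])
  show "\<one>\<^bsub>Aut_S m \<alpha>\<^esub> \<in> extensional S"
    by (simp add: Aut_S_def holomorphic_aut_group_def BijGroup_def)
qed (simp_all add: Aut_S_def holomorphic_aut_group_def BijGroup_def S_aut_1, simp add: S_aut_def)

lemma gamma_pow_V: "gamma_pow n (W_point ChV (w, x)) = W_point ChV (\<alpha> powi n * w, \<alpha> powi (int m * tri n) * w powi (int m * n) * x)"
  using \<alpha>_nz by (simp add: gamma_pow_def T_simps)

lemma p_V_eq:
  assumes "b \<noteq> 0" "b' \<noteq> 0" "p (W_point ChV (b, a)) = p (W_point ChV (b', a'))"
  obtains n where "b' = \<alpha> powi n * b" "a' = \<alpha> powi (int m * tri n) * b powi (int m * n) * a"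
proof -
  obtain n where "W_point ChV (b', a') = gamma_pow n (W_point ChV (b, a))"
    using p_eq_iff[of "W_point ChV (b, a)" "W_point ChV (b', a')"] assms by (auto simp: W_point_in_W)
  then have "(b', a') = (\<alpha> powi n * b, \<alpha> powi (int m * tri n) * b powi (int m * n) * a)"
    unfolding gamma_pow_V using assms \<alpha>_nz inj_on_eq_iff[OF inj_on_W_point[of ChV]] by simp
  then show thesis by (intro that[of n]) auto
qed

text \<open>Composing with gamma^n changes the parameters but not the map on S.\<close>

lemma S_aut_shift:
  assumes "admissible b a l"
  shows "S_aut (\<alpha> powi n * b) (\<alpha> powi (int m * tri n) * b powi (int m * n) * a) (l + int m * n) = S_aut b a l"
    and "admissible (\<alpha> powi n * b) (\<alpha> powi (int m * tri n) * b powi (int m * n) * a) (l + int m * n)"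
proof -
  show a': "admissible (\<alpha> powi n * b) (\<alpha> powi (int m * tri n) * b powi (int m * n) * a) (l + int m * n)"
    using assms \<alpha>_nz by (simp add: admissible_def power_mult_distrib powi_simps)
      (metis mult.commute power_int_mult power_int_of_nat)
  show "S_aut (\<alpha> powi n * b) (\<alpha> powi (int m * tri n) * b powi (int m * n) * a) (l + int m * n) = S_aut b a l"
  proof (rule extensionalityI[of _ S])
    fix s assume "s \<in> S"
    then obtain P where P: "P \<in> W" "s = p P" by (auto simp: topspace_S)
    have "T (\<alpha> powi n * b) (\<alpha> powi (int m * tri n) * b powi (int m * n) * a) (l + int m * n) P = gamma_pow n (T b a l P)"
      using assms P \<alpha>_nz by (simp add: gamma_pow_def T_T admissible_def mult_ac add.commute)
    then show "S_aut (\<alpha> powi n * b) (\<alpha> powi (int m * tri n) * b powi (int m * n) * a) (l + int m * n) s = S_aut b a l s"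
      unfolding P(2) S_aut_p[OF a' P(1)] S_aut_p[OF assms P(1)] using p_gamma_pow[OF T_in_W] assms P(1) by (simp add: admissible_def)
  qed (simp_all add: S_aut_def)
qed

definition base :: S_pt where
  "base = p (W_point ChV (1, 1))"

lemma base_in_S: "base \<in> S"
  by (auto simp: base_def topspace_S W_point_in_W)

lemma S_aut_base: "admissible b a l \<Longrightarrow> S_aut b a l base = p (W_point ChV (b, a))"
  by (simp add: base_def S_aut_p W_point_in_W T_simps admissible_def)

lemma S_aut_eq:
  assumes "admissible b a l" "admissible b' a' l'" "S_aut b a l = S_aut b' a' l'"
  obtains n where "b' = \<alpha> powi n * b" "a' = \<alpha> powi (int m * tri n) * b powi (int m * n) * a" "l' = l + int m * n"
proof -
  have "p (W_point ChV (b, a)) = p (W_point ChV (b', a'))" using S_aut_base assms by metis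
  then obtain n where n: "b' = \<alpha> powi n * b" "a' = \<alpha> powi (int m * tri n) * b powi (int m * n) * a"
    using p_V_eq[of b b' a a'] assms by (auto simp: admissible_def)
  \<comment> \<open>The value at \<open>base\<close> has determined b' and a'. Now l' follows from
    b'^m = \<alpha>^l', because the powers of \<alpha> are distinct.\<close>
  have "\<alpha> powi l' = \<alpha> powi (l + int m * n)"
    using assms(2) S_aut_shift(2)[OF assms(1), of n] by (simp add: admissible_def n)
  then have "l' = l + int m * n" by (rule alpha_powi_inj)
  with n that show thesis by blast
qed

section \<open>Normal form and multiplication of the automorphisms\<close>

definition rho :: complex where
  "rho = (SOME r. r ^ m = \<alpha>)"

lemma rho: "rho ^ m = \<alpha>" "rho \<noteq> 0"
proof -
  obtain r where "\<alpha> = r ^ m" using exists_complex_root[of m \<alpha>] m by auto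
  then show 1: "rho ^ m = \<alpha>" unfolding rho_def by (metis (mono_tags, lifting) someI)
  then show "rho \<noteq> 0" using \<alpha>_nz m by (metis power_0_left nat_less_le)
qed

text \<open>The constant \<open>croot\<close> is chosen so that \<open>(w, x) \<mapsto> (\<rho>w, cwx)\<close> is an \<open>m\<close>-th root of \<open>\<gamma>\<close>.\<close>

definition croot :: complex where
  "croot = (SOME c. c ^ m = inverse (rho powi tri (int m)))"

lemma croot: "croot ^ m = inverse (rho powi tri (int m))" "croot \<noteq> 0"
proof -
  obtain c where "inverse (rho powi tri (int m)) = c ^ m"
    using exists_complex_root[of m "inverse (rho powi tri (int m))"] m by auto
  then show 1: "croot ^ m = inverse (rho powi tri (int m))" unfolding croot_def by (metis (mono_tags, lifting) someI)
  then show "croot \<noteq> 0" using rho m by (metis inverse_nonzero_iff_nonzero nat_less_le power_0_left power_int_eq_0_iff)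
qed

text \<open>The coefficient of w^j x in the j-th iterate of (w, x) -> (rho w, croot w x).\<close>

definition aut_coeff :: "int \<Rightarrow> complex" where
  "aut_coeff j = croot powi j * rho powi tri j"

lemma aut_coeff_nz: "aut_coeff j \<noteq> 0"
  using croot rho by (simp add: aut_coeff_def)

lemma aut_coeff_add: "aut_coeff (j + k) = aut_coeff j * aut_coeff k * rho powi (j * k)"
  using croot rho by (simp add: aut_coeff_def tri_add powi_simps)

lemma aut_coeff_0: "aut_coeff 0 = 1"
  by (simp add: aut_coeff_def tri_def)

text \<open>In tri (m n) = n tri m + m^2 tri n the first summand is cancelled by the choice of
  \<open>croot\<close>. What is left is the coefficient in gamma^n.\<close>

lemma aut_coeff_m: "aut_coeff (int m * n) = \<alpha> powi (int m * tri n)"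
proof -
  have "2 * tri (int m * n) = 2 * (n * tri (int m) + int m * (int m * tri n))"
  proof -
    have "2 * (n * tri (int m) + int m * (int m * tri n)) = n * (2 * tri (int m)) + int m * (int m * (2 * tri n))"
      by (simp add: algebra_simps)
    also have "\<dots> = int m * n * (int m * n - 1)" unfolding two_tri by (simp add: algebra_simps)
    finally show ?thesis by (simp add: two_tri)
  qed
  then have t: "tri (int m * n) = n * tri (int m) + int m * (int m * tri n)" by simp
  have "croot powi (int m * n) = inverse (rho powi (n * tri (int m)))"
    by (simp add: power_int_mult croot power_int_inverse mult.commute[of n])
  moreover have "rho powi (int m * (int m * tri n)) = \<alpha> powi (int m * tri n)"
    using power_int_mult[of rho "int m" "int m * tri n"] by (simp add: rho)
  ultimately show ?thesis using rho by (simp add: aut_coeff_def t powi_simps)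
qed

text \<open>\<open>E j 1 1\<close> is the \<open>j\<close>-th power of the root \<open>(w, x) \<mapsto> (\<rho>w, cwx)\<close> of \<open>\<gamma>\<close>, and
  \<open>E j t s\<close> is its composition with \<open>(w, x) \<mapsto> (sw, tx)\<close>.\<close>

definition E :: "int \<Rightarrow> complex \<Rightarrow> complex \<Rightarrow> S_pt \<Rightarrow> S_pt" where
  "E j t s = S_aut (s * rho powi j) (t * aut_coeff j) j"

lemma E_admissible: "t \<noteq> 0 \<Longrightarrow> s ^ m = 1 \<Longrightarrow> admissible (s * rho powi j) (t * aut_coeff j) j"
proof -
  assume t: "t \<noteq> 0" and s: "s ^ m = 1"
  have "s \<noteq> 0" using s m by (metis power_0_left nat_less_le zero_neq_one)
  moreover have "(rho powi j) ^ m = \<alpha> powi j"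
    by (metis rho(1) mult.commute power_int_mult power_int_of_nat)
  ultimately show ?thesis using t s rho aut_coeff_nz by (simp add: admissible_def power_mult_distrib)
qed

lemma E_in_Aut: "t \<noteq> 0 \<Longrightarrow> s ^ m = 1 \<Longrightarrow> E j t s \<in> carrier (Aut_S m \<alpha>)"
  unfolding E_def by (intro S_aut_in_Aut E_admissible)

lemma mu_nz: "s ^ m = 1 \<Longrightarrow> s \<noteq> (0 :: complex)"
  using m by (metis power_0_left nat_less_le zero_neq_one)

lemma mu_powi: "s ^ m = 1 \<Longrightarrow> (s powi j) ^ m = (1 :: complex)"
  by (metis mult.commute power_int_1_left power_int_mult power_int_of_nat)

text \<open>A law of Heisenberg type: the twist by the j-th power of s' comes from evaluating w^j at
  s' w.\<close>

lemma E_mult: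
  assumes "t \<noteq> 0" "s ^ m = 1" "t' \<noteq> 0" "s' ^ m = 1"
  shows "E j t s \<otimes>\<^bsub>Aut_S m \<alpha>\<^esub> E j' t' s' = E (j + j') (t * t' * s' powi j) (s * s')"
proof -
  have "E j t s \<otimes>\<^bsub>Aut_S m \<alpha>\<^esub> E j' t' s' =
    S_aut (s * rho powi j * (s' * rho powi j')) (t * aut_coeff j * (t' * aut_coeff j') * (s' * rho powi j') powi j) (j + j')"
    unfolding E_def by (rule S_aut_mult) (use assms E_admissible in auto)
  also have "s * rho powi j * (s' * rho powi j') = s * s' * rho powi (j + j')"
    using rho by (simp add: powi_simps)
  also have "t * aut_coeff j * (t' * aut_coeff j') * (s' * rho powi j') powi j = t * t' * s' powi j * aut_coeff (j + j')"
    by (simp add: aut_coeff_add power_int_mult_distrib power_int_mult mult.commute[of j])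
  finally show ?thesis by (simp add: E_def)
qed

lemma E_one: "\<one>\<^bsub>Aut_S m \<alpha>\<^esub> = E 0 1 1"
  by (simp add: E_def Aut_S_one aut_coeff_0)

lemma E_shift:
  assumes "t \<noteq> 0" "s ^ m = 1"
  shows "E (j + int m * n) t s = E j t s"
proof -
  have e1: "s * rho powi (j + int m * n) = \<alpha> powi n * (s * rho powi j)"
    using rho by (simp add: powi_simps power_int_mult)
  have e2: "t * aut_coeff (j + int m * n) = \<alpha> powi (int m * tri n) * (s * rho powi j) powi (int m * n) * (t * aut_coeff j)"
  proof -
    have "s powi (int m * n) = 1" by (rule power_eq_1_powi[OF assms(2)])
    moreover have "(rho powi j) powi (int m * n) = rho powi (j * (int m * n))" by (simp add: power_int_mult)
    ultimately show ?thesis by (simp add: aut_coeff_add aut_coeff_m power_int_mult_distrib)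
  qed
  show ?thesis
    unfolding E_def e1 e2 by (rule S_aut_shift(1)[OF E_admissible[OF assms, of j], of n])
qed

lemma E_cong:
  assumes "t \<noteq> 0" "s ^ m = 1" "int m dvd j' - j"
  shows "E j' t s = E j t s"
proof -
  obtain n where "j' - j = int m * n" using assms by (auto elim: dvdE)
  then have "j' = j + int m * n" by simp
  then show ?thesis using E_shift[OF assms(1,2)] by simp
qed

lemma E_inj:
  assumes "t \<noteq> 0" "s ^ m = 1" "t' \<noteq> 0" "s' ^ m = 1" "E j t s = E j' t' s'"
  shows "int m dvd j' - j" "s = s'" "t = t'"
proof -
  obtain n where n: "s' * rho powi j' = \<alpha> powi n * (s * rho powi j)" "j' = j + int m * n"
    using S_aut_eq[OF E_admissible[OF assms(1,2)] E_admissible[OF assms(3,4)]] assms(5) unfolding E_def by metis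
  show "int m dvd j' - j" by (simp add: n)
  have "rho powi j' = \<alpha> powi n * rho powi j"
    using rho by (simp add: n powi_simps power_int_mult)
  then show s: "s = s'" using n(1) rho \<alpha>_nz by simp
  \<comment> \<open>Now that s = s' and j' may be replaced by j, a second comparison of parameters
    has shift 0 and yields t = t'.\<close>
  have "E j t s = E j t' s"
    using assms(5) E_cong[OF assms(3,4) \<open>int m dvd j' - j\<close>] s by simp
  then obtain k where k: "s * rho powi j = \<alpha> powi k * (s * rho powi j)"
    "t' * aut_coeff j = \<alpha> powi (int m * tri k) * (s * rho powi j) powi (int m * k) * (t * aut_coeff j)"
    using S_aut_eq[OF E_admissible[OF assms(1,2)] E_admissible[OF assms(3,2)]] unfolding E_def by metis
  have "\<alpha> powi k = \<alpha> powi 0" using k(1) mu_nz[OF assms(2)] rho by simp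
  then have "k = 0" by (rule alpha_powi_inj)
  then show "t = t'" using k(2) aut_coeff_nz by (simp add: tri_def)
qed

lemma S_aut_E:
  assumes "admissible b a l"
  obtains t s where "t \<noteq> 0" "s ^ m = 1" "S_aut b a l = E l t s" "s * rho powi l = b" "t * aut_coeff l = a"
proof -
  have "(b / rho powi l) ^ m = 1"
    using assms rho \<alpha>_nz by (simp add: admissible_def power_divide)
      (metis mult.commute power_int_mult power_int_of_nat)
  moreover have "a / aut_coeff l \<noteq> 0" using assms aut_coeff_nz by (simp add: admissible_def)
  ultimately show thesis
    using that[of "a / aut_coeff l" "b / rho powi l"] aut_coeff_nz rho by (simp add: E_def)
qed

lemma Aut_S_E:
  assumes "f \<in> carrier (Aut_S m \<alpha>)"
  obtains j t s where "t \<noteq> 0" "s ^ m = 1" "f = E j t s"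
  using assms Aut_S_S_aut S_aut_E by metis

text \<open>A point with y_k = 0 and x_k nonzero is not a node of the chain, so it lies on a single
  curve.\<close>

lemma W_point_in_W_curve:
  assumes "u \<noteq> 0" "W_point (ChU k) (u, 0) \<in> W_curve i"
  shows "k = i"
proof -
  from assms(2) consider y where "W_point (ChU k) (u, 0) = W_point (ChU (i - 1)) (0, y)"
    | x where "W_point (ChU k) (u, 0) = W_point (ChU i) (x, 0)"
    by (auto simp: W_curve_def)
  then show ?thesis
  proof cases
    case 1
    then show ?thesis using assms(1) by (auto simp: W_point_eq_iff_normal split: if_splits)
  qed (simp add: W_point_eq_iff_normal)
qed

lemma T_W_curve_subset:
  assumes "b \<noteq> 0" "a \<noteq> 0"
  shows "T b a l ` W_curve i \<subseteq> W_curve (i + l)"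
proof
  fix Q assume "Q \<in> T b a l ` W_curve i"
  then consider y where "Q = T b a l (W_point (ChU (i - 1)) (0, y))" | x where "Q = T b a l (W_point (ChU i) (x, 0))"
    by (auto simp: W_curve_def)
  then show "Q \<in> W_curve (i + l)"
  proof cases
    case 1
    have e: "i - 1 + l = i + l - 1" by simp
    show ?thesis unfolding 1 T_simps[OF assms] W_curve_def e by auto
  next
    case 2
    then show ?thesis unfolding 2 T_simps[OF assms] W_curve_def by auto
  qed
qed

lemma W_curve_subset: "W_curve i \<subseteq> W"
  by (auto simp: W_curve_def W_point_in_W)

lemma T_W_curve:
  assumes "b \<noteq> 0" "a \<noteq> 0"
  shows "T b a l ` W_curve i = W_curve (i + l)"
proof (intro subset_antisym T_W_curve_subset[OF assms] subsetI)
  fix Q assume Q: "Q \<in> W_curve (i + l)"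
  let ?Q = "T (inverse b) (inverse a * b powi l) (- l) Q"
  have "?Q \<in> W_curve (i + l + (- l))"
    using T_W_curve_subset[of "inverse b" "inverse a * b powi l" "- l" "i + l"] assms Q by auto
  moreover have "Q = T b a l ?Q" using T_inverse(1)[OF assms] Q W_curve_subset by fastforce
  ultimately show "Q \<in> T b a l ` W_curve i" by simp
qed

lemma S_aut_S_curve: "admissible b a l \<Longrightarrow> S_aut b a l ` S_curve m \<alpha> i = S_curve m \<alpha> (i + l)"
proof -
  assume a: "admissible b a l"
  have "S_aut b a l ` p ` W_curve i = p ` T b a l ` W_curve i"
    unfolding image_image using S_aut_p[OF a] W_curve_subset by (intro image_cong) blast+
  then show ?thesis using T_W_curve a by (simp add: S_curve_def admissible_def)
qed

text \<open>The point (1, 0) of U_i is not a node, and gamma^n moves it to a point that lies only on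
  the curve with index i + m n.\<close>

lemma S_curve_eq_imp_dvd:
  assumes "S_curve m \<alpha> i = S_curve m \<alpha> i'"
  shows "int m dvd i' - i"
proof -
  let ?P = "W_point (ChU i) (1, 0)"
  have P: "?P \<in> W_curve i" "?P \<in> W" by (auto simp: W_curve_def W_point_in_W)
  then have "p ?P \<in> p ` W_curve i'" using assms by (auto simp: S_curve_def)
  then obtain Q where Q: "Q \<in> W_curve i'" "p ?P = p Q" by auto
  have "Q \<in> W" using Q(1) W_curve_subset by blast
  then obtain n where n: "Q = gamma_pow n ?P" using p_eq_iff[OF P(2)] Q(2) by blast
  define v where "v = \<alpha> powi (int m * tri n) * (\<alpha> powi n) powi (- (i + int m * n))"
  have v: "v \<noteq> 0" using \<alpha>_nz by (simp add: v_def)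
  have "Q = W_point (ChU (i + int m * n)) (v, 0)"
    unfolding n gamma_pow_def using \<alpha>_nz by (subst T_simps) (simp_all add: v_def)
  then have "i + int m * n = i'" using W_point_in_W_curve[OF v] Q(1) by metis
  then show ?thesis by auto
qed

text \<open>An automorphism with parameter j rotates the cycle of curves by j, so invariance of C_1
  makes m divide j.\<close>

lemma Aut1_iff: "f \<in> Aut1 m \<alpha> \<longleftrightarrow> (\<exists>t s. t \<noteq> 0 \<and> s ^ m = 1 \<and> f = E 0 t s)"
proof
  assume f: "f \<in> Aut1 m \<alpha>"
  then have "f \<in> carrier (Aut_S m \<alpha>)" by (simp add: Aut1_def)
  then obtain j t s where e: "t \<noteq> 0" "s ^ m = 1" "f = E j t s" by (rule Aut_S_E)
  have "f ` S_curve m \<alpha> 1 = S_curve m \<alpha> 1" using f m by (auto simp: Aut1_def)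
  then have "S_curve m \<alpha> (1 + j) = S_curve m \<alpha> 1"
    using S_aut_S_curve[OF E_admissible[OF e(1,2), of j], of 1] by (simp add: e(3) E_def)
  then have "int m dvd 1 - (1 + j)" by (rule S_curve_eq_imp_dvd)
  then have "int m dvd j - 0" by simp
  from E_cong[OF e(1,2) this] show "\<exists>t s. t \<noteq> 0 \<and> s ^ m = 1 \<and> f = E 0 t s"
    using e by (intro exI[of _ t] exI[of _ s]) simp
next
  assume "\<exists>t s. t \<noteq> 0 \<and> s ^ m = 1 \<and> f = E 0 t s"
  then obtain t s where e: "t \<noteq> 0" "s ^ m = 1" "f = E 0 t s" by blast
  then show "f \<in> Aut1 m \<alpha>"
    using S_aut_S_curve[OF E_admissible[OF e(1,2), of 0]] E_in_Aut[OF e(1,2), of 0] unfolding Aut1_def e(3) E_def by simp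
qed

lemma E_0_in_Aut1: "t \<noteq> 0 \<Longrightarrow> s ^ m = 1 \<Longrightarrow> E 0 t s \<in> Aut1 m \<alpha>"
  using Aut1_iff by blast

lemma Aut1_E:
  assumes "f \<in> Aut1 m \<alpha>"
  obtains t s where "t \<noteq> 0" "s ^ m = 1" "f = E 0 t s"
  using assms Aut1_iff by blast

lemma mem_group_center:
  "z \<in> group_center H \<longleftrightarrow> z \<in> carrier H \<and> (\<forall>g\<in>carrier H. z \<otimes>\<^bsub>H\<^esub> g = g \<otimes>\<^bsub>H\<^esub> z)"
  unfolding group_center_def by (rule mem_Collect_eq)

lemma center_iff: "f \<in> group_center (Aut_S m \<alpha>) \<longleftrightarrow> (\<exists>t. t \<noteq> 0 \<and> f = E 0 t 1)"
proof
  assume f: "f \<in> group_center (Aut_S m \<alpha>)"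
  then have "f \<in> carrier (Aut_S m \<alpha>)" unfolding mem_group_center by (rule conjunct1)
  then obtain j t s where e: "t \<noteq> 0" "s ^ m = 1" "f = E j t s" by (rule Aut_S_E)
  have comm: "E (j + j') (t * t' * s' powi j) (s * s') = E (j' + j) (t' * t * s powi j') (s' * s)"
    if that: "t' \<noteq> 0" "s' ^ m = 1" for j' t' s'
  proof -
    have "f \<otimes>\<^bsub>Aut_S m \<alpha>\<^esub> E j' t' s' = E j' t' s' \<otimes>\<^bsub>Aut_S m \<alpha>\<^esub> f"
      using f[unfolded mem_group_center, THEN conjunct2] E_in_Aut[OF that, of j'] by (rule bspec)
    then show ?thesis unfolding e(3) E_mult[OF e(1,2) that] E_mult[OF that e(1,2)] .
  qed
  have nz: "t * t' * s' powi j \<noteq> 0" "t' * t * s powi j' \<noteq> 0" "(s * s') ^ m = 1" "(s' * s) ^ m = 1"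
    if "t' \<noteq> 0" "s' ^ m = 1" for t' s' j'
    using that e mu_nz by (auto simp: power_mult_distrib)
  \<comment> \<open>Commuting with the root \<open>E 1 1 1\<close> gives t = t s.\<close>
  have "s = 1"
    using E_inj(3)[OF nz(1)[of 1 1] nz(3)[of 1 1] nz(2)[of 1 1 1] nz(4)[of 1 1] comm[of 1 1 1]] e(1) by simp
  obtain \<omega> :: complex where \<omega>: "\<omega> ^ m = 1" "\<And>l. \<omega> powi l = 1 \<Longrightarrow> int m dvd l"
    using primitive_root_of_unity[OF m] by blast
  \<comment> \<open>Commuting with the rotation by a primitive root of unity \<omega> gives t
    \<omega>^j = t.\<close>
  have "\<omega> powi j = 1"
    using E_inj(3)[OF nz(1)[of 1 \<omega>] nz(3)[of 1 \<omega>] nz(2)[of 1 \<omega> 0] nz(4)[of 1 \<omega>] comm[of 1 \<omega> 0]] e(1) \<omega>(1) by simp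
  then have "int m dvd j - 0" using \<omega>(2) by simp
  from E_cong[OF e(1,2) this] show "\<exists>t. t \<noteq> 0 \<and> f = E 0 t 1"
    using e \<open>s = 1\<close> by (intro exI[of _ t]) simp
next
  assume "\<exists>t. t \<noteq> 0 \<and> f = E 0 t 1"
  then obtain t where t: "t \<noteq> 0" "f = E 0 t 1" by blast
  have "f \<otimes>\<^bsub>Aut_S m \<alpha>\<^esub> g = g \<otimes>\<^bsub>Aut_S m \<alpha>\<^esub> f" if g: "g \<in> carrier (Aut_S m \<alpha>)" for g
  proof -
    obtain j t' s where e: "t' \<noteq> 0" "s ^ m = 1" "g = E j t' s" using Aut_S_E[OF g] by blast
    show ?thesis unfolding t(2) e(3) using t(1) e(1,2) by (simp add: E_mult mult.commute)
  qed
  moreover have "f \<in> carrier (Aut_S m \<alpha>)" using E_in_Aut[OF t(1)] t(2) by simp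
  ultimately show "f \<in> group_center (Aut_S m \<alpha>)" unfolding mem_group_center by (intro conjI ballI)
qed

abbreviation G where "G \<equiv> Aut_S m \<alpha>"
abbreviation N1 where "N1 \<equiv> (Aut_S m \<alpha>)\<lparr>carrier := Aut1 m \<alpha>\<rparr>"

lemma comm_group_N1: "comm_group N1"
proof (rule comm_groupI)
  fix x y assume "x \<in> carrier N1" "y \<in> carrier N1"
  then have xy: "x \<in> Aut1 m \<alpha>" "y \<in> Aut1 m \<alpha>" by simp_all
  obtain t s where x: "t \<noteq> 0" "s ^ m = 1" "x = E 0 t s" using xy(1) by (rule Aut1_E)
  obtain t' s' where y: "t' \<noteq> 0" "s' ^ m = 1" "y = E 0 t' s'" using xy(2) by (rule Aut1_E)
  have m1: "x \<otimes>\<^bsub>N1\<^esub> y = E 0 (t * t') (s * s')"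
    using E_mult[OF x(1,2) y(1,2), of 0 0] by (simp add: x(3) y(3))
  have m2: "y \<otimes>\<^bsub>N1\<^esub> x = E 0 (t' * t) (s' * s)"
    using E_mult[OF y(1,2) x(1,2), of 0 0] by (simp add: x(3) y(3))
  have tt: "t * t' \<noteq> 0" "(s * s') ^ m = 1" using x y by (auto simp: power_mult_distrib)
  then show "x \<otimes>\<^bsub>N1\<^esub> y \<in> carrier N1" unfolding m1 by (simp add: E_0_in_Aut1)
  show "x \<otimes>\<^bsub>N1\<^esub> y = y \<otimes>\<^bsub>N1\<^esub> x" unfolding m1 m2 by (simp add: mult.commute)
  fix z assume "z \<in> carrier N1"
  then have "z \<in> Aut1 m \<alpha>" by simp
  then obtain t'' s'' where z: "t'' \<noteq> 0" "s'' ^ m = 1" "z = E 0 t'' s''" by (rule Aut1_E)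
  have "t' * t'' \<noteq> 0" "(s' * s'') ^ m = 1" using y z by (auto simp: power_mult_distrib)
  then have r: "x \<otimes>\<^bsub>G\<^esub> (y \<otimes>\<^bsub>G\<^esub> z) = E 0 (t * (t' * t'')) (s * (s' * s''))"
    using E_mult[OF y(1,2) z(1,2), of 0 0] E_mult[OF x(1,2), of "t' * t''" "s' * s''" 0 0]
    by (simp add: x(3) y(3) z(3))
  have "(x \<otimes>\<^bsub>G\<^esub> y) \<otimes>\<^bsub>G\<^esub> z = E 0 (t * t' * t'') (s * s' * s'')"
    using m1 E_mult[OF tt z(1,2), of 0 0] by (simp add: z(3))
  with r show "x \<otimes>\<^bsub>N1\<^esub> y \<otimes>\<^bsub>N1\<^esub> z = x \<otimes>\<^bsub>N1\<^esub> (y \<otimes>\<^bsub>N1\<^esub> z)"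
    by (simp add: mult.assoc)
next
  show "\<one>\<^bsub>N1\<^esub> \<in> carrier N1"
    by (simp add: E_one E_0_in_Aut1)
  fix x assume "x \<in> carrier N1"
  then have "x \<in> Aut1 m \<alpha>" by simp
  then obtain t s where x: "t \<noteq> 0" "s ^ m = 1" "x = E 0 t s" by (rule Aut1_E)
  show "\<one>\<^bsub>N1\<^esub> \<otimes>\<^bsub>N1\<^esub> x = x"
    using E_mult[of 1 1 t s 0 0] x by (simp add: E_one)
  have i: "inverse t \<noteq> 0" "(inverse s) ^ m = 1" using x by (auto simp: power_inverse)
  have "E 0 (inverse t) (inverse s) \<otimes>\<^bsub>N1\<^esub> x = \<one>\<^bsub>N1\<^esub>"
    using E_mult[OF i x(1,2), of 0 0] x mu_nz[OF x(2)] by (simp add: E_one)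
  then show "\<exists>y\<in>carrier N1. y \<otimes>\<^bsub>N1\<^esub> x = \<one>\<^bsub>N1\<^esub>"
    by (intro bexI[of _ "E 0 (inverse t) (inverse s)"]) (simp_all add: E_0_in_Aut1[OF i])
qed

end

section \<open>The compact-open topology\<close>

lemma homeomorphic_map_onto_subtopology:
  assumes "continuous_map X A f" "\<And>N. openin X N \<Longrightarrow> openin A (f ` N)" "inj_on f (topspace X)"
    and "f ` topspace X = Y"
  shows "homeomorphic_map X (subtopology A Y) f"
proof (rule bijective_open_imp_homeomorphic_map)
  have sub: "Y \<subseteq> topspace A" using assms(1,4) by (auto simp: continuous_map_def)
  show "continuous_map X (subtopology A Y) f"
    using assms by (auto intro: continuous_map_into_subtopology)
  show "f ` topspace X = topspace (subtopology A Y)" using sub assms(4) by (simp add: Int_absorb1)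
  show "open_map X (subtopology A Y) f"
    unfolding open_map_def
  proof (intro allI impI)
    fix N assume N: "openin X N"
    then have "f ` N \<subseteq> Y" using assms(4) openin_subset by blast
    then show "openin (subtopology A Y) (f ` N)"
      using assms(2)[OF N] by (auto simp: openin_subtopology intro!: exI[of _ "f ` N"])
  qed
qed fact

lemma openin_prod_discrete:
  "openin (prod_topology X (discrete_topology M)) N \<longleftrightarrow>
     N \<subseteq> topspace X \<times> M \<and> (\<forall>s\<in>M. openin X {t. (t, s) \<in> N})"
proof (intro iffI conjI ballI)
  assume N: "openin (prod_topology X (discrete_topology M)) N"
  then show sub: "N \<subseteq> topspace X \<times> M" using openin_subset by fastforce
  fix s assume s: "s \<in> M"
  have "continuous_map X (prod_topology X (discrete_topology M)) (\<lambda>t. (t, s))"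
    using s by (simp add: continuous_map_pairwise o_def)
  then have "openin X {t \<in> topspace X. (t, s) \<in> N}" using N by (auto simp: continuous_map_def)
  moreover have "{t \<in> topspace X. (t, s) \<in> N} = {t. (t, s) \<in> N}" using sub by auto
  ultimately show "openin X {t. (t, s) \<in> N}" by simp
next
  assume N: "N \<subseteq> topspace X \<times> M \<and> (\<forall>s\<in>M. openin X {t. (t, s) \<in> N})"
  have "N = (\<Union>s\<in>M. {t. (t, s) \<in> N} \<times> {s})" using N by auto
  moreover have "openin (prod_topology X (discrete_topology M)) (\<Union>s\<in>M. {t. (t, s) \<in> N} \<times> {s})"
    using N by (intro openin_Union) (auto simp: openin_prod_Times_iff)
  ultimately show "openin (prod_topology X (discrete_topology M)) N" by simp
qed

lemma openin_prod_discrete_left: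
  "openin (prod_topology (discrete_topology M) X) N \<longleftrightarrow>
     N \<subseteq> M \<times> topspace X \<and> (\<forall>s\<in>M. openin X {t. (s, t) \<in> N})"
proof (intro iffI conjI ballI)
  assume N: "openin (prod_topology (discrete_topology M) X) N"
  then show sub: "N \<subseteq> M \<times> topspace X" using openin_subset by fastforce
  fix s assume s: "s \<in> M"
  have "continuous_map X (prod_topology (discrete_topology M) X) (\<lambda>t. (s, t))"
    using s by (simp add: continuous_map_pairwise o_def)
  then have "openin X {t \<in> topspace X. (s, t) \<in> N}" using N by (auto simp: continuous_map_def)
  moreover have "{t \<in> topspace X. (s, t) \<in> N} = {t. (s, t) \<in> N}" using sub by auto
  ultimately show "openin X {t. (s, t) \<in> N}" by simp
next
  assume N: "N \<subseteq> M \<times> topspace X \<and> (\<forall>s\<in>M. openin X {t. (s, t) \<in> N})"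
  have "N = (\<Union>s\<in>M. {s} \<times> {t. (s, t) \<in> N})" using N by auto
  moreover have "openin (prod_topology (discrete_topology M) X) (\<Union>s\<in>M. {s} \<times> {t. (s, t) \<in> N})"
    using N by (intro openin_Union) (auto simp: openin_prod_Times_iff)
  ultimately show "openin (prod_topology (discrete_topology M) X) N" by simp
qed

lemma finite_top_of_set_discrete:
  fixes M :: "'a::t1_space set"
  assumes "finite M"
  shows "top_of_set M = discrete_topology M"
proof -
  have "openin (top_of_set M) {x}" if "x \<in> M" for x
  proof -
    have "open (- (M - {x}))" using assms by (intro open_Compl finite_imp_closed finite_Diff)
    moreover have "{x} = M \<inter> - (M - {x})" using that by auto
    ultimately show ?thesis by (metis openin_open)
  qed
  then show ?thesis using discrete_topology_unique[of M "top_of_set M"] by simp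
qed

lemma open_Cstar: "open (UNIV - {0 :: complex})"
  by (intro open_Diff) auto

context inoue begin

abbreviation A where "A \<equiv> Aut_S_top m \<alpha>"

lemma topspace_A: "topspace A = carrier G"
  by (simp add: Aut_S_top_def)

text \<open>Joint continuity of (t, P) -> p (T b t l P), in the coordinates of one chart.\<close>

lemma open_orbit_map_preimage:
  assumes b: "b \<noteq> 0" and V: "openin (S_top m \<alpha>) V"
  shows "open {tz. fst tz \<noteq> 0 \<and> snd tz \<in> chart_dom i \<and> p (T b (fst tz) l (W_point i (snd tz))) \<in> V}"
proof -
  define M where "M j = {\<eta> \<in> chart_dom j. W_point j \<eta> \<in> {P \<in> W. p P \<in> V}}" for j
  have M: "open (M j)" for j
    using V unfolding M_def openin_S openin_W_top by blast
  have M': "\<eta> \<in> M j \<longleftrightarrow> \<eta> \<in> chart_dom j \<and> p (W_point j \<eta>) \<in> V" for j \<eta>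
    using W_point_in_W[of \<eta> j] unfolding M_def by blast
  show ?thesis
  proof (cases i)
    case (ChU k)
    define \<theta> where "\<theta> = (\<lambda>tz :: complex \<times> C2. (fst tz * b powi (- (k + l)) * fst (snd tz), inverse (fst tz) * b powi (k + l + 1) * snd (snd tz)))"
    have "open {tz :: complex \<times> C2. fst tz \<noteq> 0}"
    proof -
      have "{tz :: complex \<times> C2. fst tz \<noteq> 0} = fst -` (- {0})" by auto
      then show ?thesis by (simp add: open_vimage_fst open_Compl)
    qed
    moreover have "continuous_on {tz. fst tz \<noteq> 0} \<theta>"
      unfolding \<theta>_def by (intro continuous_intros) auto
    ultimately have "open ({tz. fst tz \<noteq> 0} \<inter> \<theta> -` M (ChU (k + l)))"
      using M continuous_open_preimage by blast
    moreover have eqT: "T b (fst tz) l (W_point i (snd tz)) = W_point (ChU (k + l)) (\<theta> tz)" if "fst tz \<noteq> 0" for tz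
      using T_simps(1)[OF b that, of l k "fst (snd tz)" "snd (snd tz)"] by (simp add: ChU \<theta>_def)
    have "{tz. fst tz \<noteq> 0 \<and> snd tz \<in> chart_dom i \<and> p (T b (fst tz) l (W_point i (snd tz))) \<in> V} =
        {tz. fst tz \<noteq> 0} \<inter> \<theta> -` M (ChU (k + l))"
    proof (rule Set.set_eqI)
      fix tz
      show "tz \<in> {tz. fst tz \<noteq> 0 \<and> snd tz \<in> chart_dom i \<and> p (T b (fst tz) l (W_point i (snd tz))) \<in> V} \<longleftrightarrow>
          tz \<in> {tz. fst tz \<noteq> 0} \<inter> \<theta> -` M (ChU (k + l))"
        by (cases "fst tz = 0") (simp_all add: M' ChU eqT[unfolded ChU])
    qed
    ultimately show ?thesis by simp
  next
    case ChV
    define D where "D = {tz :: complex \<times> C2. fst tz \<noteq> 0 \<and> fst (snd tz) \<noteq> 0}"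
    define \<theta> where "\<theta> = (\<lambda>tz :: complex \<times> C2. (b * fst (snd tz), fst tz * fst (snd tz) powi l * snd (snd tz)))"
    have "D = (- {0}) \<times> {z. fst z \<noteq> 0}" by (auto simp: D_def)
    then have "open D" by (simp only:) (intro open_Times open_Compl open_fst_neq closed_singleton)
    moreover have "continuous_on D \<theta>"
      unfolding \<theta>_def D_def by (intro continuous_intros) auto
    ultimately have "open (D \<inter> \<theta> -` M ChV)"
      using M continuous_open_preimage by blast
    moreover have eqT: "T b (fst tz) l (W_point i (snd tz)) = W_point ChV (\<theta> tz)" if "fst tz \<noteq> 0" for tz
      using T_simps(2)[OF b that, of l "fst (snd tz)" "snd (snd tz)"] by (simp add: ChV \<theta>_def)
    have "{tz. fst tz \<noteq> 0 \<and> snd tz \<in> chart_dom i \<and> p (T b (fst tz) l (W_point i (snd tz))) \<in> V} =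
        D \<inter> \<theta> -` M ChV"
    proof (rule Set.set_eqI)
      fix tz
      show "tz \<in> {tz. fst tz \<noteq> 0 \<and> snd tz \<in> chart_dom i \<and> p (T b (fst tz) l (W_point i (snd tz))) \<in> V} \<longleftrightarrow>
          tz \<in> D \<inter> \<theta> -` M ChV"
        using b by (cases "fst tz = 0") (auto simp: M' ChV eqT[unfolded ChV] D_def, simp_all add: \<theta>_def)
    qed
    ultimately show ?thesis by simp
  qed
qed

lemma admissible_any: "admissible b 1 l \<Longrightarrow> t \<noteq> 0 \<Longrightarrow> admissible b t l"
  by (simp add: admissible_def)

text \<open>Joint continuity in the parameter and the point, together with the tube lemma for
  compact K, gives continuity into the compact-open topology.\<close>

lemma continuous_S_aut:
  assumes b: "admissible b 1 l"
  shows "continuous_map (top_of_set (UNIV - {0})) A (\<lambda>t. S_aut b t l)"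
proof -
  let ?C = "UNIV - {0 :: complex}"
  note ad = admissible_any[OF b]
  have b0: "b \<noteq> 0" using b by (simp add: admissible_def)
  have joint: "openin (prod_topology (top_of_set ?C) (S_top m \<alpha>)) {(t, q). t \<noteq> 0 \<and> q \<in> S \<and> S_aut b t l q \<in> V}"
    if V: "openin (S_top m \<alpha>) V" for V
    unfolding openin_prod_topology_alt
  proof (intro allI impI)
    fix t0 q0 assume "(t0, q0) \<in> {(t, q). t \<noteq> 0 \<and> q \<in> S \<and> S_aut b t l q \<in> V}"
    then have t0: "t0 \<noteq> 0" "q0 \<in> S" "S_aut b t0 l q0 \<in> V" by auto
    obtain P0 where P0: "P0 \<in> W" "q0 = p P0" using t0(2) unfolding topspace_S by blast
    obtain i z0 where z0: "z0 \<in> chart_dom i" "P0 = W_point i z0" using P0(1) by (auto simp: topspace_W_top)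
    define O' where "O' = {tz. fst tz \<noteq> 0 \<and> snd tz \<in> chart_dom i \<and> p (T b (fst tz) l (W_point i (snd tz))) \<in> V}"
    have O': "open O'" unfolding O'_def by (rule open_orbit_map_preimage[OF b0 V])
    have "p (T b t0 l (W_point i z0)) \<in> V" using t0(3) S_aut_p[OF ad[OF t0(1)] P0(1)] P0(2) z0(2) by simp
    then have "(t0, z0) \<in> O'" using t0(1) z0(1) by (simp add: O'_def)
    with O' obtain N1 N2 where N: "open N1" "open N2" "(t0, z0) \<in> N1 \<times> N2" "N1 \<times> N2 \<subseteq> O'"
      by (rule open_prod_elim)
    have N2: "N2 \<subseteq> chart_dom i" and N1: "N1 \<subseteq> ?C" using N(3,4) by (auto simp: O'_def)
    have "openin (S_top m \<alpha>) (p ` W_point i ` N2)"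
      by (intro open_p_image openin_W_point_image N N2)
    moreover have "openin (top_of_set ?C) N1" using N(1) N1 by (simp add: openin_open_eq[OF open_Cstar])
    moreover have "N1 \<times> p ` W_point i ` N2 \<subseteq> {(t, q). t \<noteq> 0 \<and> q \<in> S \<and> S_aut b t l q \<in> V}"
    proof
      fix tq assume "tq \<in> N1 \<times> p ` W_point i ` N2"
      then obtain t z where tz: "tq = (t, p (W_point i z))" "t \<in> N1" "z \<in> N2" by auto
      then have "(t, z) \<in> O'" using N(4) by blast
      then have o: "t \<noteq> 0" "z \<in> chart_dom i" "p (T b t l (W_point i z)) \<in> V" by (auto simp: O'_def)
      have "W_point i z \<in> W" using o(2) by (rule W_point_in_W)
      then show "tq \<in> {(t, q). t \<noteq> 0 \<and> q \<in> S \<and> S_aut b t l q \<in> V}"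
        using o S_aut_p[OF ad[OF o(1)]] unfolding tz(1) topspace_S by simp
    qed
    moreover have "q0 \<in> p ` W_point i ` N2" using N(3) P0 z0 by auto
    ultimately show "\<exists>U V'. openin (top_of_set ?C) U \<and> openin (S_top m \<alpha>) V' \<and> t0 \<in> U \<and> q0 \<in> V' \<and>
        U \<times> V' \<subseteq> {(t, q). t \<noteq> 0 \<and> q \<in> S \<and> S_aut b t l q \<in> V}"
      using N(3) by (intro exI[of _ N1] exI[of _ "p ` W_point i ` N2"]) auto
  qed
  show ?thesis
    unfolding Aut_S_top_def compact_open_topology_def continuous_on_generated_topo_iff
  proof (intro conjI allI impI)
    fix U assume "U \<in> {{f \<in> carrier G. f ` K \<subseteq> V} |K V. compactin (S_top m \<alpha>) K \<and> openin (S_top m \<alpha>) V}"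
    then obtain K V where KV: "U = {f \<in> carrier G. f ` K \<subseteq> V}" "compactin (S_top m \<alpha>) K" "openin (S_top m \<alpha>) V"
      by blast
    have KS: "K \<subseteq> S" using KV(2) by (rule compactin_subset_topspace)
    have "(\<lambda>t. S_aut b t l) -` U \<inter> topspace (top_of_set ?C) = {t. t \<noteq> 0 \<and> (\<forall>q\<in>K. S_aut b t l q \<in> V)}"
      using S_aut_in_Aut[OF ad] by (auto simp: KV(1))
    moreover have "openin (top_of_set ?C) {t. t \<noteq> 0 \<and> (\<forall>q\<in>K. S_aut b t l q \<in> V)}"
    proof (subst openin_subopen, intro ballI)
      fix t0 assume "t0 \<in> {t. t \<noteq> 0 \<and> (\<forall>q\<in>K. S_aut b t l q \<in> V)}"
      then have t0: "t0 \<noteq> 0" "\<And>q. q \<in> K \<Longrightarrow> S_aut b t0 l q \<in> V" by auto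
      obtain U1 V1 where UV: "openin (top_of_set ?C) U1" "openin (S_top m \<alpha>) V1" "{t0} \<subseteq> U1" "K \<subseteq> V1"
        "U1 \<times> V1 \<subseteq> {(t, q). t \<noteq> 0 \<and> q \<in> S \<and> S_aut b t l q \<in> V}"
        by (rule Wallace_theorem_prod_topology[of "top_of_set ?C" "{t0}" "S_top m \<alpha>" K
              "{(t, q). t \<noteq> 0 \<and> q \<in> S \<and> S_aut b t l q \<in> V}"])
          (use t0 KV KS joint[OF KV(3)] in auto)
      have "U1 \<subseteq> ?C" using openin_subset[OF UV(1)] by simp
      then have "U1 \<subseteq> {t. t \<noteq> 0 \<and> (\<forall>q\<in>K. S_aut b t l q \<in> V)}" using UV(4,5) by blast
      then show "\<exists>T. openin (top_of_set ?C) T \<and> t0 \<in> T \<and> T \<subseteq> {t. t \<noteq> 0 \<and> (\<forall>q\<in>K. S_aut b t l q \<in> V)}"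
        using UV(1,3) by blast
    qed
    ultimately show "openin (top_of_set ?C) ((\<lambda>t. S_aut b t l) -` U \<inter> topspace (top_of_set ?C))" by simp
  next
    have "carrier G \<in> {{f \<in> carrier G. f ` K \<subseteq> V} |K V. compactin (S_top m \<alpha>) K \<and> openin (S_top m \<alpha>) V}"
      by (intro CollectI exI[of _ "{}"] exI[of _ "{}"]) simp
    moreover have "(\<lambda>t. S_aut b t l) ` topspace (top_of_set ?C) \<subseteq> carrier G"
      using S_aut_in_Aut[OF ad] by auto
    ultimately show "(\<lambda>t. S_aut b t l) ` topspace (top_of_set ?C) \<subseteq> \<Union> {{f \<in> carrier G. f ` K \<subseteq> V} |K V. compactin (S_top m \<alpha>) K \<and> openin (S_top m \<alpha>) V}"
      by blast
  qed
qed

text \<open>The possible values of \<open>b\<close>, the roots of the powers of \<open>\<alpha>\<close>, form a discrete subset of \<open>\<complex>\<^sup>*\<close>.\<close>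

lemma isolating_neighbourhood:
  assumes b: "admissible b 1 l"
  obtains D where "open D" "b \<in> D" "0 \<notin> D" "\<And>b' l'. b' \<in> D \<Longrightarrow> admissible b' 1 l' \<Longrightarrow> b' = b \<and> l' = l"
proof -
  define R where "R = {z. z ^ m = \<alpha> powi l} - {b}"
  \<comment> \<open>The moduli |b'|^m are powers of |\<alpha>|, so the two inequalities single out
    l' = l; removing the finite set R excludes the other m-th roots of \<alpha>^l.\<close>
  define D where "D = {w. cmod \<alpha> powi (l + 1) < cmod w ^ m} \<inter> {w. cmod w ^ m < cmod \<alpha> powi (l - 1)} - R"
  have "finite R" unfolding R_def using m by (intro finite_Diff finite_nth_roots)
  then have o: "open D"
    unfolding D_def by (intro open_Diff open_Int open_Collect_less continuous_intros finite_imp_closed)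
  have less: "cmod \<alpha> powi i < cmod \<alpha> powi k \<longleftrightarrow> k < i" for i k
  proof -
    have "cmod \<alpha> powi j = exp (real_of_int j * ln (cmod \<alpha>))" for j
      using \<alpha>_pos by (simp add: powr_real_of_int'[symmetric] powr_def)
    then show ?thesis using ln_\<alpha> by simp
  qed
  have nb: "cmod b' ^ m = cmod \<alpha> powi l'" if "admissible b' 1 l'" for b' l'
    using that by (metis admissible_def norm_power norm_power_int)
  have bD: "b \<in> D" using nb[OF b] by (simp add: D_def R_def less)
  have "cmod \<alpha> powi (l + 1) > 0" using \<alpha>_pos by simp
  then have D0: "0 \<notin> D" using m by (auto simp: D_def power_0_left)
  show thesis
  proof (rule that[OF o bD D0])
    fix b' l' assume b': "b' \<in> D" "admissible b' 1 l'"
    have "l' = l" using b'(1) nb[OF b'(2)] by (simp add: D_def less)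
    moreover have "b' ^ m = \<alpha> powi l" using b'(2) \<open>l' = l\<close> by (simp add: admissible_def)
    then have "b' = b" using b'(1) by (auto simp: D_def R_def)
    ultimately show "b' = b \<and> l' = l" by simp
  qed
qed

text \<open>The image is itself a subbasic open set: the automorphisms sending \<open>base\<close>
  into the image of D x N in S, where D isolates b.\<close>

lemma open_S_aut:
  assumes b: "admissible b 1 l" and N: "open N" "0 \<notin> N"
  shows "openin A ((\<lambda>t. S_aut b t l) ` N)"
proof -
  obtain D where D: "open D" "b \<in> D" "0 \<notin> D" "\<And>b' l'. b' \<in> D \<Longrightarrow> admissible b' 1 l' \<Longrightarrow> b' = b \<and> l' = l"
    using isolating_neighbourhood[OF b] by blast
  define V where "V = p ` W_point ChV ` (D \<times> N)"
  have "D \<times> N \<subseteq> chart_dom ChV" using D(3) by auto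
  then have V: "openin (S_top m \<alpha>) V"
    unfolding V_def using D(1) N(1) by (intro open_p_image openin_W_point_image open_Times)
  have "(\<lambda>t. S_aut b t l) ` N = {f \<in> carrier G. f ` {base} \<subseteq> V}"
  proof (intro subset_antisym subsetI)
    fix f assume "f \<in> (\<lambda>t. S_aut b t l) ` N"
    then obtain t where t: "t \<in> N" "f = S_aut b t l" by blast
    then have ad: "admissible b t l" using N(2) by (metis admissible_any[OF b])
    have "f base \<in> V" using D(2) t S_aut_base[OF ad] by (auto simp: V_def)
    then show "f \<in> {f \<in> carrier G. f ` {base} \<subseteq> V}" using S_aut_in_Aut[OF ad] t by simp
  next
    fix f assume f: "f \<in> {f \<in> carrier G. f ` {base} \<subseteq> V}"
    then obtain b' a' l' where e: "admissible b' a' l'" "f = S_aut b' a' l'" using Aut_S_S_aut[of f] by blast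
    have "p (W_point ChV (b', a')) \<in> V" using f S_aut_base[OF e(1)] e(2) by simp
    then obtain d t where dt: "d \<in> D" "t \<in> N" "p (W_point ChV (b', a')) = p (W_point ChV (d, t))"
      unfolding V_def by blast
    have d0: "d \<noteq> 0" using D(3) dt(1) by auto
    have b'0: "b' \<noteq> 0" using e(1) by (simp add: admissible_def)
    \<comment> \<open>Shifting the parameters of f by this gamma^n moves its first parameter into D,
      which contains b as the only possible value.\<close>
    obtain n where n: "d = \<alpha> powi n * b'" "t = \<alpha> powi (int m * tri n) * b' powi (int m * n) * a'"
      using p_V_eq[OF b'0 d0 dt(3)] by blast
    have ad: "admissible d t (l' + int m * n)" and fe: "f = S_aut d t (l' + int m * n)"
      using S_aut_shift[OF e(1), of n] by (auto simp: n e(2))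
    have "admissible d 1 (l' + int m * n)" using ad by (simp add: admissible_def)
    then have "d = b \<and> l' + int m * n = l" using D(4) dt(1) by blast
    then show "f \<in> (\<lambda>t. S_aut b t l) ` N" using fe dt(2) by blast
  qed
  moreover have "compactin (S_top m \<alpha>) {base}" using base_in_S by (simp add: finite_imp_compactin)
  ultimately show ?thesis
    unfolding Aut_S_top_def compact_open_topology_def using V by (intro topology_generated_by_Basis) blast
qed

lemma E_admissible_1: "s ^ m = 1 \<Longrightarrow> admissible (s * rho powi j) 1 j"
  using E_admissible[of 1 s j] by (simp add: admissible_def)

lemma continuous_E:
  assumes s: "s ^ m = 1"
  shows "continuous_map (top_of_set (UNIV - {0})) A (\<lambda>t. E j t s)"
proof -
  have "continuous_map (top_of_set (UNIV - {0})) (top_of_set (UNIV - {0})) (\<lambda>t. t * aut_coeff j)"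
    using aut_coeff_nz by (auto intro!: continuous_intros)
  from continuous_map_compose[OF this continuous_S_aut[OF E_admissible_1[OF s, of j]]] show ?thesis
    by (simp add: o_def E_def)
qed

lemma open_E:
  assumes s: "s ^ m = 1" and N: "openin (top_of_set (UNIV - {0})) N"
  shows "openin A ((\<lambda>t. E j t s) ` N)"
proof -
  have oN: "open N" "0 \<notin> N" using N unfolding openin_open_eq[OF open_Cstar] by auto
  let ?N = "(\<lambda>t. t / aut_coeff j) -` N"
  have "open ?N" using oN(1) by (intro open_vimage continuous_intros) (simp_all add: aut_coeff_nz)
  moreover have "0 \<notin> ?N" using oN(2) by simp
  ultimately have "openin A ((\<lambda>t. S_aut (s * rho powi j) t j) ` ?N)"
    by (rule open_S_aut[OF E_admissible_1[OF s]])
  moreover have "(\<lambda>t. S_aut (s * rho powi j) t j) ` ?N = (\<lambda>t. E j t s) ` N"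
  proof (intro subset_antisym subsetI)
    fix f assume "f \<in> (\<lambda>t. S_aut (s * rho powi j) t j) ` ?N"
    then obtain t where "t / aut_coeff j \<in> N" "f = S_aut (s * rho powi j) t j" by blast
    then show "f \<in> (\<lambda>t. E j t s) ` N" using aut_coeff_nz by (intro image_eqI[of _ _ "t / aut_coeff j"]) (auto simp: E_def)
  next
    fix f assume "f \<in> (\<lambda>t. E j t s) ` N"
    then obtain t where "t \<in> N" "f = E j t s" by blast
    then show "f \<in> (\<lambda>t. S_aut (s * rho powi j) t j) ` ?N"
      using aut_coeff_nz by (intro image_eqI[of _ _ "t * aut_coeff j"]) (auto simp: E_def)
  qed
  ultimately show ?thesis by simp
qed

lemma openin_E_component: "s ^ m = 1 \<Longrightarrow> openin A {E j t s | t. t \<noteq> 0}"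
proof -
  assume s: "s ^ m = 1"
  have "{E j t s | t. t \<noteq> 0} = (\<lambda>t. E j t s) ` (UNIV - {0})" by auto
  then show ?thesis using open_E[OF s, of "UNIV - {0}" j] by simp
qed

text \<open>The right-hand side is connected as a continuous image of the punctured plane and open
  by \<open>open_E\<close>. Its complement is a union of open sets of the same kind, so it is also
  closed and hence the whole component.\<close>

lemma Aut0_eq: "Aut0 m \<alpha> = {E 0 t 1 | t. t \<noteq> 0}"
proof -
  let ?M = "{E 0 t 1 | t. t \<noteq> 0}"
  have M: "?M = (\<lambda>t. E 0 t 1) ` (UNIV - {0})" by auto
  have con: "connectedin A ?M"
    unfolding M
    by (rule connectedin_continuous_map_image[OF continuous_E])
      (simp_all add: connectedin_subtopology connectedin_absolute connected_punctured Compl_eq_Diff_UNIV[symmetric])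
  have one: "\<one>\<^bsub>G\<^esub> \<in> ?M" by (auto simp: E_one intro!: exI[of _ 1])
  have op: "openin A ?M" by (rule openin_E_component) simp
  have "openin A (topspace A - ?M)"
  proof (subst openin_subopen, intro ballI)
    fix f assume f: "f \<in> topspace A - ?M"
    then have "f \<in> carrier G" by (simp add: topspace_A)
    then obtain j t s where e: "t \<noteq> 0" "s ^ m = 1" "f = E j t s" by (rule Aut_S_E)
    have notM: "E j t' s \<notin> ?M" if t': "t' \<noteq> 0" for t'
    proof
      assume "E j t' s \<in> ?M"
      then obtain u where u: "u \<noteq> 0" "E j t' s = E 0 u 1" by blast
      have "(1::complex) ^ m = 1" by simp
      note inj = E_inj[OF t' e(2) u(1) this u(2)]
      have "int m dvd j - 0" using inj(1) by simp
      then have "f = E 0 t 1" using E_cong[OF e(1,2)] e(3) inj(2) by simp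
      then show False using f e(1) by blast
    qed
    have "{E j t s | t. t \<noteq> 0} \<subseteq> topspace A - ?M"
    proof
      fix g assume "g \<in> {E j t s | t. t \<noteq> 0}"
      then obtain t' where t': "t' \<noteq> 0" "g = E j t' s" by blast
      show "g \<in> topspace A - ?M"
        using notM[OF t'(1)] E_in_Aut[OF t'(1) e(2), of j] t'(2) unfolding topspace_A by (intro DiffI) simp_all
    qed
    then show "\<exists>U. openin A U \<and> f \<in> U \<and> U \<subseteq> topspace A - ?M"
      using openin_E_component[OF e(2), of j] e(1,3) by (intro exI[of _ "{E j t s | t. t \<noteq> 0}"]) auto
  qed
  then have cl: "closedin A ?M" using openin_subset[OF op] by (simp add: closedin_def)
  show ?thesis
    unfolding Aut0_def
  proof (intro subset_antisym)
    show "?M \<subseteq> connected_component_of_set A \<one>\<^bsub>G\<^esub>"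
      by (rule connected_component_of_maximal[OF con one])
    have "\<one>\<^bsub>G\<^esub> \<in> connected_component_of_set A \<one>\<^bsub>G\<^esub>"
      using one openin_subset[OF op] by (auto simp: connected_component_of_refl)
    then show "connected_component_of_set A \<one>\<^bsub>G\<^esub> \<subseteq> ?M"
      using connectedin_clopen_cases[OF connectedin_connected_component_of cl op, of "\<one>\<^bsub>G\<^esub>"] one
      unfolding disjnt_iff by blast
  qed
qed

lemma Aut0_center: "Aut0 m \<alpha> = group_center G"
  unfolding Aut0_eq using center_iff by blast

lemma Aut0_iso:
  "topological_group_iso Cstar (top_of_set (carrier Cstar)) (G\<lparr>carrier := Aut0 m \<alpha>\<rparr>)
     (subtopology A (Aut0 m \<alpha>)) (\<lambda>t. E 0 t 1)"
  unfolding topological_group_iso_def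
proof
  have inj: "inj_on (\<lambda>t. E 0 t 1) (UNIV - {0})"
  proof (rule inj_onI)
    fix x y :: complex assume "x \<in> UNIV - {0}" "y \<in> UNIV - {0}" "E 0 x 1 = E 0 y 1"
    then show "x = y" using E_inj(3)[of x 1 y 1 0 0] by simp
  qed
  have img: "(\<lambda>t. E 0 t 1) ` (UNIV - {0}) = Aut0 m \<alpha>" unfolding Aut0_eq by blast
  show "(\<lambda>t. E 0 t 1) \<in> iso Cstar (G\<lparr>carrier := Aut0 m \<alpha>\<rparr>)"
    unfolding iso_def
  proof (intro CollectI conjI homI)
    fix x y assume "x \<in> carrier Cstar" "y \<in> carrier Cstar"
    then show "E 0 (x \<otimes>\<^bsub>Cstar\<^esub> y) 1 = E 0 x 1 \<otimes>\<^bsub>G\<lparr>carrier := Aut0 m \<alpha>\<rparr>\<^esub> E 0 y 1"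
      using E_mult[of x 1 y 1 0 0] by (simp add: Cstar_def)
  qed (use inj img in \<open>auto simp: Cstar_def bij_betw_def\<close>)
  show "homeomorphic_map (top_of_set (carrier Cstar)) (subtopology A (Aut0 m \<alpha>)) (\<lambda>t. E 0 t 1)"
    by (rule homeomorphic_map_onto_subtopology) (use continuous_E[of 1 0] open_E[of 1 _ 0] inj img in \<open>simp_all add: Cstar_def\<close>)
qed

section \<open>The topology of Aut_1 and its translates\<close>

definition \<psi> :: "complex \<times> complex \<Rightarrow> S_pt \<Rightarrow> S_pt" where
  "\<psi> = (\<lambda>(t, s). E 0 t s)"

lemma top_mu: "top_of_set (carrier (mu m)) = discrete_topology {s. s ^ m = 1}"
  using finite_top_of_set_discrete[of "{s. s ^ m = (1::complex)}"] m by (simp add: mu_def finite_nth_roots)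

lemma \<psi>_image: "\<psi> ` ((UNIV - {0}) \<times> {s. s ^ m = 1}) = Aut1 m \<alpha>"
proof (intro subset_antisym subsetI)
  fix f assume "f \<in> Aut1 m \<alpha>"
  then obtain t s where "t \<noteq> 0" "s ^ m = 1" "f = E 0 t s" by (rule Aut1_E)
  then show "f \<in> \<psi> ` ((UNIV - {0}) \<times> {s. s ^ m = 1})" by (intro image_eqI[of _ _ "(t, s)"]) (auto simp: \<psi>_def)
qed (auto simp: \<psi>_def intro: E_0_in_Aut1)

lemma openin_\<psi>_image:
  assumes "openin (prod_topology (top_of_set (UNIV - {0})) (discrete_topology {s. s ^ m = 1})) N"
  shows "openin A (\<psi> ` N)"
proof -
  have N: "N \<subseteq> (UNIV - {0}) \<times> {s. s ^ m = 1}" "\<And>s. s ^ m = 1 \<Longrightarrow> openin (top_of_set (UNIV - {0})) {t. (t, s) \<in> N}"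
    using assms unfolding openin_prod_discrete by auto
  have "\<psi> ` N = (\<Union>s\<in>{s. s ^ m = 1}. (\<lambda>t. E 0 t s) ` {t. (t, s) \<in> N})"
    using N(1) by (fastforce simp: \<psi>_def image_iff)
  moreover have "openin A (\<Union>s\<in>{s. s ^ m = 1}. (\<lambda>t. E 0 t s) ` {t. (t, s) \<in> N})"
    using open_E N(2) by (intro openin_Union) auto
  ultimately show ?thesis by simp
qed

lemma continuous_\<psi>:
  "continuous_map (prod_topology (top_of_set (UNIV - {0})) (discrete_topology {s. s ^ m = 1})) A \<psi>"
  unfolding continuous_map_def
proof (intro conjI allI impI)
  show "\<psi> \<in> topspace (prod_topology (top_of_set (UNIV - {0})) (discrete_topology {s. s ^ m = 1})) \<rightarrow> topspace A"
    using E_in_Aut by (auto simp: topspace_A \<psi>_def)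
  fix U assume U: "openin A U"
  have "openin (top_of_set (UNIV - {0})) {t \<in> UNIV - {0}. E 0 t s \<in> U}" if "s ^ m = 1" for s
    using continuous_E[OF that, of 0] U by (auto simp: continuous_map_def)
  moreover have "{t. (t, s) \<in> {x \<in> (UNIV - {0}) \<times> {s. s ^ m = 1}. \<psi> x \<in> U}} = {t \<in> UNIV - {0}. E 0 t s \<in> U}"
    if "s ^ m = 1" for s using that by (auto simp: \<psi>_def)
  ultimately show "openin (prod_topology (top_of_set (UNIV - {0})) (discrete_topology {s. s ^ m = 1}))
     {x \<in> topspace (prod_topology (top_of_set (UNIV - {0})) (discrete_topology {s. s ^ m = 1})). \<psi> x \<in> U}"
    unfolding openin_prod_discrete by simp
qed

lemma \<psi>_iso:
  "topological_group_iso (Cstar \<times>\<times> mu m)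
     (prod_topology (top_of_set (carrier Cstar)) (top_of_set (carrier (mu m))))
     N1 (subtopology A (Aut1 m \<alpha>)) \<psi>"
  unfolding topological_group_iso_def
proof
  let ?X = "(UNIV - {0}) \<times> {s :: complex. s ^ m = 1}"
  have inj: "inj_on \<psi> ?X"
  proof (rule inj_onI)
    fix x y assume xy: "x \<in> ?X" "y \<in> ?X" "\<psi> x = \<psi> y"
    obtain t s t' s' where e: "x = (t, s)" "y = (t', s')" by (metis surj_pair)
    have "E 0 t s = E 0 t' s'" using xy(3) by (simp add: e \<psi>_def)
    moreover have "t \<noteq> 0" "s ^ m = 1" "t' \<noteq> 0" "s' ^ m = 1" using xy(1,2) by (auto simp: e)
    ultimately show "x = y" using E_inj(2,3)[of t s t' s' 0 0] by (simp add: e)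
  qed
  have car: "carrier (Cstar \<times>\<times> mu m) = ?X" by (simp add: Cstar_def mu_def)
  show "\<psi> \<in> iso (Cstar \<times>\<times> mu m) N1"
    unfolding iso_def
  proof (intro CollectI conjI homI)
    fix x y assume "x \<in> carrier (Cstar \<times>\<times> mu m)" "y \<in> carrier (Cstar \<times>\<times> mu m)"
    then obtain t s t' s' where "x = (t, s)" "t \<noteq> 0" "s ^ m = 1" "y = (t', s')" "t' \<noteq> 0" "s' ^ m = 1"
      unfolding car by auto
    then show "\<psi> (x \<otimes>\<^bsub>Cstar \<times>\<times> mu m\<^esub> y) = \<psi> x \<otimes>\<^bsub>N1\<^esub> \<psi> y"
      using E_mult[of t s t' s' 0 0] by (simp add: Cstar_def mu_def \<psi>_def)
  qed (use inj \<psi>_image in \<open>auto simp: car bij_betw_def simp del: carrier_DirProd\<close>)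
  show "homeomorphic_map (prod_topology (top_of_set (carrier Cstar)) (top_of_set (carrier (mu m))))
      (subtopology A (Aut1 m \<alpha>)) \<psi>"
    unfolding top_mu
    by (rule homeomorphic_map_onto_subtopology)
      (use continuous_\<psi> openin_\<psi>_image inj \<psi>_image in \<open>simp_all add: Cstar_def\<close>)
qed

lemma openin_Aut1: "openin A (Aut1 m \<alpha>)"
proof -
  have "openin (prod_topology (top_of_set (UNIV - {0})) (discrete_topology {s. s ^ m = 1}))
      ((UNIV - {0}) \<times> {s :: complex. s ^ m = 1})"
    by (simp add: openin_prod_Times_iff)
  from openin_\<psi>_image[OF this] show ?thesis unfolding \<psi>_image .
qed

text \<open>By \<open>E_mult\<close>, \<open>E j t s\<close> is \<open>E 0 t s\<close> times
  \<open>E j 1 1\<close>. So this is a preimage under right translation; the next lemma concerns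
  images.\<close>

lemma openin_Aut1_preimage:
  assumes U: "openin A U"
  shows "openin A {E 0 t s | t s. t \<noteq> 0 \<and> s ^ m = 1 \<and> E j t s \<in> U}"
proof -
  have "openin (top_of_set (UNIV - {0})) {t \<in> UNIV - {0}. E j t s \<in> U}" if "s ^ m = 1" for s
    using continuous_E[OF that, of j] U by (auto simp: continuous_map_def)
  then have "openin A (\<Union>s\<in>{s. s ^ m = 1}. (\<lambda>t. E 0 t s) ` {t \<in> UNIV - {0}. E j t s \<in> U})"
    using open_E by (intro openin_Union) auto
  moreover have "(\<Union>s\<in>{s. s ^ m = 1}. (\<lambda>t. E 0 t s) ` {t \<in> UNIV - {0}. E j t s \<in> U}) =
      {E 0 t s | t s. t \<noteq> 0 \<and> s ^ m = 1 \<and> E j t s \<in> U}" by blast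
  ultimately show ?thesis by simp
qed

lemma openin_Aut1_translate:
  assumes N: "openin A N"
  shows "openin A {E j t s | t s. t \<noteq> 0 \<and> s ^ m = 1 \<and> E 0 t s \<in> N}"
proof -
  have "openin (top_of_set (UNIV - {0})) {t \<in> UNIV - {0}. E 0 t s \<in> N}" if "s ^ m = 1" for s
    using continuous_E[OF that, of 0] N by (auto simp: continuous_map_def)
  then have "openin A (\<Union>s\<in>{s. s ^ m = 1}. (\<lambda>t. E j t s) ` {t \<in> UNIV - {0}. E 0 t s \<in> N})"
    using open_E by (intro openin_Union) auto
  moreover have "(\<Union>s\<in>{s. s ^ m = 1}. (\<lambda>t. E j t s) ` {t \<in> UNIV - {0}. E 0 t s \<in> N}) =
      {E j t s | t s. t \<noteq> 0 \<and> s ^ m = 1 \<and> E 0 t s \<in> N}" by blast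
  ultimately show ?thesis by simp
qed

end

section \<open>The semidirect product\<close>

lemma group_mu:
  assumes "m > 0"
  shows "group (mu m)"
proof (rule groupI)
  fix x assume x: "x \<in> carrier (mu m)"
  then have "x \<noteq> 0" using assms by (auto simp: mu_def power_0_left)
  then show "\<exists>y\<in>carrier (mu m). y \<otimes>\<^bsub>mu m\<^esub> x = \<one>\<^bsub>mu m\<^esub>"
    using x by (intro bexI[of _ "inverse x"]) (auto simp: mu_def power_inverse)
qed (auto simp: mu_def power_mult_distrib)

lemma generate_mu_powi:
  assumes m: "m > 0" and \<zeta>: "\<zeta> \<in> carrier (mu m)" and h: "h \<in> generate (mu m) {\<zeta>}"
  obtains j where "\<zeta> powi j = h"
proof -
  interpret group "mu m" by (rule group_mu[OF m])
  have \<zeta>0: "\<zeta> \<noteq> 0" using \<zeta> m by (auto simp: mu_def power_0_left)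
  have invz: "inv\<^bsub>mu m\<^esub> \<zeta> = inverse \<zeta>"
    using \<zeta> \<zeta>0 by (intro inv_equality) (auto simp: mu_def power_inverse)
  from h have "\<exists>j. \<zeta> powi j = h"
  proof (induction rule: generate.induct)
    case one
    show ?case by (rule exI[of _ 0]) (simp add: mu_def)
  next
    case (incl h)
    then show ?case by (intro exI[of _ 1]) simp
  next
    case (inv h)
    then show ?case by (intro exI[of _ "-1"]) (simp add: power_int_minus invz)
  next
    case (eng h1 h2)
    then obtain i k where "\<zeta> powi i = h1" "\<zeta> powi k = h2" by auto
    then show ?case using \<zeta>0 by (intro exI[of _ "i + k"]) (simp add: mu_def power_int_add)
  qed
  with that show thesis by blast
qed

context inoue begin

context
  fixes \<zeta> :: complex
  assumes \<zeta>: "\<zeta> \<in> carrier (mu m)" and gen: "generate (mu m) {\<zeta>} = carrier (mu m)"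
begin

text \<open>A discrete logarithm to base \<zeta>. It involves a choice and is meaningful modulo m,
  so J 1 need not be 0 and J is additive up to multiples of m.\<close>

definition J :: "complex \<Rightarrow> int" where
  "J u = (SOME j. \<zeta> powi j = u)"

lemma \<zeta>_m: "\<zeta> ^ m = 1"
  using \<zeta> by (simp add: mu_def)

lemma \<zeta>_J: "u ^ m = 1 \<Longrightarrow> \<zeta> powi J u = u"
proof -
  assume "u ^ m = 1"
  then have "u \<in> generate (mu m) {\<zeta>}" by (simp add: gen) (simp add: mu_def)
  then obtain j where "\<zeta> powi j = u" by (rule generate_mu_powi[OF m \<zeta>])
  then show ?thesis unfolding J_def by (rule someI)
qed

text \<open>A primitive m-th root of unity \<omega> is a power of \<zeta>, so \<zeta>^j = 1 implies
  \<omega>^j = 1.\<close>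

lemma \<zeta>_powi_eq_1:
  assumes "\<zeta> powi j = 1"
  shows "int m dvd j"
proof -
  obtain \<omega> :: complex where \<omega>: "\<omega> ^ m = 1" "\<And>l. \<omega> powi l = 1 \<Longrightarrow> int m dvd l"
    using primitive_root_of_unity[OF m] by blast
  have "\<omega> powi j = (\<zeta> powi J \<omega>) powi j" by (simp add: \<zeta>_J[OF \<omega>(1)])
  also have "\<dots> = (\<zeta> powi j) powi J \<omega>" by (simp add: power_int_mult[symmetric] mult.commute)
  also have "\<dots> = 1" using assms by simp
  finally show ?thesis by (rule \<omega>(2))
qed

lemma \<zeta>_powi_eq: "\<zeta> powi i = \<zeta> powi j \<Longrightarrow> int m dvd i - j"
  using mu_nz[OF \<zeta>_m] by (intro \<zeta>_powi_eq_1) (simp add: power_int_diff)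

lemma J_powi: "int m dvd J (\<zeta> powi j) - j"
  by (rule \<zeta>_powi_eq) (simp add: \<zeta>_J mu_powi \<zeta>_m)

lemma J_mult: "u ^ m = 1 \<Longrightarrow> u' ^ m = 1 \<Longrightarrow> int m dvd J (u * u') - (J u + J u')"
  using mu_nz[OF \<zeta>_m] by (intro \<zeta>_powi_eq) (simp add: power_int_add \<zeta>_J power_mult_distrib)

lemma mu_powi_cong: "s ^ m = 1 \<Longrightarrow> int m dvd i - j \<Longrightarrow> s powi i = (s powi j :: complex)"
proof -
  assume s: "s ^ m = 1" and "int m dvd i - j"
  then obtain n where "i - j = int m * n" by (auto elim: dvdE)
  then have "i = j + int m * n" by simp
  then show ?thesis using mu_nz[OF s] power_eq_1_powi[OF s, of n] by (simp add: power_int_add)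
qed

text \<open>Conjugation by a power of the m-th root of gamma; in the parameters it is (t, s) -> (t
  s^(J u), s).\<close>

definition \<theta> :: "complex \<Rightarrow> (S_pt \<Rightarrow> S_pt) \<Rightarrow> S_pt \<Rightarrow> S_pt" where
  "\<theta> u = (\<lambda>a\<in>Aut1 m \<alpha>. E (J u) 1 1 \<otimes>\<^bsub>G\<^esub> a \<otimes>\<^bsub>G\<^esub> E (- J u) 1 1)"

text \<open>The factor from Aut_1 stands on the left, in accordance with the order of the factors in
  \<open>semidirect_product\<close>.\<close>

definition \<Phi> :: "complex \<times> (S_pt \<Rightarrow> S_pt) \<Rightarrow> S_pt \<Rightarrow> S_pt" where
  "\<Phi> = (\<lambda>(u, a). a \<otimes>\<^bsub>G\<^esub> E (J u) 1 1)"

lemma \<theta>_E: "t \<noteq> 0 \<Longrightarrow> s ^ m = 1 \<Longrightarrow> \<theta> u (E 0 t s) = E 0 (t * s powi J u) s"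
  using E_mult[of 1 1 t s "J u" 0] E_mult[of "t * s powi J u" s 1 1 "J u" "- J u"] mu_nz[of s]
  by (simp add: \<theta>_def E_0_in_Aut1)

lemma \<Phi>_E: "t \<noteq> 0 \<Longrightarrow> s ^ m = 1 \<Longrightarrow> \<Phi> (u, E 0 t s) = E (J u) t s"
  using E_mult[of t s 1 1 0 "J u"] by (simp add: \<Phi>_def)

lemma E_0_mult: "t \<noteq> 0 \<Longrightarrow> s ^ m = 1 \<Longrightarrow> t' \<noteq> 0 \<Longrightarrow> s' ^ m = 1 \<Longrightarrow>
    E 0 t s \<otimes>\<^bsub>G\<^esub> E 0 t' s' = E 0 (t * t') (s * s')"
  using E_mult[of t s t' s' 0 0] by simp

lemma \<theta>_in_Aut1: "a \<in> Aut1 m \<alpha> \<Longrightarrow> \<theta> u a \<in> Aut1 m \<alpha>"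
  by (erule Aut1_E) (simp add: \<theta>_E E_0_in_Aut1 mu_nz)

lemma \<theta>_Bij: "\<theta> u \<in> Bij (Aut1 m \<alpha>)"
proof -
  define g where "g a = E (- J u) 1 1 \<otimes>\<^bsub>G\<^esub> a \<otimes>\<^bsub>G\<^esub> E (J u) 1 1" for a
  have g: "g (E 0 t s) = E 0 (t * s powi (- J u)) s" if "t \<noteq> 0" "s ^ m = 1" for t s
    using that E_mult[of 1 1 t s "- J u" 0] E_mult[of "t * s powi (- J u)" s 1 1 "- J u" "J u"] mu_nz[of s]
    by (simp add: g_def)
  have "bij_betw (\<theta> u) (Aut1 m \<alpha>) (Aut1 m \<alpha>)"
  proof (rule bij_betw_byWitness[of _ g])
    show "\<forall>a\<in>Aut1 m \<alpha>. g (\<theta> u a) = a"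
    proof
      fix a assume "a \<in> Aut1 m \<alpha>"
      then obtain t s where "t \<noteq> 0" "s ^ m = 1" "a = E 0 t s" by (rule Aut1_E)
      then show "g (\<theta> u a) = a" using mu_nz[of s] by (simp add: \<theta>_E g power_int_minus mult.assoc)
    qed
    show "\<forall>a\<in>Aut1 m \<alpha>. \<theta> u (g a) = a"
    proof
      fix a assume "a \<in> Aut1 m \<alpha>"
      then obtain t s where "t \<noteq> 0" "s ^ m = 1" "a = E 0 t s" by (rule Aut1_E)
      then show "\<theta> u (g a) = a" using mu_nz[of s] by (simp add: \<theta>_E g power_int_minus mult.assoc)
    qed
    show "\<theta> u ` Aut1 m \<alpha> \<subseteq> Aut1 m \<alpha>" using \<theta>_in_Aut1 by blast
    show "g ` Aut1 m \<alpha> \<subseteq> Aut1 m \<alpha>"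
    proof (rule image_subsetI)
      fix a assume "a \<in> Aut1 m \<alpha>"
      then obtain t s where "t \<noteq> 0" "s ^ m = 1" "a = E 0 t s" by (rule Aut1_E)
      then show "g a \<in> Aut1 m \<alpha>" using mu_nz[of s] by (simp add: g E_0_in_Aut1)
    qed
  qed
  then show ?thesis by (simp add: Bij_def \<theta>_def)
qed

lemma \<theta>_hom: "\<theta> \<in> hom (mu m) (AutoGroup N1)"
proof (rule homI)
  fix u assume "u \<in> carrier (mu m)"
  have "\<theta> u \<in> hom N1 N1"
  proof (rule homI)
    fix x y assume "x \<in> carrier N1" "y \<in> carrier N1"
    then have xy: "x \<in> Aut1 m \<alpha>" "y \<in> Aut1 m \<alpha>" by simp_all
    obtain t s where x: "t \<noteq> 0" "s ^ m = 1" "x = E 0 t s" using xy(1) by (rule Aut1_E)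
    obtain t' s' where y: "t' \<noteq> 0" "s' ^ m = 1" "y = E 0 t' s'" using xy(2) by (rule Aut1_E)
    show "\<theta> u (x \<otimes>\<^bsub>N1\<^esub> y) = \<theta> u x \<otimes>\<^bsub>N1\<^esub> \<theta> u y"
      using x y mu_nz[OF x(2)] mu_nz[OF y(2)]
      by (simp add: \<theta>_E E_0_mult power_mult_distrib power_int_mult_distrib ac_simps)
  qed (simp add: \<theta>_in_Aut1)
  then show "\<theta> u \<in> carrier (AutoGroup N1)" using \<theta>_Bij by (simp add: AutoGroup_def auto_def)
next
  fix u u' assume "u \<in> carrier (mu m)" "u' \<in> carrier (mu m)"
  then have hh: "u ^ m = 1" "u' ^ m = 1" by (auto simp: mu_def)
  have "\<theta> (u * u') = compose (Aut1 m \<alpha>) (\<theta> u) (\<theta> u')"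
  proof (rule extensionalityI[of _ "Aut1 m \<alpha>"])
    fix a assume a: "a \<in> Aut1 m \<alpha>"
    then obtain t s where e: "t \<noteq> 0" "s ^ m = 1" "a = E 0 t s" by (rule Aut1_E)
    have "s powi J (u * u') = s powi (J u + J u')"
      by (rule mu_powi_cong[OF e(2) J_mult[OF hh]])
    then show "\<theta> (u * u') a = compose (Aut1 m \<alpha>) (\<theta> u) (\<theta> u') a"
      using a e mu_nz[OF e(2)] by (simp add: compose_def \<theta>_E power_int_add ac_simps)
  qed (simp_all add: \<theta>_def)
  then show "\<theta> (u \<otimes>\<^bsub>mu m\<^esub> u') = \<theta> u \<otimes>\<^bsub>AutoGroup N1\<^esub> \<theta> u'"
    using \<theta>_Bij by (simp add: AutoGroup_def BijGroup_def mu_def)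
qed

lemma \<theta>_\<psi>: "t \<in> carrier Cstar \<Longrightarrow> s \<in> carrier (mu m) \<Longrightarrow> \<theta> \<zeta> (\<psi> (t, s)) = \<psi> (s * t, s)"
proof -
  assume "t \<in> carrier Cstar" "s \<in> carrier (mu m)"
  then have ts: "t \<noteq> 0" "s ^ m = 1" by (auto simp: Cstar_def mu_def)
  \<comment> \<open>J \<zeta> is congruent to 1 modulo m, and s is an m-th root of unity.\<close>
  have "s powi J \<zeta> = s powi 1" using J_powi[of 1] by (intro mu_powi_cong ts) simp
  then show ?thesis using ts by (simp add: \<psi>_def \<theta>_E mult.commute)
qed

lemma \<Phi>_1:
  assumes "a \<in> Aut1 m \<alpha>"
  shows "\<Phi> (1, a) = a"
proof -
  obtain t s where e: "t \<noteq> 0" "s ^ m = 1" "a = E 0 t s" using assms by (rule Aut1_E)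
  have "int m dvd J 1 - 0" using J_powi[of 0] by simp
  from E_cong[OF e(1,2) this] show ?thesis by (simp add: e(3) \<Phi>_E[OF e(1,2)])
qed

lemma carrier_semidirect: "carrier (semidirect_product (mu m) N1 \<theta>) = {u. u ^ m = 1} \<times> Aut1 m \<alpha>"
  by (simp add: semidirect_product_def mu_def)

lemma \<Phi>_in_Aut: "u ^ m = 1 \<Longrightarrow> a \<in> Aut1 m \<alpha> \<Longrightarrow> \<Phi> (u, a) \<in> carrier G"
  by (erule Aut1_E) (simp add: \<Phi>_E E_in_Aut)

lemma \<Phi>_inj: "inj_on \<Phi> ({u. u ^ m = 1} \<times> Aut1 m \<alpha>)"
proof (rule inj_onI)
  fix x y assume xy: "x \<in> {u. u ^ m = 1} \<times> Aut1 m \<alpha>" "y \<in> {u. u ^ m = 1} \<times> Aut1 m \<alpha>" "\<Phi> x = \<Phi> y"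
  obtain u a u' a' where ha: "x = (u, a)" "y = (u', a')" by (metis surj_pair)
  have hh: "u ^ m = 1" "u' ^ m = 1" and aa: "a \<in> Aut1 m \<alpha>" "a' \<in> Aut1 m \<alpha>" using xy by (auto simp: ha)
  obtain t s where e: "t \<noteq> 0" "s ^ m = 1" "a = E 0 t s" using aa(1) by (rule Aut1_E)
  obtain t' s' where e': "t' \<noteq> 0" "s' ^ m = 1" "a' = E 0 t' s'" using aa(2) by (rule Aut1_E)
  have "E (J u) t s = E (J u') t' s'" using xy(3) by (simp add: ha e(3) e'(3) \<Phi>_E e e')
  note inj = E_inj[OF e(1,2) e'(1,2) this]
  have "\<zeta> powi J u' = \<zeta> powi J u" by (rule mu_powi_cong[OF \<zeta>_m inj(1)])
  then have "u' = u" by (simp add: \<zeta>_J hh)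
  then show "x = y" using inj by (simp add: ha e e')
qed

lemma \<Phi>_image: "\<Phi> ` ({u. u ^ m = 1} \<times> Aut1 m \<alpha>) = carrier G"
proof (intro subset_antisym subsetI)
  fix f assume "f \<in> \<Phi> ` ({u. u ^ m = 1} \<times> Aut1 m \<alpha>)"
  then show "f \<in> carrier G" using \<Phi>_in_Aut by auto
next
  fix f assume "f \<in> carrier G"
  then obtain j t s where e: "t \<noteq> 0" "s ^ m = 1" "f = E j t s" by (rule Aut_S_E)
  have "\<Phi> (\<zeta> powi j, E 0 t s) = E j t s"
    using E_cong[OF e(1,2) J_powi] by (simp add: \<Phi>_E[OF e(1,2)])
  moreover have "(\<zeta> powi j, E 0 t s) \<in> {u. u ^ m = 1} \<times> Aut1 m \<alpha>"
    using e by (simp add: mu_powi \<zeta>_m E_0_in_Aut1)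
  ultimately show "f \<in> \<Phi> ` ({u. u ^ m = 1} \<times> Aut1 m \<alpha>)" using e(3) by (metis imageI)
qed

lemma \<Phi>_mult:
  assumes "u ^ m = 1" "u' ^ m = 1" "a \<in> Aut1 m \<alpha>" "a' \<in> Aut1 m \<alpha>"
  shows "\<Phi> (u * u', a \<otimes>\<^bsub>G\<^esub> \<theta> u a') = \<Phi> (u, a) \<otimes>\<^bsub>G\<^esub> \<Phi> (u', a')"
proof -
  obtain t s where e: "t \<noteq> 0" "s ^ m = 1" "a = E 0 t s" using assms(3) by (rule Aut1_E)
  obtain t' s' where e': "t' \<noteq> 0" "s' ^ m = 1" "a' = E 0 t' s'" using assms(4) by (rule Aut1_E)
  have nz: "t' * s' powi J u \<noteq> 0" "t * (t' * s' powi J u) \<noteq> 0" "(s * s') ^ m = 1"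
    using e e' mu_nz[OF e'(2)] by (auto simp: power_mult_distrib)
  have "\<Phi> (u * u', a \<otimes>\<^bsub>G\<^esub> \<theta> u a') = E (J (u * u')) (t * (t' * s' powi J u)) (s * s')"
    by (simp only: e(3) e'(3) \<theta>_E[OF e'(1,2)] E_0_mult[OF e(1,2) nz(1) e'(2)] \<Phi>_E[OF nz(2,3)])
  \<comment> \<open>J is additive modulo m, and \<open>E\<close> depends on its first argument only
    modulo m.\<close>
  also have "\<dots> = E (J u + J u') (t * (t' * s' powi J u)) (s * s')"
    by (rule E_cong[OF nz(2,3) J_mult[OF assms(1,2)]])
  also have "\<dots> = \<Phi> (u, a) \<otimes>\<^bsub>G\<^esub> \<Phi> (u', a')"
    by (simp only: e(3) e'(3) \<Phi>_E[OF e(1,2)] \<Phi>_E[OF e'(1,2)] E_mult[OF e(1,2) e'(1,2)] mult.assoc)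
  finally show ?thesis .
qed

lemma \<Phi>_slice: "{a \<in> Aut1 m \<alpha>. \<Phi> (u, a) \<in> U} = {E 0 t s | t s. t \<noteq> 0 \<and> s ^ m = 1 \<and> E (J u) t s \<in> U}"
proof (intro subset_antisym subsetI)
  fix a assume "a \<in> {a \<in> Aut1 m \<alpha>. \<Phi> (u, a) \<in> U}"
  then have a: "a \<in> Aut1 m \<alpha>" "\<Phi> (u, a) \<in> U" by auto
  obtain t s where e: "t \<noteq> 0" "s ^ m = 1" "a = E 0 t s" using a(1) by (rule Aut1_E)
  then have "E (J u) t s \<in> U" using a(2) by (simp add: \<Phi>_E)
  with e show "a \<in> {E 0 t s | t s. t \<noteq> 0 \<and> s ^ m = 1 \<and> E (J u) t s \<in> U}" by blast
next
  fix a assume "a \<in> {E 0 t s | t s. t \<noteq> 0 \<and> s ^ m = 1 \<and> E (J u) t s \<in> U}"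
  then obtain t s where e: "t \<noteq> 0" "s ^ m = 1" "a = E 0 t s" "E (J u) t s \<in> U" by blast
  then show "a \<in> {a \<in> Aut1 m \<alpha>. \<Phi> (u, a) \<in> U}" by (simp add: \<Phi>_E E_0_in_Aut1)
qed

text \<open>Since \<open>mu m\<close> is discrete and Aut_1 is open, continuity and openness can be
  checked on each slice, where \<Phi> is a right translation.\<close>

lemma \<Phi>_homeomorphic:
  "homeomorphic_map (prod_topology (top_of_set (carrier (mu m))) (subtopology A (Aut1 m \<alpha>))) A \<Phi>"
proof -
  let ?M = "{u :: complex. u ^ m = 1}"
  let ?X = "prod_topology (discrete_topology ?M) (subtopology A (Aut1 m \<alpha>))"
  have sub: "Aut1 m \<alpha> \<subseteq> topspace A" using openin_subset[OF openin_Aut1] .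
  have top: "topspace ?X = ?M \<times> Aut1 m \<alpha>" using sub by (simp add: Int_absorb1)
  have sub_open: "openin (subtopology A (Aut1 m \<alpha>)) B \<longleftrightarrow> openin A B \<and> B \<subseteq> Aut1 m \<alpha>" for B
    by (rule openin_open_subtopology[OF openin_Aut1])
  have "homeomorphic_map ?X (subtopology A (carrier G)) \<Phi>"
  proof (rule homeomorphic_map_onto_subtopology)
    show "continuous_map ?X A \<Phi>"
      unfolding continuous_map_def top
    proof (intro conjI allI impI)
      show "\<Phi> \<in> ?M \<times> Aut1 m \<alpha> \<rightarrow> topspace A" unfolding topspace_A using \<Phi>_in_Aut by auto
      fix U assume U: "openin A U"
      have "openin (subtopology A (Aut1 m \<alpha>)) {a. (u, a) \<in> {x \<in> ?M \<times> Aut1 m \<alpha>. \<Phi> x \<in> U}}" if u: "u \<in> ?M" for u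
      proof -
        have "{a. (u, a) \<in> {x \<in> ?M \<times> Aut1 m \<alpha>. \<Phi> x \<in> U}} = {a \<in> Aut1 m \<alpha>. \<Phi> (u, a) \<in> U}" using u by auto
        also have "openin (subtopology A (Aut1 m \<alpha>)) \<dots>"
          unfolding sub_open using openin_Aut1_preimage[OF U, of "J u"] unfolding \<Phi>_slice[symmetric] by blast
        finally show ?thesis .
      qed
      then show "openin ?X {x \<in> ?M \<times> Aut1 m \<alpha>. \<Phi> x \<in> U}"
        unfolding openin_prod_discrete_left using sub by (auto simp: Int_absorb1)
    qed
    fix N assume N: "openin ?X N"
    then have N': "N \<subseteq> ?M \<times> Aut1 m \<alpha>" "\<And>u. u \<in> ?M \<Longrightarrow> openin A {a. (u, a) \<in> N} \<and> {a. (u, a) \<in> N} \<subseteq> Aut1 m \<alpha>"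
      unfolding openin_prod_discrete_left sub_open using sub by (auto simp: Int_absorb1)
    have "\<Phi> ` N = (\<Union>u\<in>?M. {E (J u) t s | t s. t \<noteq> 0 \<and> s ^ m = 1 \<and> E 0 t s \<in> {a. (u, a) \<in> N}})"
    proof (intro subset_antisym subsetI)
      fix f assume "f \<in> \<Phi> ` N"
      then obtain u a where ha: "(u, a) \<in> N" "f = \<Phi> (u, a)" by auto
      then have "u \<in> ?M" "a \<in> Aut1 m \<alpha>" using N'(1) by auto
      moreover obtain t s where "t \<noteq> 0" "s ^ m = 1" "a = E 0 t s" using \<open>a \<in> Aut1 m \<alpha>\<close> by (rule Aut1_E)
      ultimately show "f \<in> (\<Union>u\<in>?M. {E (J u) t s | t s. t \<noteq> 0 \<and> s ^ m = 1 \<and> E 0 t s \<in> {a. (u, a) \<in> N}})"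
        using ha by (intro UN_I[of u]) (auto simp: \<Phi>_E)
    next
      fix f assume "f \<in> (\<Union>u\<in>?M. {E (J u) t s | t s. t \<noteq> 0 \<and> s ^ m = 1 \<and> E 0 t s \<in> {a. (u, a) \<in> N}})"
      then obtain u t s where "(u, E 0 t s) \<in> N" "t \<noteq> 0" "s ^ m = 1" "f = E (J u) t s" by blast
      then show "f \<in> \<Phi> ` N" by (intro image_eqI[of _ _ "(u, E 0 t s)"]) (simp_all add: \<Phi>_E)
    qed
    moreover have "openin A (\<Union>u\<in>?M. {E (J u) t s | t s. t \<noteq> 0 \<and> s ^ m = 1 \<and> E 0 t s \<in> {a. (u, a) \<in> N}})"
      using openin_Aut1_translate N'(2) by (intro openin_Union) blast
    ultimately show "openin A (\<Phi> ` N)" by simp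
  qed (unfold top, rule \<Phi>_inj, rule \<Phi>_image)
  then show ?thesis unfolding top_mu by (simp add: topspace_A[symmetric])
qed

lemma \<Phi>_iso:
  "topological_group_iso (semidirect_product (mu m) N1 \<theta>)
     (prod_topology (top_of_set (carrier (mu m))) (subtopology A (Aut1 m \<alpha>))) G A \<Phi>"
  unfolding topological_group_iso_def
proof (intro conjI \<Phi>_homeomorphic)
  show "\<Phi> \<in> iso (semidirect_product (mu m) N1 \<theta>) G"
    unfolding iso_def carrier_semidirect
  proof (intro CollectI conjI homI)
    fix x y assume "x \<in> carrier (semidirect_product (mu m) N1 \<theta>)" "y \<in> carrier (semidirect_product (mu m) N1 \<theta>)"
    then obtain u a u' a' where "x = (u, a)" "y = (u', a')" "u ^ m = 1" "a \<in> Aut1 m \<alpha>" "u' ^ m = 1" "a' \<in> Aut1 m \<alpha>"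
      unfolding carrier_semidirect by auto
    then show "\<Phi> (x \<otimes>\<^bsub>semidirect_product (mu m) N1 \<theta>\<^esub> y) = \<Phi> x \<otimes>\<^bsub>G\<^esub> \<Phi> y"
      using \<Phi>_mult by (simp add: semidirect_product_def mu_def)
  qed (use \<Phi>_in_Aut \<Phi>_inj \<Phi>_image in \<open>auto simp: carrier_semidirect bij_betw_def\<close>)
qed

end

end

theorem theorem1p1:
  fixes m :: nat and \<alpha> :: complex
  assumes "m > 0" and "0 < cmod \<alpha>" and "cmod \<alpha> < 1"
  shows
   "Aut0 m \<alpha> = group_center (Aut_S m \<alpha>) \<and>
    (\<exists>\<phi>. topological_group_iso
            Cstar (top_of_set (carrier Cstar))
            ((Aut_S m \<alpha>)\<lparr>carrier := Aut0 m \<alpha>\<rparr>) (subtopology (Aut_S_top m \<alpha>) (Aut0 m \<alpha>)) \<phi>) \<and>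
    comm_group ((Aut_S m \<alpha>)\<lparr>carrier := Aut1 m \<alpha>\<rparr>) \<and>
    (\<exists>\<psi>. topological_group_iso
            (Cstar \<times>\<times> mu m) (prod_topology (top_of_set (carrier Cstar)) (top_of_set (carrier (mu m))))
            ((Aut_S m \<alpha>)\<lparr>carrier := Aut1 m \<alpha>\<rparr>) (subtopology (Aut_S_top m \<alpha>) (Aut1 m \<alpha>)) \<psi> \<and>
       (\<forall>\<zeta>\<in>carrier (mu m). generate (mu m) {\<zeta>} = carrier (mu m) \<longrightarrow>
          (\<exists>\<theta> \<Phi>.
             \<theta> \<in> hom (mu m) (AutoGroup ((Aut_S m \<alpha>)\<lparr>carrier := Aut1 m \<alpha>\<rparr>)) \<and>
             (\<forall>t\<in>carrier Cstar. \<forall>s\<in>carrier (mu m). \<theta> \<zeta> (\<psi> (t, s)) = \<psi> (s * t, s)) \<and>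
             topological_group_iso
               (semidirect_product (mu m) ((Aut_S m \<alpha>)\<lparr>carrier := Aut1 m \<alpha>\<rparr>) \<theta>)
               (prod_topology (top_of_set (carrier (mu m))) (subtopology (Aut_S_top m \<alpha>) (Aut1 m \<alpha>)))
               (Aut_S m \<alpha>) (Aut_S_top m \<alpha>) \<Phi> \<and>
             (\<forall>a\<in>Aut1 m \<alpha>. \<Phi> (1, a) = a))))"
proof -
  interpret inoue m \<alpha> by unfold_locales fact+
  show ?thesis
    using Aut0_center Aut0_iso comm_group_N1 \<psi>_iso \<theta>_hom \<theta>_\<psi> \<Phi>_iso \<Phi>_1 by blast
qed

end
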